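(* Let $\mathfrak{m}$ be the $-1$-eigenspace of the involution of $\mathfrak{su}(3)$ defining the Riemannian symmetric space $\mathrm{SU}(3)/\mathrm{SO}(3)$, and let $\{0\}\neq\mathfrak{m}'\subsetneq\mathfrak{m}$ be a linear subspace. Then $\mathfrak{m}'$ is a Lie triple system in $\mathfrak{m}$ if and only if there exist a maximal flat subspace $\mathfrak{a}\subset\mathfrak{m}$ and a system of simple roots $\{\alpha_1,\alpha_2\}$ in the root system $\Delta$ of $\mathfrak{su}(3)$ with respect to $\mathfrak{a}$ so that, with $\alpha_3:=\alpha_1+\alpha_2$ and with $H_k\in\mathfrak{a}$ and $M_{\alpha_k}(1)\in\mathfrak{m}$ ($k=1,2,3$) defined in relation to these $\alpha_k$ as in the context, $\mathfrak{m}'$ is of one of the following types: \begin{itemize} \item[(G)] $\mathfrak{m}'=\mathbb{R}H$ with some $H\in\mathfrak{a}$; \item[(T)] $\mathfrak{m}'=\mathfrak{a}$; \item[(S)] $\mathfrak{m}'=\mathbb{R}H_3\oplus\mathbb{R}M_{\alpha_3}(1)$; \item[(M)] $\mathfrak{m}'=\mathbb{R}H_3\oplus\mathbb{R}\,(M_{\alpha_1}(1)+M_{\alpha_2}(1))$; \item[(P)] $\mathfrak{m}'=\mathfrak{a}\oplus\mathbb{R}M_{\alpha_3}(1)$. \end{itemize} Two Lie triple systems of types other than (G) are congruent to each other under the isotropy action on $\mathfrak{m}$ if and only if they are of the same type. A Lie triple system $\{0\}\neq\mathfrak{m}'\subsetneq\mathfrak{m}$ is maximal (with respect to inclusion among the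 Lie triple systems different from $\mathfrak{m}$) if and only if it is either of type (P) or of type (M).
   Context: Let $\mathfrak{g}=\mathfrak{su}(3)$ and let $\sigma:\mathfrak{g}\to\mathfrak{g}$ be the involutive automorphism defining $\mathrm{SU}(3)/\mathrm{SO}(3)$ (entrywise complex conjugation), $\mathfrak{k}=\mathrm{Eig}(\sigma,1)=\mathfrak{so}(3)$, $\mathfrak{m}=\mathrm{Eig}(\sigma,-1)$. The isotropy action is the adjoint action of $\mathrm{SO}(3)$ on $\mathfrak{m}$. A linear subspace $\mathfrak{m}'\subset\mathfrak{m}$ is a Lie triple system if $R(u,v)w=-[[u,v],w]\in\mathfrak{m}'$ for all $u,v,w\in\mathfrak{m}'$. A flat subspace of $\mathfrak{m}$ is a linear subspace on which the Lie bracket vanishes. Let $\mathfrak{a}\subset\mathfrak{m}$ be a maximal flat subspace. It is 2-dimensional and is a Cartan subalgebra of $\mathfrak{g}$. Let $\Delta\subset(\mathfrak{a}^{\mathbb{C}})^*$ be the root system of $\mathfrak{g}^{\mathbb{C}}=\mathfrak{sl}(3,\mathbb{C})$ with respect to $\mathfrak{a}^{\mathbb{C}}$ (type $A_2$). Roots are purely imaginary on $\mathfrak{a}$, and $\alpha\circ\sigma=-\alpha$ for $\alpha\in\Delta$. Let $\{\alpha_1,\alpha_2\}$ be a system of simple roots and $\alpha_3:=\alpha_1+\alpha_2$, so $\Delta=\{\pm\alpha_1,\pm\alpha_2,\pm\alpha_3\}$. Let $\kappa$ be the ($\mathbb{C}$-bilinearly extended) Killing form, and use the inner product $-\kappa$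 on $\mathfrak{g}$. Define $H_k\in\mathfrak{a}$ by $-\kappa(H_k,\cdot)|_{\mathfrak{a}}=\tfrac1i\alpha_k|_{\mathfrak{a}}$. Let $X\mapsto\overline{X}$ be the conjugation of $\mathfrak{g}^{\mathbb{C}}$ with respect to $\mathfrak{g}$ and extend $\sigma$ complex-linearly to $\mathfrak{g}^{\mathbb{C}}$. For $\alpha\in\Delta$ let $\alpha^\sharp\in i\mathfrak{a}$ be the vector with $\kappa(\alpha^\sharp,H)=\alpha(H)$ for $H\in\mathfrak{a}$. A Chevalley basis is a choice of root vectors $X_\alpha$, $\alpha\in\Delta$, together with real constants $c_{\alpha,\beta}$ so that $[X_\alpha,X_\beta]=c_{\alpha,\beta}X_{\alpha+\beta}$ if $\alpha+\beta\in\Delta$, $[X_\alpha,X_{-\alpha}]=\alpha^\sharp$, $[X_\alpha,X_\beta]=0$ otherwise, and $c_{-\alpha,-\beta}=-c_{\alpha,\beta}$. Fix a Chevalley basis with $X_{-\alpha}=-\overline{X_\alpha}$ for all $\alpha$, $c_{\alpha_1,\alpha_2}>0$, and $\sigma(X_{\alpha_k})=X_{-\alpha_k}$ for $k=1,2$. Then $\sigma(X_{\alpha})=s_{\alpha}X_{-\alpha}$ with $s_\alpha\in\{\pm1\}$ for all $\alpha\in\Delta$. Put $V_\alpha(z):=\tfrac1{\sqrt2}(zX_\alpha-\overline{z}X_{-\alpha})$ for $z\in\mathbb{C}$, and $M_{\alpha}(1):=V_{\alpha}(1)$ if $s_{\alpha}=1$, $M_{\alpha}(1):=V_{\alpha}(i)$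 if $s_{\alpha}=-1$. Thus $\mathfrak{m}=\mathfrak{a}\oplus\bigoplus_{k=1}^3\mathbb{R}M_{\alpha_k}(1)$. *)

theory Defs
  imports "HOL-Analysis.Analysis" "HOL-Library.Function_Algebras"
begin

section \<open>Complex 3x3 matrices as a complex vector space\<close>

type_synonym cmat3 = "complex^3^3"

definition cscale :: "complex \<Rightarrow> cmat3 \<Rightarrow> cmat3" where
  "cscale c A = map_matrix (\<lambda>x. c * x) A"

lemma cscale_nth: "cscale c A $ i $ j = c * A $ i $ j"
  by (simp add: cscale_def map_matrix_def)

interpretation cmat: vector_space cscale
  by unfold_locales (simp_all add: vec_eq_iff cscale_nth algebra_simps)

text \<open>Trace of a complex-linear endomorphism \<open>f\<close> of a finite-dimensional complex
  subspace \<open>V\<close>, read off from a basis of \<open>V\<close> (the choice of basis is immaterial).\<close>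
definition endo_trace :: "cmat3 set \<Rightarrow> (cmat3 \<Rightarrow> cmat3) \<Rightarrow> complex" where
  "endo_trace V f =
    (let B = (SOME B. B \<subseteq> V \<and> cmat.independent B \<and> cmat.span B = V)
     in \<Sum>b\<in>B. cmat.representation B (f b) b)"

definition lie_bracket :: "cmat3 \<Rightarrow> cmat3 \<Rightarrow> cmat3" where
  "lie_bracket A B = A ** B - B ** A"

section \<open>The symmetric space SU(3)/SO(3)\<close>

definition conj_transpose :: "cmat3 \<Rightarrow> cmat3" where
  "conj_transpose A = map_matrix cnj (transpose A)"

definition su3 :: "cmat3 set" where
  "su3 = {A. conj_transpose A = - A \<and> trace A = 0}"

definition sigma :: "cmat3 \<Rightarrow> cmat3" where
  "sigma A = map_matrix cnj A"

definition su3_m :: "cmat3 set" where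
  "su3_m = {A \<in> su3. sigma A = - A}"

definition curv :: "cmat3 \<Rightarrow> cmat3 \<Rightarrow> cmat3 \<Rightarrow> cmat3" where
  "curv u v w = - lie_bracket (lie_bracket u v) w"

definition lie_triple_system :: "cmat3 set \<Rightarrow> bool" where
  "lie_triple_system n \<longleftrightarrow> subspace n \<and> n \<subseteq> su3_m \<and>
     (\<forall>u\<in>n. \<forall>v\<in>n. \<forall>w\<in>n. curv u v w \<in> n)"

definition maximal_lie_triple_system :: "cmat3 set \<Rightarrow> bool" where
  "maximal_lie_triple_system n \<longleftrightarrow> lie_triple_system n \<and> n \<noteq> su3_m \<and>
     (\<forall>n'. lie_triple_system n' \<and> n' \<noteq> su3_m \<and> n \<subseteq> n' \<longrightarrow> n' = n)"

definition flat_subspace :: "cmat3 set \<Rightarrow> bool" where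
  "flat_subspace a \<longleftrightarrow> subspace a \<and> a \<subseteq> su3_m \<and> (\<forall>u\<in>a. \<forall>v\<in>a. lie_bracket u v = 0)"

definition maximal_flat :: "cmat3 set \<Rightarrow> bool" where
  "maximal_flat a \<longleftrightarrow> flat_subspace a \<and> (\<forall>b. flat_subspace b \<and> a \<subseteq> b \<longrightarrow> b = a)"

definition Ad_SO3 :: "real^3^3 \<Rightarrow> cmat3 \<Rightarrow> cmat3" where
  "Ad_SO3 Q A = map_matrix complex_of_real Q ** A ** matrix_inv (map_matrix complex_of_real Q)"

definition isotropy_congruent :: "cmat3 set \<Rightarrow> cmat3 set \<Rightarrow> bool" where
  "isotropy_congruent n n' \<longleftrightarrow> (\<exists>Q. rotation_matrix Q \<and> n' = Ad_SO3 Q ` n)"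

section \<open>Complexification and Killing form\<close>

text \<open>The complexification of a real subspace of su(3); since su(3) is totally real
  inside the complex matrices it can be taken there.\<close>
definition complexification :: "cmat3 set \<Rightarrow> cmat3 set" where
  "complexification S = {A + cscale \<i> B |A B. A \<in> S \<and> B \<in> S}"

definition su3C :: "cmat3 set" where
  "su3C = complexification su3"

definition su3_Re :: "cmat3 \<Rightarrow> cmat3" where
  "su3_Re Z = (THE A. A \<in> su3 \<and> (\<exists>B\<in>su3. Z = A + cscale \<i> B))"

definition su3_Im :: "cmat3 \<Rightarrow> cmat3" where
  "su3_Im Z = (THE B. B \<in> su3 \<and> (\<exists>A\<in>su3. Z = A + cscale \<i> B))"

text \<open>Conjugation with respect to the real form su(3); not the entrywise conjugation.\<close>
definition conj_su3 :: "cmat3 \<Rightarrow> cmat3" where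
  "conj_su3 Z = su3_Re Z - cscale \<i> (su3_Im Z)"

text \<open>The complex-linear extension of \<^const>\<open>sigma\<close>, which is itself conjugate-linear
  on matrices.\<close>
definition sigmaC :: "cmat3 \<Rightarrow> cmat3" where
  "sigmaC Z = sigma (su3_Re Z) + cscale \<i> (sigma (su3_Im Z))"

definition killing :: "cmat3 \<Rightarrow> cmat3 \<Rightarrow> complex" where
  "killing A B = endo_trace su3C (\<lambda>Z. lie_bracket A (lie_bracket B Z))"

section \<open>Roots\<close>

type_synonym cfunctional = "cmat3 \<Rightarrow> complex"

text \<open>Linear functionals on a complex subspace \<open>V\<close> are represented by their extension
  by zero to all matrices.\<close>
definition dual_space :: "cmat3 set \<Rightarrow> cfunctional set" where
  "dual_space V = {f. (\<forall>A\<in>V. \<forall>B\<in>V. f (A + B) = f A + f B) \<and>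
     (\<forall>c. \<forall>A\<in>V. f (cscale c A) = c * f A) \<and> (\<forall>A. A \<notin> V \<longrightarrow> f A = 0)}"

definition root_space :: "cmat3 set \<Rightarrow> cfunctional \<Rightarrow> cmat3 set" where
  "root_space a \<alpha> = {Z \<in> su3C. \<forall>H\<in>complexification a. lie_bracket H Z = cscale (\<alpha> H) Z}"

definition roots :: "cmat3 set \<Rightarrow> cfunctional set" where
  "roots a = {\<alpha> \<in> dual_space (complexification a). \<alpha> \<noteq> 0 \<and> root_space a \<alpha> \<noteq> {0}}"

definition simple_system :: "cmat3 set \<Rightarrow> cfunctional set \<Rightarrow> bool" where
  "simple_system a S \<longleftrightarrow> finite S \<and> S \<subseteq> roots a \<and>
     (\<forall>u :: cfunctional \<Rightarrow> complex.
        (\<forall>H. (\<Sum>\<alpha>\<in>S. u \<alpha> * \<alpha> H) = 0) \<longrightarrow> (\<forall>\<alpha>\<in>S. u \<alpha> = 0)) \<and>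
     (\<forall>\<beta>\<in>roots a. \<exists>n :: cfunctional \<Rightarrow> nat.
        (\<forall>H. \<beta> H = (\<Sum>\<alpha>\<in>S. of_nat (n \<alpha>) * \<alpha> H)) \<or>
        (\<forall>H. \<beta> H = - (\<Sum>\<alpha>\<in>S. of_nat (n \<alpha>) * \<alpha> H)))"

text \<open>\<open>Hvec a \<alpha>\<^sub>k\<close> is the vector usually written \<open>H\<^sub>k\<close>.\<close>
definition Hvec :: "cmat3 set \<Rightarrow> cfunctional \<Rightarrow> cmat3" where
  "Hvec a \<alpha> = (THE H. H \<in> a \<and> (\<forall>A\<in>a. - killing H A = (1 / \<i>) * \<alpha> A))"

definition sharp :: "cmat3 set \<Rightarrow> cfunctional \<Rightarrow> cmat3" where
  "sharp a \<alpha> = (THE Z. Z \<in> cscale \<i> ` a \<and> (\<forall>H\<in>a. killing Z H = \<alpha> H))"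

section \<open>Chevalley bases\<close>

definition chevalley_basis ::
  "cmat3 set \<Rightarrow> (cfunctional \<Rightarrow> cmat3) \<Rightarrow> (cfunctional \<Rightarrow> cfunctional \<Rightarrow> real) \<Rightarrow> bool" where
  "chevalley_basis a X c \<longleftrightarrow>
     (\<forall>\<alpha>\<in>roots a. X \<alpha> \<in> root_space a \<alpha> \<and> X \<alpha> \<noteq> 0) \<and>
     (\<forall>\<alpha>\<in>roots a. \<forall>\<beta>\<in>roots a.
        lie_bracket (X \<alpha>) (X \<beta>) =
          (if \<alpha> + \<beta> \<in> roots a then c \<alpha> \<beta> *\<^sub>R X (\<alpha> + \<beta>)
           else if \<beta> = - \<alpha> then sharp a \<alpha> else 0)) \<and>
     (\<forall>\<alpha>\<in>roots a. \<forall>\<beta>\<in>roots a. \<alpha> + \<beta> \<in> roots a \<longrightarrow> c (- \<alpha>) (- \<beta>) = - c \<alpha> \<beta>)"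

text \<open>The normalisations imposed in addition on a Chevalley basis, relative to simple roots
  \<open>\<alpha>\<^sub>1\<close>, \<open>\<alpha>\<^sub>2\<close>. They leave the signs of the two simple root vectors free.\<close>
definition adapted_chevalley_basis ::
  "cmat3 set \<Rightarrow> cfunctional \<Rightarrow> cfunctional \<Rightarrow>
   (cfunctional \<Rightarrow> cmat3) \<Rightarrow> (cfunctional \<Rightarrow> cfunctional \<Rightarrow> real) \<Rightarrow> bool" where
  "adapted_chevalley_basis a \<alpha>1 \<alpha>2 X c \<longleftrightarrow> chevalley_basis a X c \<and>
     (\<forall>\<alpha>\<in>roots a. X (- \<alpha>) = - conj_su3 (X \<alpha>)) \<and> c \<alpha>1 \<alpha>2 > 0 \<and>
     sigmaC (X \<alpha>1) = X (- \<alpha>1) \<and> sigmaC (X \<alpha>2) = X (- \<alpha>2)"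

definition root_sign :: "(cfunctional \<Rightarrow> cmat3) \<Rightarrow> cfunctional \<Rightarrow> real" where
  "root_sign X \<alpha> = (THE s. s \<in> {1, -1} \<and> sigmaC (X \<alpha>) = s *\<^sub>R X (- \<alpha>))"

definition Vvec :: "(cfunctional \<Rightarrow> cmat3) \<Rightarrow> cfunctional \<Rightarrow> complex \<Rightarrow> cmat3" where
  "Vvec X \<alpha> z = (1 / sqrt 2) *\<^sub>R (cscale z (X \<alpha>) - cscale (cnj z) (X (- \<alpha>)))"

text \<open>\<open>Mvec X \<alpha>\<close> is the vector usually written \<open>M\<^sub>\<alpha>(1)\<close>.\<close>
definition Mvec :: "(cfunctional \<Rightarrow> cmat3) \<Rightarrow> cfunctional \<Rightarrow> cmat3" where
  "Mvec X \<alpha> = (if root_sign X \<alpha> = 1 then Vvec X \<alpha> 1 else Vvec X \<alpha> \<i>)"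

section \<open>The types of Lie triple systems\<close>

definition is_direct_sum :: "cmat3 set \<Rightarrow> cmat3 set \<Rightarrow> cmat3 set \<Rightarrow> bool" where
  "is_direct_sum W U V \<longleftrightarrow> W = {u + v |u v. u \<in> U \<and> v \<in> V} \<and> U \<inter> V = {0}"

datatype lts_type = TypeG | TypeT | TypeS | TypeM | TypeP

fun has_type_wrt ::
  "cmat3 set \<Rightarrow> cfunctional \<Rightarrow> cfunctional \<Rightarrow> (cfunctional \<Rightarrow> cmat3) \<Rightarrow> lts_type \<Rightarrow> cmat3 set \<Rightarrow> bool"
where
  "has_type_wrt a \<alpha>1 \<alpha>2 X TypeG n \<longleftrightarrow> (\<exists>H\<in>a. n = span {H})"
| "has_type_wrt a \<alpha>1 \<alpha>2 X TypeT n \<longleftrightarrow> n = a"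
| "has_type_wrt a \<alpha>1 \<alpha>2 X TypeS n \<longleftrightarrow>
     is_direct_sum n (span {Hvec a (\<alpha>1 + \<alpha>2)}) (span {Mvec X (\<alpha>1 + \<alpha>2)})"
| "has_type_wrt a \<alpha>1 \<alpha>2 X TypeM n \<longleftrightarrow>
     is_direct_sum n (span {Hvec a (\<alpha>1 + \<alpha>2)}) (span {Mvec X \<alpha>1 + Mvec X \<alpha>2})"
| "has_type_wrt a \<alpha>1 \<alpha>2 X TypeP n \<longleftrightarrow>
     is_direct_sum n a (span {Mvec X (\<alpha>1 + \<alpha>2)})"

text \<open>The Chevalley basis is quantified together with the flat and the simple roots: it is
  determined by them only up to the signs of the simple root vectors, on which
  \<open>M\<^sub>\<alpha>\<^sub>1(1) + M\<^sub>\<alpha>\<^sub>2(1)\<close> depends.\<close>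
definition has_type :: "lts_type \<Rightarrow> cmat3 set \<Rightarrow> bool" where
  "has_type t n \<longleftrightarrow> (\<exists>a \<alpha>1 \<alpha>2 X c.
     maximal_flat a \<and> \<alpha>1 \<noteq> \<alpha>2 \<and> simple_system a {\<alpha>1, \<alpha>2} \<and>
     adapted_chevalley_basis a \<alpha>1 \<alpha>2 X c \<and> has_type_wrt a \<alpha>1 \<alpha>2 X t n)"

section \<open>Consistency of the encodings\<close>

lemma su3_iff: "A \<in> su3 \<longleftrightarrow> (\<forall>i j. cnj (A $ j $ i) = - A $ i $ j) \<and> A$1$1 + A$2$2 + A$3$3 = 0"
  by (simp add: su3_def conj_transpose_def vec_eq_iff map_matrix_def transpose_def trace_def sum_3)

lemma trace_simps:
  "trace (A + B :: cmat3) = trace A + trace B" "trace (cscale c A) = c * trace A"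
  by (simp_all add: trace_def sum_3 cscale_nth algebra_simps)

lemma su3_decomposition:
  assumes "trace Z = 0"
  shows "(1/2) *\<^sub>R (Z - conj_transpose Z) \<in> su3"
    and "cscale (- \<i> / 2) (Z + conj_transpose Z) \<in> su3"
    and "Z = (1/2) *\<^sub>R (Z - conj_transpose Z) + cscale \<i> (cscale (- \<i> / 2) (Z + conj_transpose Z))"
proof -
  have tr: "Z$1$1 + Z$2$2 + Z$3$3 = 0" using assms by (simp add: trace_def sum_3)
  then have tr': "cnj (Z$1$1) + cnj (Z$2$2) + cnj (Z$3$3) = 0"
    by (metis complex_cnj_add complex_cnj_zero)
  have ct: "conj_transpose Z $ i $ j = cnj (Z $ j $ i)" for i j
    by (simp add: conj_transpose_def map_matrix_def transpose_def)
  have e1: "((1/2) *\<^sub>R (Z - conj_transpose Z)) $ i $ j = (Z $ i $ j - cnj (Z $ j $ i)) / 2" for i j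
    unfolding vector_scaleR_component vector_minus_component ct by (simp add: scaleR_conv_of_real)
  have e2: "cscale (- \<i> / 2) (Z + conj_transpose Z) $ i $ j = - \<i> / 2 * (Z $ i $ j + cnj (Z $ j $ i))"
    for i j by (simp add: ct cscale_nth)
  have s: "a + b + c - (a' + b' + c') = (a - a') + (b - b') + (c - c')" for a b c a' b' c' :: complex
    by simp
  show "(1/2) *\<^sub>R (Z - conj_transpose Z) \<in> su3"
    unfolding su3_iff e1
  proof (intro conjI allI)
    have "(Z$1$1 - cnj (Z$1$1)) + (Z$2$2 - cnj (Z$2$2)) + (Z$3$3 - cnj (Z$3$3)) = 0"
      using s[of "Z$1$1" "Z$2$2" "Z$3$3" "cnj (Z$1$1)" "cnj (Z$2$2)" "cnj (Z$3$3)"] tr tr' by simp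
    then show "(Z$1$1 - cnj (Z$1$1)) / 2 + (Z$2$2 - cnj (Z$2$2)) / 2 + (Z$3$3 - cnj (Z$3$3)) / 2 = 0"
      by (metis add_divide_distrib div_0)
  qed (simp add: field_simps)
  show "cscale (- \<i> / 2) (Z + conj_transpose Z) \<in> su3"
    unfolding su3_iff e2
  proof (intro conjI allI)
    have "- \<i> / 2 * (Z$1$1 + cnj (Z$1$1)) + - \<i> / 2 * (Z$2$2 + cnj (Z$2$2)) + - \<i> / 2 * (Z$3$3 + cnj (Z$3$3))
       = - \<i> / 2 * ((Z$1$1 + Z$2$2 + Z$3$3) + (cnj (Z$1$1) + cnj (Z$2$2) + cnj (Z$3$3)))"
      by (simp only: distrib_left add.assoc add.left_commute add.commute)
    then show "- \<i> / 2 * (Z$1$1 + cnj (Z$1$1)) + - \<i> / 2 * (Z$2$2 + cnj (Z$2$2))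
      + - \<i> / 2 * (Z$3$3 + cnj (Z$3$3)) = 0"
      by (simp add: tr tr')
  qed (simp add: field_simps)
  show "Z = (1/2) *\<^sub>R (Z - conj_transpose Z) + cscale \<i> (cscale (- \<i> / 2) (Z + conj_transpose Z))"
    unfolding vec_eq_iff vector_add_component e1 cscale_nth[of \<i>] e2
    by (simp add: field_simps)
qed

lemma su3C_eq: "su3C = {Z. trace Z = 0}"
proof
  show "su3C \<subseteq> {Z. trace Z = 0}"
    by (auto simp: su3C_def complexification_def su3_def trace_simps)
  show "{Z. trace Z = 0} \<subseteq> su3C"
    using su3_decomposition unfolding su3C_def complexification_def by blast
qed

lemma su3_Re_Im_unique:
  assumes "A \<in> su3" "B \<in> su3" "A' \<in> su3" "B' \<in> su3" "A + cscale \<i> B = A' + cscale \<i> B'"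
  shows "A = A'" "B = B'"
proof -
  have eq: "A$i$j + \<i> * B$i$j = A'$i$j + \<i> * B'$i$j" for i j
    using arg_cong[OF assms(5), of "\<lambda>M. M$i$j"] by (simp add: cscale_nth)
  have "A$i$j - \<i> * B$i$j = A'$i$j - \<i> * B'$i$j" for i j
    using arg_cong[OF eq[of j i], of cnj] assms(1-4)
    by (simp add: su3_iff algebra_simps)
  then have "A$i$j = A'$i$j \<and> B$i$j = B'$i$j" for i j
    using eq[of i j] by (smt (verit) add_diff_cancel_left' complex_i_not_zero
        diff_add_cancel mult_cancel_left add.commute add_diff_eq diff_diff_eq2 mult_2 zero_neq_numeral)
  then show "A = A'" "B = B'" by (simp_all add: vec_eq_iff)
qed

lemma su3_Re_Im:
  assumes "A \<in> su3" "B \<in> su3"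
  shows "su3_Re (A + cscale \<i> B) = A" "su3_Im (A + cscale \<i> B) = B"
  unfolding su3_Re_def su3_Im_def
  by (rule the_equality; use assms su3_Re_Im_unique in blast)+

lemma conj_su3_eq:
  assumes "Z \<in> su3C"
  shows "conj_su3 Z = - conj_transpose Z"
proof -
  obtain A B where AB: "A \<in> su3" "B \<in> su3" "Z = A + cscale \<i> B"
    using assms unfolding su3C_def complexification_def by blast
  show ?thesis
    unfolding AB(3) conj_su3_def su3_Re_Im[OF AB(1,2)] using AB(1,2)
    by (simp add: vec_eq_iff su3_iff conj_transpose_def map_matrix_def transpose_def cscale_nth)
qed

lemma sigmaC_eq:
  assumes "Z \<in> su3C"
  shows "sigmaC Z = - transpose Z"
proof -
  obtain A B where AB: "A \<in> su3" "B \<in> su3" "Z = A + cscale \<i> B"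
    using assms unfolding su3C_def complexification_def by blast
  show ?thesis
    unfolding AB(3) sigmaC_def su3_Re_Im[OF AB(1,2)] using AB(1,2)
    by (simp add: vec_eq_iff su3_iff sigma_def map_matrix_def transpose_def cscale_nth)
qed

end

theory Submission
  imports Defs
begin

text \<open>Multiplication by \<open>\<i>\<close> identifies \<open>su3_m\<close> with the traceless real symmetric \<open>3 \<times> 3\<close>
  matrices, on which the isotropy group acts by orthogonal conjugation and the maximal flats are
  the sets of matrices diagonal in a fixed orthonormal basis. Relative to such a basis the roots
  are the differences of diagonal entries, the normalisations of the Chevalley basis pin the
  simple root vectors down up to sign, and every type becomes an explicit model subspace up to
  orthogonal conjugation.

  For the classification, diagonalise a nonzero element \<open>H\<close> of a Lie triple system \<open>n\<close>.
  If \<open>n\<close> contains two independent commuting elements it contains all diagonal matrices in a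
  suitable basis, hence is a sum of off-diagonal root lines, of which there is at most one unless
  \<open>n = su3_m\<close>. Otherwise every element commuting with \<open>H\<close> is a multiple of \<open>H\<close>; applied to
  \<open>[[S, H], S]\<close> for \<open>S\<close> in an eigenspace of the squared adjoint action of \<open>H\<close>, this leaves only
  \<open>H\<close> proportional to \<open>diag (1, 0, -1)\<close> and the types S and M, or \<open>n = \<real>H\<close>. The types are told
  apart by flatness, the existence of a common kernel vector, and that of a common eigenvector.\<close>

section \<open>Orthogonal conjugation\<close>

text \<open>The obstacle is that a Chevalley basis is known only through its normalisations. On
  traceless matrices the Killing form is 6 times the trace form, so a root vector is
  \<open>x\<close> times a matrix unit with \<open>x * cnj x = 1 / 6\<close>. The condition on
  \<open>sigmaC\<close> makes \<open>x\<close> imaginary for the two simple roots. Their bracket is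
  then a real multiple of a matrix unit, and since the structure constants are real,
  \<open>x\<close> is real for the sum of the simple roots. Hence the sign of the third root is -1,
  and each of the three vectors M is \<open>\<i>\<close> times a real symmetric matrix with a single
  off-diagonal pair. What stays free is the relative sign of the two simple root vectors: it enters
  type M alone and is removed by the reflection diag(-1, 1, 1). Such a reflection is available
  because conjugation by \<open>- Q\<close> and by \<open>Q\<close> agree, so that O(3) may replace
  SO(3). Type G is left out of the congruence statement because the spectrum of H, up to scaling, is
  a continuous invariant of the line.\<close>

definition cmat_of_real :: "real^3^3 \<Rightarrow> cmat3" where
  "cmat_of_real = map_matrix complex_of_real"

text \<open>The transpose stands in for the inverse, so that linearity and
  \<open>conj_by_mult\<close> hold for every \<open>Q\<close>; for orthogonal \<open>Q\<close> this
  is the isotropy action (\<open>Ad_SO3_eq\<close>).\<close>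

definition conj_by :: "real^3^3 \<Rightarrow> cmat3 \<Rightarrow> cmat3" where
  "conj_by Q A = cmat_of_real Q ** A ** cmat_of_real (transpose Q)"

lemma cmat_of_real_nth [simp]: "cmat_of_real Q $ i $ j = complex_of_real (Q $ i $ j)"
  by (simp add: cmat_of_real_def map_matrix_def)

lemma cmat_of_real_mult: "cmat_of_real (Q ** R) = cmat_of_real Q ** cmat_of_real R"
  by (simp add: vec_eq_iff matrix_matrix_mult_def)

lemma cmat_of_real_1: "cmat_of_real (mat 1) = mat 1"
  by (simp add: vec_eq_iff mat_def)

lemma cmat_of_real_transpose: "cmat_of_real (transpose Q) = transpose (cmat_of_real Q)"
  by (simp add: vec_eq_iff transpose_def)

lemma conj_by_mult: "conj_by Q (conj_by R A) = conj_by (Q ** R) A"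
  by (simp add: conj_by_def cmat_of_real_mult matrix_transpose_mul matrix_mul_assoc)

lemma conj_by_1 [simp]: "conj_by (mat 1) A = A"
  by (simp add: conj_by_def cmat_of_real_1 transpose_mat)

lemma conj_by_inverse:
  assumes "orthogonal_matrix Q"
  shows "conj_by (transpose Q) (conj_by Q A) = A" "conj_by Q (conj_by (transpose Q) A) = A"
  using assms by (simp_all add: conj_by_mult orthogonal_matrix_def)

lemma conj_by_image_inverse:
  assumes "orthogonal_matrix Q"
  shows "conj_by (transpose Q) ` conj_by Q ` S = S" "conj_by Q ` conj_by (transpose Q) ` S = S"
  using assms by (simp_all add: conj_by_inverse image_image)

lemma conj_by_image_mult: "conj_by Q ` conj_by R ` S = conj_by (Q ** R) ` S"
  by (simp add: conj_by_mult image_image)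

lemma inj_conj_by: "orthogonal_matrix Q \<Longrightarrow> inj (conj_by Q)"
  by (metis conj_by_inverse(1) injI)

lemma conj_by_eq_iff: "orthogonal_matrix Q \<Longrightarrow> conj_by Q A = conj_by Q B \<longleftrightarrow> A = B"
  using inj_conj_by by (metis injD)

lemma conj_by_uminus_left: "conj_by (- Q) A = conj_by Q A"
  by (simp add: vec_eq_iff conj_by_def matrix_matrix_mult_def transpose_def sum_negf)

lemma conj_by_add: "conj_by Q (A + B) = conj_by Q A + conj_by Q B"
  by (simp add: conj_by_def matrix_matrix_mult_def vec_eq_iff sum_3 algebra_simps)

lemma conj_by_diff: "conj_by Q (A - B) = conj_by Q A - conj_by Q B"
  by (simp add: conj_by_def matrix_matrix_mult_def vec_eq_iff sum_3 algebra_simps)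

lemma conj_by_uminus: "conj_by Q (- A) = - conj_by Q A"
  by (simp add: conj_by_def matrix_matrix_mult_def vec_eq_iff sum_3 algebra_simps)

lemma conj_by_0 [simp]: "conj_by Q 0 = 0"
  by (simp add: conj_by_def)

lemma conj_by_cscale: "conj_by Q (cscale c A) = cscale c (conj_by Q A)"
  by (simp add: conj_by_def matrix_matrix_mult_def vec_eq_iff sum_3 algebra_simps cscale_nth)

lemma scaleR_eq_cscale: "r *\<^sub>R A = cscale (complex_of_real r) A"
  unfolding vec_eq_iff cscale_nth vector_scaleR_component by (simp add: scaleR_conv_of_real)

lemma conj_by_scaleR: "conj_by Q (r *\<^sub>R A) = r *\<^sub>R conj_by Q A"
  by (simp add: scaleR_eq_cscale conj_by_cscale)

lemma conj_by_eq_0_iff: "orthogonal_matrix Q \<Longrightarrow> conj_by Q A = 0 \<longleftrightarrow> A = 0"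
  using conj_by_eq_iff[of Q A 0] by simp

lemma linear_conj_by: "linear (conj_by Q)"
  by (simp add: linearI conj_by_add conj_by_scaleR)

lemma conj_by_times:
  assumes "orthogonal_matrix Q"
  shows "conj_by Q (A ** B) = conj_by Q A ** conj_by Q B"
proof -
  have "cmat_of_real (transpose Q) ** cmat_of_real Q = mat 1"
    using assms by (simp add: orthogonal_matrix_def flip: cmat_of_real_mult cmat_of_real_1)
  then show ?thesis
    unfolding conj_by_def by (metis (no_types) matrix_mul_assoc matrix_mul_lid)
qed

lemma conj_by_lie_bracket:
  "orthogonal_matrix Q \<Longrightarrow> conj_by Q (lie_bracket A B) = lie_bracket (conj_by Q A) (conj_by Q B)"
  by (simp add: lie_bracket_def conj_by_diff conj_by_times)

lemma conj_by_curv: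
  "orthogonal_matrix Q \<Longrightarrow> conj_by Q (curv u v w) = curv (conj_by Q u) (conj_by Q v) (conj_by Q w)"
  by (simp add: curv_def conj_by_uminus conj_by_lie_bracket)

lemma trace_conj_by: "orthogonal_matrix Q \<Longrightarrow> trace (conj_by Q A) = trace A"
  unfolding conj_by_def
  by (simp add: trace_mul_sym[of _ "cmat_of_real (transpose Q)"] matrix_mul_assoc orthogonal_matrix_def
      cmat_of_real_1 flip: cmat_of_real_mult)

lemma transpose_conj_by: "transpose (conj_by Q A) = conj_by Q (transpose A)"
  by (simp add: conj_by_def matrix_transpose_mul cmat_of_real_transpose matrix_mul_assoc)

lemma sigma_conj_by: "sigma (conj_by Q A) = conj_by Q (sigma A)"
  by (simp add: sigma_def conj_by_def map_matrix_def matrix_matrix_mult_def vec_eq_iff)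

lemma conj_transpose_eq: "conj_transpose A = sigma (transpose A)"
  by (simp add: conj_transpose_def sigma_def)

lemma conj_transpose_conj_by: "conj_transpose (conj_by Q A) = conj_by Q (conj_transpose A)"
  by (simp add: conj_transpose_eq transpose_conj_by sigma_conj_by)

lemma conj_by_in_su3_m: "orthogonal_matrix Q \<Longrightarrow> A \<in> su3_m \<Longrightarrow> conj_by Q A \<in> su3_m"
  by (simp add: su3_m_def su3_def conj_transpose_conj_by sigma_conj_by trace_conj_by conj_by_uminus)

lemma orthogonal_transpose: "orthogonal_matrix Q \<Longrightarrow> orthogonal_matrix (transpose Q)"
  by simp

lemma conj_by_image_su3_m: "orthogonal_matrix Q \<Longrightarrow> conj_by Q ` su3_m = su3_m"
  by (force simp: conj_by_in_su3_m image_iff conj_by_inverse intro: bexI[of _ "conj_by (transpose Q) _"])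

lemma conj_by_in_su3C_iff: "orthogonal_matrix Q \<Longrightarrow> conj_by Q A \<in> su3C \<longleftrightarrow> A \<in> su3C"
  by (simp add: su3C_eq trace_conj_by)

lemma Ad_SO3_eq:
  assumes "orthogonal_matrix Q"
  shows "Ad_SO3 Q = conj_by Q"
proof -
  have "cmat_of_real Q ** cmat_of_real (transpose Q) = mat 1"
    "cmat_of_real (transpose Q) ** cmat_of_real Q = mat 1"
    using assms by (simp_all add: orthogonal_matrix_def flip: cmat_of_real_mult cmat_of_real_1)
  then have "matrix_inv (cmat_of_real Q) = cmat_of_real (transpose Q)"
    unfolding matrix_inv_def
    by (intro some_equality) (auto, metis matrix_mul_assoc matrix_mul_lid matrix_mul_rid)
  then show ?thesis
    by (auto simp: fun_eq_iff Ad_SO3_def conj_by_def cmat_of_real_def)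
qed

lemma lie_triple_system_conj_by:
  assumes "orthogonal_matrix Q" "lie_triple_system n"
  shows "lie_triple_system (conj_by Q ` n)"
  using assms
  by (auto simp: lie_triple_system_def conj_by_in_su3_m subset_iff linear_subspace_image[OF linear_conj_by]
      simp flip: conj_by_curv)

lemma lie_triple_system_conj_by_iff:
  "orthogonal_matrix Q \<Longrightarrow> lie_triple_system (conj_by Q ` n) \<longleftrightarrow> lie_triple_system n"
  using lie_triple_system_conj_by[of Q n] lie_triple_system_conj_by[of "transpose Q" "conj_by Q ` n"]
  by (auto simp: conj_by_image_inverse)

lemma flat_subspace_conj_by:
  assumes "orthogonal_matrix Q" "flat_subspace n"
  shows "flat_subspace (conj_by Q ` n)"
  using assms
  by (auto simp: flat_subspace_def conj_by_in_su3_m subset_iff linear_subspace_image[OF linear_conj_by]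
      simp flip: conj_by_lie_bracket)

lemma flat_subspace_conj_by_iff:
  "orthogonal_matrix Q \<Longrightarrow> flat_subspace (conj_by Q ` n) \<longleftrightarrow> flat_subspace n"
  using flat_subspace_conj_by[of Q n] flat_subspace_conj_by[of "transpose Q" "conj_by Q ` n"]
  by (auto simp: conj_by_image_inverse)

text \<open>In dimension 3, \<open>det (- Q) = - det Q\<close>, and conjugation is even in
  \<open>Q\<close>; so one of \<open>Q\<close>, \<open>- Q\<close> is a rotation inducing the same
  map.\<close>

lemma isotropy_congruent_iff:
  "isotropy_congruent n n' \<longleftrightarrow> (\<exists>Q. orthogonal_matrix Q \<and> n' = conj_by Q ` n)"
proof
  assume "isotropy_congruent n n'"
  then show "\<exists>Q. orthogonal_matrix Q \<and> n' = conj_by Q ` n"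
    by (auto simp: isotropy_congruent_def rotation_matrix_def Ad_SO3_eq)
next
  assume "\<exists>Q. orthogonal_matrix Q \<and> n' = conj_by Q ` n"
  then obtain Q where Q: "orthogonal_matrix Q" "n' = conj_by Q ` n" by blast
  have "orthogonal_matrix (- Q)"
    using Q(1) by (simp add: orthogonal_matrix_def vec_eq_iff matrix_matrix_mult_def transpose_def)
  moreover have "det (- Q) = - det Q"
    by (simp add: det_3)
  moreover have "conj_by (- Q) = conj_by Q"
    by (simp add: fun_eq_iff conj_by_uminus_left)
  moreover have "det Q = 1 \<or> det Q = - 1"
    using det_orthogonal_matrix[OF Q(1)] .
  ultimately have "rotation_matrix Q \<or> rotation_matrix (- Q) \<and> conj_by (- Q) = conj_by Q"
    using Q(1) by (auto simp: rotation_matrix_def)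
  then obtain R where R: "rotation_matrix R" "conj_by R = conj_by Q"
    by blast
  then have "n' = Ad_SO3 R ` n"
    using Q(2) by (simp add: Ad_SO3_eq rotation_matrix_def)
  then show "isotropy_congruent n n'"
    using R(1) by (auto simp: isotropy_congruent_def)
qed

section \<open>Coordinates on the tangent space\<close>

text \<open>The coordinates on \<open>su3_m\<close>: \<open>isym x y a b c\<close> is \<open>\<i>\<close> times the symmetric matrix with
  diagonal \<open>x, y, - x - y\<close> and off-diagonal entries \<open>a = s\<^sub>1\<^sub>2\<close>, \<open>b = s\<^sub>1\<^sub>3\<close>, \<open>c = s\<^sub>2\<^sub>3\<close>.\<close>
definition isym :: "real \<Rightarrow> real \<Rightarrow> real \<Rightarrow> real \<Rightarrow> real \<Rightarrow> cmat3" where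
  "isym x y a b c = vector
     [vector [\<i> * complex_of_real x, \<i> * complex_of_real a, \<i> * complex_of_real b],
      vector [\<i> * complex_of_real a, \<i> * complex_of_real y, \<i> * complex_of_real c],
      vector [\<i> * complex_of_real b, \<i> * complex_of_real c, \<i> * complex_of_real (- x - y)]]"

text \<open>The isotropy algebra so(3): brackets of two elements of \<open>su3_m\<close> land here,
  and a further bracket with \<open>su3_m\<close> leads back
  (\<open>lie_bracket_rskew_isym\<close>).\<close>

definition rskew :: "real \<Rightarrow> real \<Rightarrow> real \<Rightarrow> cmat3" where
  "rskew p q r = vector
     [vector [0, complex_of_real p, complex_of_real q],
      vector [- complex_of_real p, 0, complex_of_real r],
      vector [- complex_of_real q, - complex_of_real r, 0]]"

lemma isym_nth [simp]:
  "isym x y a b c $ 1 $ 1 = \<i> * complex_of_real x" "isym x y a b c $ 1 $ 2 = \<i> * complex_of_real a"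
  "isym x y a b c $ 1 $ 3 = \<i> * complex_of_real b" "isym x y a b c $ 2 $ 1 = \<i> * complex_of_real a"
  "isym x y a b c $ 2 $ 2 = \<i> * complex_of_real y" "isym x y a b c $ 2 $ 3 = \<i> * complex_of_real c"
  "isym x y a b c $ 3 $ 1 = \<i> * complex_of_real b" "isym x y a b c $ 3 $ 2 = \<i> * complex_of_real c"
  "isym x y a b c $ 3 $ 3 = \<i> * complex_of_real (- x - y)"
  by (simp_all add: isym_def)

lemma rskew_nth [simp]:
  "rskew p q r $ 1 $ 1 = 0" "rskew p q r $ 1 $ 2 = complex_of_real p"
  "rskew p q r $ 1 $ 3 = complex_of_real q" "rskew p q r $ 2 $ 1 = - complex_of_real p"
  "rskew p q r $ 2 $ 2 = 0" "rskew p q r $ 2 $ 3 = complex_of_real r"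
  "rskew p q r $ 3 $ 1 = - complex_of_real q" "rskew p q r $ 3 $ 2 = - complex_of_real r"
  "rskew p q r $ 3 $ 3 = 0"
  by (simp_all add: rskew_def)

lemma isym_eq_iff [simp]:
  "isym x y a b c = isym x' y' a' b' c' \<longleftrightarrow> x = x' \<and> y = y' \<and> a = a' \<and> b = b' \<and> c = c'"
  by (auto simp add: vec_eq_iff forall_3 simp del: of_real_add of_real_diff of_real_minus)

lemma isym_0: "0 = isym 0 0 0 0 0"
  by (simp add: vec_eq_iff forall_3)

lemma isym_eq_0_iff [simp]: "isym x y a b c = 0 \<longleftrightarrow> x = 0 \<and> y = 0 \<and> a = 0 \<and> b = 0 \<and> c = 0"
  by (simp add: isym_0)

lemma isym_add: "isym x y a b c + isym x' y' a' b' c' = isym (x + x') (y + y') (a + a') (b + b') (c + c')"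
  by (simp add: vec_eq_iff forall_3 algebra_simps)

lemma isym_diff: "isym x y a b c - isym x' y' a' b' c' = isym (x - x') (y - y') (a - a') (b - b') (c - c')"
  by (simp add: vec_eq_iff forall_3 algebra_simps)

lemma isym_scaleR: "r *\<^sub>R isym x y a b c = isym (r * x) (r * y) (r * a) (r * b) (r * c)"
  by (simp add: scaleR_eq_cscale vec_eq_iff forall_3 cscale_nth algebra_simps)

lemma su3_m_eq: "su3_m = {isym x y a b c | x y a b c. True}"
proof -
  have "A = isym (Im (A$1$1)) (Im (A$2$2)) (Im (A$1$2)) (Im (A$1$3)) (Im (A$2$3))" if "A \<in> su3_m" for A
  proof -
    have 1: "cnj (A$j$i) = - (A$i$j)" "cnj (A$i$j) = - (A$i$j)" and 2: "A$1$1 + A$2$2 + A$3$3 = 0" for i j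
      using that by (auto simp: su3_m_def su3_iff sigma_def vec_eq_iff map_matrix_def)
    have 3: "A$i$j = A$j$i" "Re (A$i$j) = 0" for i j
      using 1[where i=i and j=j] by (auto simp: complex_eq_iff)
    have "Im (A$3$3) = - Im (A$1$1) - Im (A$2$2)"
      using arg_cong[OF 2, of Im] by simp
    then show ?thesis
      using 3(1)[of 2 1] 3(1)[of 3 1] 3(1)[of 3 2]
      by (simp add: vec_eq_iff forall_3 complex_eq_iff 3(2) del: of_real_diff of_real_minus)
  qed
  moreover have "isym x y a b c \<in> su3_m" for x y a b c
    by (auto simp: su3_m_def su3_iff sigma_def vec_eq_iff map_matrix_def forall_3 algebra_simps)
  ultimately show ?thesis by blast
qed

lemma isym_in_su3_m [simp]: "isym x y a b c \<in> su3_m"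
  by (auto simp: su3_m_eq)

lemma lie_bracket_isym:
  "lie_bracket (isym x y a b c) (isym x' y' a' b' c') =
     rskew (x' * a + a' * y + b' * c - x * a' - a * y' - b * c')
           (x' * b + a' * c + b' * (- x - y) - x * b' - a * c' - b * (- x' - y'))
           (a' * b + y' * c + c' * (- x - y) - a * b' - y * c' - c * (- x' - y'))"
  unfolding vec_eq_iff forall_3 lie_bracket_def vector_minus_component matrix_matrix_mult_def
  by (simp add: sum_3 algebra_simps complex_eq_iff)

lemma lie_bracket_rskew_isym:
  "lie_bracket (rskew p q r) (isym x y a b c) =
     isym (2 * (p * a + q * b)) (2 * (r * c - p * a))
          (p * y + q * c - p * x + r * b) (p * c - q * (x + y) - q * x - a * r)
          (- p * b - r * (x + y) - a * q - y * r)"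
  unfolding vec_eq_iff forall_3 lie_bracket_def vector_minus_component matrix_matrix_mult_def
  by (simp add: sum_3 algebra_simps complex_eq_iff)

lemma rskew_eq_0_iff [simp]: "rskew p q r = 0 \<longleftrightarrow> p = 0 \<and> q = 0 \<and> r = 0"
  by (auto simp add: vec_eq_iff forall_3)

lemma isym_uminus: "- isym x y a b c = isym (- x) (- y) (- a) (- b) (- c)"
  by (simp add: vec_eq_iff forall_3 algebra_simps)

section \<open>Simultaneous diagonalisation\<close>

text \<open>A maximiser of the Rayleigh quotient on the unit sphere of \<open>V\<close> is an
  eigenvector. Invariance puts the residual \<open>l *\<^sub>R v - S *v v\<close> into
  \<open>V\<close>, so it is an admissible direction of variation.\<close>

lemma symmetric_matrix_eigenvector_in_subspace:
  fixes S :: "real^'n^'n"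
  assumes sym: "transpose S = S" and V: "subspace V" "V \<noteq> {0}" and inv: "\<And>v. v \<in> V \<Longrightarrow> S *v v \<in> V"
  obtains v l where "v \<in> V" "norm v = 1" "S *v v = l *\<^sub>R v"
proof -
  have adj: "u \<bullet> (S *v w) = (S *v u) \<bullet> w" for u w
    using dot_lmul_matrix[of u S w] by (simp add: sym flip: transpose_matrix_vector)
  define g where "g w = w \<bullet> (S *v w)" for w
  obtain w where w: "w \<in> V" "w \<noteq> 0"
    using V subspace_0 by fastforce
  let ?K = "V \<inter> sphere 0 1"
  have "(1 / norm w) *\<^sub>R w \<in> ?K"
    using w V(1) by (auto simp: subspace_scale)
  then have "?K \<noteq> {}" by blast
  moreover have "compact ?K"
    using closed_subspace[OF V(1)] compact_Int_closed[of "sphere 0 1" V] by (simp add: Int_commute)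
  moreover have "continuous_on ?K g"
    unfolding g_def by (intro continuous_intros linear_continuous_on linear_linear[THEN iffD2] matrix_vector_mul_linear)
  ultimately obtain v where v: "v \<in> ?K" and max: "\<And>u. u \<in> ?K \<Longrightarrow> g u \<le> g v"
    using continuous_attains_sup[of ?K g] by blast
  define l where "l = g v"
  \<comment> \<open>Maximality in homogeneous form: \<open>h\<close> is a quadratic form,
    nonnegative on \<open>V\<close>, that vanishes at \<open>v\<close>.\<close>
  define h where "h u = l * (u \<bullet> u) - g u" for u
  have h_ge: "h u \<ge> 0" if "u \<in> V" for u
  proof (cases "u = 0")
    case False
    have "(1 / norm u) *\<^sub>R u \<in> ?K"
      using False that V(1) by (auto simp: subspace_scale)
    from max[OF this] have "g u / (norm u)^2 \<le> l"
      by (simp add: g_def l_def matrix_vector_mult_scaleR power2_eq_square)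
    then show ?thesis
      using False by (simp add: h_def dot_square_norm divide_le_eq)
  qed (simp add: h_def g_def)
  have vv: "v \<bullet> v = 1"
    using v by (simp add: dot_square_norm)
  \<comment> \<open>Half the gradient of \<open>h\<close> at \<open>v\<close>.\<close>
  define u where "u = l *\<^sub>R v - S *v v"
  have u: "u \<in> V"
    unfolding u_def using v V(1) inv by (auto intro: subspace_diff subspace_scale)
  have quad: "h (v + t *\<^sub>R u) = 2 * t * (u \<bullet> u) + t^2 * h u" for t
  proof -
    have "h (v + t *\<^sub>R u) = h v + 2 * t * (l * (v \<bullet> u) - (S *v v) \<bullet> u) + t^2 * h u"
      using adj[of v u] by (simp add: h_def g_def inner_add_left inner_add_right matrix_vector_right_distrib
          matrix_vector_mult_scaleR inner_commute power2_eq_square algebra_simps)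
    moreover have "h v = 0"
      by (simp add: h_def l_def vv)
    moreover have "l * (v \<bullet> u) - (S *v v) \<bullet> u = u \<bullet> u"
      by (simp add: u_def inner_diff_left)
    ultimately show ?thesis by simp
  qed
  define c where "c = h u"
  have "c \<ge> 0"
    using h_ge u by (simp add: c_def)
  have "u \<bullet> u \<le> 0"
  proof (rule ccontr)
    assume "\<not> u \<bullet> u \<le> 0"
    \<comment> \<open>A step against the gradient, short enough for the linear term to win; the
      \<open>+ 1\<close> keeps the denominator positive when \<open>c = 0\<close>.\<close>
    define t where "t = - (u \<bullet> u) / (c + 1)"
    have "t * (2 * (u \<bullet> u) + t * c) \<ge> 0"
      using h_ge[of "v + t *\<^sub>R u"] u v V(1) quad[of t]
      by (auto intro: subspace_add subspace_scale simp: c_def power2_eq_square algebra_simps)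
    moreover have "t < 0"
      using \<open>\<not> u \<bullet> u \<le> 0\<close> \<open>c \<ge> 0\<close> unfolding t_def by (intro divide_neg_pos) linarith+
    moreover have "2 * (u \<bullet> u) + t * c = (u \<bullet> u) * (c + 2) / (c + 1)"
      using \<open>c \<ge> 0\<close> by (simp add: t_def field_simps)
    moreover have "(u \<bullet> u) * (c + 2) / (c + 1) > 0"
      using \<open>\<not> u \<bullet> u \<le> 0\<close> \<open>c \<ge> 0\<close> by (intro divide_pos_pos mult_pos_pos) linarith+
    ultimately show False
      using mult_neg_pos by fastforce
  qed
  then have "u = 0"
    by (metis inner_eq_zero_iff inner_ge_zero order_antisym)
  then show ?thesis
    using that[of v l] v by (simp add: u_def)
qed

text \<open>\<open>T\<close> commutes with \<open>S\<close>, so it preserves the eigenspace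
  \<open>W\<close> of \<open>S\<close> inside \<open>V\<close>; an eigenvector of \<open>T\<close>
  in \<open>W\<close> is a joint one.\<close>

lemma commuting_symmetric_eigenvector_in_subspace:
  fixes S T :: "real^'n^'n"
  assumes "transpose S = S" "transpose T = T" "S ** T = T ** S" "subspace V" "V \<noteq> {0}"
    and invS: "\<And>v. v \<in> V \<Longrightarrow> S *v v \<in> V" and invT: "\<And>v. v \<in> V \<Longrightarrow> T *v v \<in> V"
  obtains v l k where "v \<in> V" "norm v = 1" "S *v v = l *\<^sub>R v" "T *v v = k *\<^sub>R v"
proof -
  obtain u l where u: "u \<in> V" "norm u = 1" "S *v u = l *\<^sub>R u"
    using symmetric_matrix_eigenvector_in_subspace[OF assms(1,4,5) invS] by blast
  define W where "W = {w \<in> V. S *v w = l *\<^sub>R w}"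
  have "subspace W"
    using assms(4) by (auto simp: W_def subspace_def matrix_vector_right_distrib
        matrix_vector_mult_scaleR scaleR_right_distrib)
  moreover have "u \<in> W" "u \<noteq> 0"
    using u by (auto simp: W_def)
  then have "W \<noteq> {0}"
    by blast
  moreover have "T *v w \<in> W" if "w \<in> W" for w
  proof -
    have "S *v (T *v w) = T *v (S *v w)"
      by (simp add: matrix_vector_mul_assoc assms(3))
    then show ?thesis
      using that invT by (simp add: W_def matrix_vector_mult_scaleR)
  qed
  ultimately obtain v k where "v \<in> W" "norm v = 1" "T *v v = k *\<^sub>R v"
    using symmetric_matrix_eigenvector_in_subspace[OF assms(2)] by blast
  then show ?thesis
    using that by (auto simp: W_def)
qed

lemma commuting_symmetric_diagonalizable_3:
  fixes S T :: "real^3^3"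
  assumes sym: "transpose S = S" "transpose T = T" and comm: "S ** T = T ** S"
  obtains Q where "orthogonal_matrix Q" "\<And>i j. i \<noteq> j \<Longrightarrow> (transpose Q ** S ** Q) $ i $ j = 0"
    "\<And>i j. i \<noteq> j \<Longrightarrow> (transpose Q ** T ** Q) $ i $ j = 0"
proof -
  have adj: "u \<bullet> (A *v w) = (A *v u) \<bullet> w" if "transpose A = A" for u w and A :: "real^3^3"
    using dot_lmul_matrix[of u A w] by (simp add: that flip: transpose_matrix_vector)
  obtain v1 l1 k1 where v1: "norm v1 = 1" "S *v v1 = l1 *\<^sub>R v1" "T *v v1 = k1 *\<^sub>R v1"
    using commuting_symmetric_eigenvector_in_subspace[OF sym comm subspace_UNIV, of thesis]
      UNIV_not_singleton[of "0::real^3"] by auto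
  let ?V = "{v. v1 \<bullet> v = 0}"
  have "\<exists>v. v \<in> ?V \<and> v \<noteq> 0"
    using orthogonal_to_vector_exists[of v1] by (auto simp: orthogonal_def)
  then have "?V \<noteq> {0}" by blast
  moreover have "subspace ?V" by (rule subspace_hyperplane)
  moreover have inv: "A *v v \<in> ?V" if "transpose A = A" "A *v v1 = m *\<^sub>R v1" "v \<in> ?V" for A m v
    using that adj[of A v1 v] by simp
  ultimately obtain v2 l2 k2 where "v2 \<in> ?V" and v2': "norm v2 = 1" "S *v v2 = l2 *\<^sub>R v2" "T *v v2 = k2 *\<^sub>R v2"
    using commuting_symmetric_eigenvector_in_subspace[OF sym comm _ _ inv[OF sym(1) v1(2)] inv[OF sym(2) v1(3)]]
    by metis
  then have v2: "v1 \<bullet> v2 = 0" "norm v2 = 1" "S *v v2 = l2 *\<^sub>R v2" "T *v v2 = k2 *\<^sub>R v2"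
    by auto
  \<comment> \<open>No eigenvector property of \<open>v3\<close> is established: symmetry of the
    matrices alone makes the off-diagonal entries involving it vanish.\<close>
  define v3 where "v3 = cross3 v1 v2"
  have v3: "v1 \<bullet> v3 = 0" "v2 \<bullet> v3 = 0" "norm v3 = 1"
    using v1(1) v2 norm_cross_dot[of v1 v2]
    by (auto simp: v3_def dot_cross_self power2_eq_1_iff) (smt (verit) norm_ge_zero)
  define Q :: "real^3^3" where "Q = (\<chi> i j. (if j = 1 then v1 else if j = 2 then v2 else v3) $ i)"
  have col: "column j Q = (if j = 1 then v1 else if j = 2 then v2 else v3)" for j
    by (simp add: Q_def column_def vec_eq_iff)
  have entry: "(transpose Q ** A ** Q) $ i $ j = column i Q \<bullet> (A *v column j Q)" for A i j
    by (simp add: matrix_matrix_mult_def matrix_vector_mult_def column_def transpose_def inner_vec_def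
        sum_3 algebra_simps)
  have entry1: "(transpose Q ** Q) $ i $ j = column i Q \<bullet> column j Q" for i j
    by (simp add: matrix_matrix_mult_def column_def transpose_def inner_vec_def)
  have "orthogonal_matrix Q"
    using v1(1) v2(1,2) v3
    by (simp add: orthogonal_matrix vec_eq_iff entry1 col mat_def forall_3 inner_commute dot_square_norm)
  moreover have off: "(transpose Q ** A ** Q) $ i $ j = 0"
    if "i \<noteq> j" "transpose A = A" "A *v v1 = l *\<^sub>R v1" "A *v v2 = k *\<^sub>R v2" for A i j l k
  proof -
    have *: "v1 \<bullet> (A *v v3) = 0" "v2 \<bullet> (A *v v3) = 0"
      using adj[OF that(2)] that(3,4) v3 by simp_all
    show ?thesis
      using that(1) * v2(1) v3(1,2) exhaust_3[of i] exhaust_3[of j]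
      by (auto simp: entry col that(3,4) inner_commute[of v2 v1] inner_commute[of v3])
  qed
  ultimately show ?thesis
    using that[of Q, OF _ off[OF _ sym(1) v1(2) v2(3)] off[OF _ sym(2) v1(3) v2(4)]] by simp
qed

text \<open>Removing the factor \<open>\<i>\<close> only changes the sign of products, so
  commutation descends to the real symmetric matrices. With \<open>B = A\<close> this is the
  spectral theorem for one element.\<close>

lemma commuting_su3_m_diagonalizable:
  assumes "A \<in> su3_m" "B \<in> su3_m" "lie_bracket A B = 0"
  obtains Q x y x' y' where "orthogonal_matrix Q"
    "A = conj_by Q (isym x y 0 0 0)" "B = conj_by Q (isym x' y' 0 0 0)"
proof -
  define re where "re C = (\<chi> i j. Im (C$i$j))" for C :: cmat3
  have re: "C = cscale \<i> (cmat_of_real (re C))" "transpose (re C) = re C" if "C \<in> su3_m" for C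
    using that by (auto simp: su3_m_eq vec_eq_iff forall_3 cscale_nth re_def transpose_def)
  have "re A ** re B = re B ** re A"
  proof -
    have *: "cscale \<i> (cmat_of_real R) ** cscale \<i> (cmat_of_real R') = - cmat_of_real (R ** R')" for R R'
      by (simp add: vec_eq_iff matrix_matrix_mult_def cscale_nth sum_3 algebra_simps complex_eq_iff)
    have "A ** B = B ** A"
      using assms(3) by (simp add: lie_bracket_def)
    then have "- cmat_of_real (re A ** re B) = - cmat_of_real (re B ** re A)"
      unfolding *[symmetric] re(1)[OF assms(1), symmetric] re(1)[OF assms(2), symmetric] .
    then have "cmat_of_real (re A ** re B) = cmat_of_real (re B ** re A)"
      by simp
    then show ?thesis
      by (simp add: vec_eq_iff)
  qed
  then obtain Q where Q: "orthogonal_matrix Q"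
    "\<And>i j. i \<noteq> j \<Longrightarrow> (transpose Q ** re A ** Q) $ i $ j = 0"
    "\<And>i j. i \<noteq> j \<Longrightarrow> (transpose Q ** re B ** Q) $ i $ j = 0"
    using commuting_symmetric_diagonalizable_3[of "re A" "re B"] re(2)[OF assms(1)] re(2)[OF assms(2)] by blast
  have *: "\<exists>x y. C = conj_by Q (isym x y 0 0 0)"
    if C: "C \<in> su3_m" and d: "\<And>i j. i \<noteq> j \<Longrightarrow> (transpose Q ** re C ** Q) $ i $ j = 0" for C
  proof -
    have "conj_by (transpose Q) C = cscale \<i> (cmat_of_real (transpose Q ** re C ** Q))"
      using arg_cong[OF re(1)[OF C], of "conj_by (transpose Q)"]
      by (simp only: conj_by_cscale) (simp only: conj_by_def cmat_of_real_mult transpose_transpose)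
    then have off: "conj_by (transpose Q) C $ i $ j = 0" if "i \<noteq> j" for i j
      using d[OF that] by (simp add: cscale_nth)
    obtain x y a b c where "conj_by (transpose Q) C = isym x y a b c"
      using conj_by_in_su3_m[OF orthogonal_transpose[OF Q(1)] C] by (auto simp: su3_m_eq)
    with off[of 1 2] off[of 1 3] off[of 2 3] have "conj_by (transpose Q) C = isym x y 0 0 0"
      by simp
    then show ?thesis
      using conj_by_inverse(2)[OF Q(1), of C] by metis
  qed
  show ?thesis
    using that Q(1) *[OF assms(1) Q(2)] *[OF assms(2) Q(3)] by blast
qed

section \<open>Model subspaces\<close>

definition perm_matrix :: "(3 \<Rightarrow> 3) \<Rightarrow> real^3^3" where
  "perm_matrix p = (\<chi> i j. if i = p j then 1 else 0)"

lemma orthogonal_perm_matrix: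
  assumes "inj p"
  shows "orthogonal_matrix (perm_matrix p)"
  using assms
  by (simp add: orthogonal_matrix vec_eq_iff matrix_matrix_mult_def transpose_def perm_matrix_def mat_def
      if_distrib[where f = "\<lambda>x. x * _"] sum.delta inj_eq eq_commute cong: if_cong)

lemma conj_by_transpose_perm_matrix:
  "conj_by (transpose (perm_matrix p)) A $ i $ j = A $ p i $ p j"
proof -
  have *: "complex_of_real (perm_matrix p $ k $ l) = (if k = p l then 1 else 0)" for k l
    by (simp add: perm_matrix_def)
  show ?thesis
    by (simp add: conj_by_def matrix_matrix_mult_def transpose_def * if_distrib[where f = "\<lambda>x. x * _"]
        if_distrib[where f = "\<lambda>x. _ * x"] sum.delta' cong: if_cong)
qed

text \<open>The permutation is an involution, so its matrix is symmetric; the transpose is there to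
  match \<open>conj_by_transpose_perm_matrix\<close>.\<close>

definition swap12 :: "real^3^3" where
  "swap12 = transpose (perm_matrix (\<lambda>i. if i = 1 then 2 else if i = 2 then 1 else 3))"

definition swap23 :: "real^3^3" where
  "swap23 = transpose (perm_matrix (\<lambda>i. if i = 2 then 3 else if i = 3 then 2 else 1))"

text \<open>A reflection, of determinant -1. It reverses the sign of \<open>a\<close> relative to
  \<open>c\<close>, which is the sign ambiguity of type M.\<close>

definition flip1 :: "real^3^3" where
  "flip1 = (\<chi> i j. if i = j then if i = 1 then - 1 else 1 else 0)"

lemma orthogonal_swap_flip [simp]:
  "orthogonal_matrix swap12" "orthogonal_matrix swap23" "orthogonal_matrix flip1"
proof -
  have "inj (\<lambda>i::3. if i = 1 then 2 else if i = 2 then 1 else 3::3)"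
    "inj (\<lambda>i::3. if i = 2 then 3 else if i = 3 then 2 else 1::3)"
    by (auto simp: inj_def forall_3)
  then show "orthogonal_matrix swap12" "orthogonal_matrix swap23"
    by (simp_all add: swap12_def swap23_def orthogonal_perm_matrix)
  show "orthogonal_matrix flip1"
    by (simp add: orthogonal_matrix flip1_def vec_eq_iff forall_3 matrix_matrix_mult_def sum_3
        transpose_def mat_def)
qed

lemma conj_by_swap_flip_isym:
  "conj_by swap12 (isym x y a b c) = isym y x a c b"
  "conj_by swap23 (isym x y a b c) = isym x (- x - y) b a c"
  "conj_by flip1 (isym x y a b c) = isym x y (- a) (- b) c"
    apply (simp_all add: vec_eq_iff forall_3 swap12_def swap23_def conj_by_transpose_perm_matrix algebra_simps)
  apply (simp add: conj_by_def flip1_def matrix_matrix_mult_def transpose_def sum_3 algebra_simps)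
  done

text \<open>The basis is ordered so that the simple roots are the differences of the diagonal
  entries 1, 2 and 2, 3. For their sum, the vector H is then a multiple of
  \<open>isym 1 0 0 0 0\<close> and the vector M one of \<open>isym 0 0 0 1 0\<close>. Type M takes
  the two simple contributions with equal sign.\<close>

fun model :: "lts_type \<Rightarrow> cmat3 set \<Rightarrow> bool" where
  "model TypeG n \<longleftrightarrow> (\<exists>x y. n = {isym (r * x) (r * y) 0 0 0 | r. True})"
| "model TypeT n \<longleftrightarrow> n = {isym x y 0 0 0 | x y. True}"
| "model TypeS n \<longleftrightarrow> n = {isym x 0 0 b 0 | x b. True}"
| "model TypeM n \<longleftrightarrow> n = {isym x 0 a 0 a | x a. True}"
| "model TypeP n \<longleftrightarrow> n = {isym x y 0 b 0 | x y b. True}"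

text \<open>Free of roots and Chevalley bases; \<open>has_type_iff\<close> identifies it with
  \<open>has_type\<close>, so that the classification is a matter of matrices alone.\<close>

definition congruent_to_model :: "lts_type \<Rightarrow> cmat3 set \<Rightarrow> bool" where
  "congruent_to_model t n \<longleftrightarrow> (\<exists>Q n0. orthogonal_matrix Q \<and> model t n0 \<and> n = conj_by Q ` n0)"

lemma congruent_to_model_conj_by:
  "orthogonal_matrix Q \<Longrightarrow> congruent_to_model t n \<Longrightarrow> congruent_to_model t (conj_by Q ` n)"
  unfolding congruent_to_model_def by (metis conj_by_image_mult orthogonal_matrix_mul)

lemma congruent_to_model_conj_by_transpose:
  assumes "orthogonal_matrix Q" "congruent_to_model t (conj_by (transpose Q) ` n)"
  shows "congruent_to_model t n"
  using congruent_to_model_conj_by[OF assms] conj_by_image_inverse(2)[OF assms(1)] by simp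

lemma congruent_to_modelI: "model t n \<Longrightarrow> congruent_to_model t n"
  unfolding congruent_to_model_def
  by (intro exI[of _ "mat 1"] exI[of _ n]) (simp add: orthogonal_matrix_id)

lemma lie_triple_system_model:
  assumes "model t n"
  shows "lie_triple_system n"
proof -
  note curv_simps = curv_def lie_bracket_isym lie_bracket_rskew_isym isym_uminus
  have sub: "subspace n" if "isym 0 0 0 0 0 \<in> n" "\<And>A B. A \<in> n \<Longrightarrow> B \<in> n \<Longrightarrow> A + B \<in> n"
    "\<And>A r. A \<in> n \<Longrightarrow> r *\<^sub>R A \<in> n"
    using that by (simp add: subspace_def isym_0)
  show ?thesis
  proof (cases t)
    case TypeG
    then obtain x y where "n = {isym (r * x) (r * y) 0 0 0 | r. True}"
      using assms by auto
    then have n: "n = {A. \<exists>r. A = isym (r * x) (r * y) 0 0 0}"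
      by simp
    have "subspace n"
    proof (rule sub)
      show "A + B \<in> n" if "A \<in> n" "B \<in> n" for A B
        using that by (auto simp: n isym_add simp flip: distrib_right)
      show "r *\<^sub>R A \<in> n" if "A \<in> n" for A r
        using that by (auto simp: n isym_scaleR simp flip: mult.assoc)
    qed (auto simp: n intro!: exI[of _ 0])
    then show ?thesis
      by (auto simp: lie_triple_system_def n curv_simps intro!: exI[of _ 0])
  next
    case TypeT
    then have "subspace n"
      using assms by (intro sub) (auto simp: isym_add isym_scaleR)
    then show ?thesis
      using TypeT assms by (auto simp: lie_triple_system_def curv_simps)
  next
    case TypeS
    then have "subspace n"
      using assms by (intro sub) (auto simp: isym_add isym_scaleR)
    then show ?thesis
      using TypeS assms by (auto simp: lie_triple_system_def curv_simps)
  next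
    case TypeM
    then have "subspace n"
      using assms by (intro sub) (auto simp: isym_add isym_scaleR)
    then show ?thesis
      using TypeM assms by (auto simp: lie_triple_system_def curv_simps)
  next
    case TypeP
    then have "subspace n"
      using assms by (intro sub) (auto simp: isym_add isym_scaleR)
    then show ?thesis
      using TypeP assms by (auto simp: lie_triple_system_def curv_simps)
  qed
qed

lemma lie_triple_system_congruent_to_model: "congruent_to_model t n \<Longrightarrow> lie_triple_system n"
  using lie_triple_system_model lie_triple_system_conj_by by (auto simp: congruent_to_model_def)

section \<open>Classification of Lie triple systems\<close>

lemma lie_triple_system_closed:
  assumes "lie_triple_system n"
  shows "isym x y a b c \<in> n \<Longrightarrow> isym x' y' a' b' c' \<in> n \<Longrightarrow> isym (x + x') (y + y') (a + a') (b + b') (c + c') \<in> n"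
    and "isym x y a b c \<in> n \<Longrightarrow> isym x' y' a' b' c' \<in> n \<Longrightarrow> isym (x - x') (y - y') (a - a') (b - b') (c - c') \<in> n"
    and "isym x y a b c \<in> n \<Longrightarrow> isym (r * x) (r * y) (r * a) (r * b) (r * c) \<in> n"
    and "u \<in> n \<Longrightarrow> v \<in> n \<Longrightarrow> w \<in> n \<Longrightarrow> lie_bracket (lie_bracket u v) w \<in> n"
proof -
  have sub: "subspace n"
    using assms by (simp add: lie_triple_system_def)
  show "isym x y a b c \<in> n \<Longrightarrow> isym x' y' a' b' c' \<in> n \<Longrightarrow> isym (x + x') (y + y') (a + a') (b + b') (c + c') \<in> n"
    using subspace_add[OF sub, of "isym x y a b c" "isym x' y' a' b' c'"] by (simp only: isym_add)
  show "isym x y a b c \<in> n \<Longrightarrow> isym x' y' a' b' c' \<in> n \<Longrightarrow> isym (x - x') (y - y') (a - a') (b - b') (c - c') \<in> n"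
    using subspace_diff[OF sub, of "isym x y a b c" "isym x' y' a' b' c'"] by (simp only: isym_diff)
  show "isym x y a b c \<in> n \<Longrightarrow> isym (r * x) (r * y) (r * a) (r * b) (r * c) \<in> n"
    using subspace_scale[OF sub, of "isym x y a b c" r] by (simp only: isym_scaleR)
  show "u \<in> n \<Longrightarrow> v \<in> n \<Longrightarrow> w \<in> n \<Longrightarrow> lie_bracket (lie_bracket u v) w \<in> n"
    using assms subspace_neg[OF sub, of "curv u v w"] by (simp add: lie_triple_system_def) (simp add: curv_def)
qed

text \<open>For conjugation by the swaps and by \<open>flip1\<close>, which are
  self-inverse.\<close>

lemma involution_image_eq:
  assumes "\<And>A. A \<in> N \<Longrightarrow> f A \<in> n" "\<And>B. B \<in> n \<Longrightarrow> f B \<in> N \<and> f (f B) = B"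
  shows "n = f ` N"
  using assms by force

lemma lie_triple_system_eqI:
  assumes "lie_triple_system n" "N \<subseteq> su3_m" "\<And>x y a b c. isym x y a b c \<in> n \<longleftrightarrow> isym x y a b c \<in> N"
  shows "n = N"
  using assms by (auto simp: lie_triple_system_def su3_m_eq subset_iff)

text \<open>The off-diagonal entries are root lines: up to sign, the squared adjoint action of a
  diagonal matrix kills the diagonal and scales each entry by the squared difference of the two
  diagonal entries involved.\<close>

lemma lie_triple_system_ad2:
  assumes "lie_triple_system n" "isym h k 0 0 0 \<in> n" "isym x y a b c \<in> n"
  shows "isym 0 0 ((h - k)^2 * a) ((2 * h + k)^2 * b) ((h + 2 * k)^2 * c) \<in> n"
proof -
  have "lie_bracket (lie_bracket (isym x y a b c) (isym h k 0 0 0)) (isym h k 0 0 0)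
      = isym 0 0 (- ((h - k)^2 * a)) (- ((2 * h + k)^2 * b)) (- ((h + 2 * k)^2 * c))"
    by (simp add: lie_bracket_isym lie_bracket_rskew_isym power2_eq_square algebra_simps)
  then have "isym 0 0 (- ((h - k)^2 * a)) (- ((2 * h + k)^2 * b)) (- ((h + 2 * k)^2 * c)) \<in> n"
    using lie_triple_system_closed(4)[OF assms(1) assms(3,2,2)] by simp
  from lie_triple_system_closed(3)[OF assms(1) this, of "- 1"] show ?thesis
    by simp
qed

text \<open>The source of new elements: for one nonzero entry among \<open>a\<close>,
  \<open>b\<close>, \<open>c\<close> the double bracket is diagonal, and for two it can reach the
  third root line.\<close>

lemma lie_triple_system_bracket_offdiag:
  assumes "lie_triple_system n" "isym h k 0 0 0 \<in> n" "isym 0 0 a b c \<in> n"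
  shows "isym (2 * ((h - k) * a^2 + (2 * h + k) * b^2)) (2 * ((h + 2 * k) * c^2 - (h - k) * a^2))
    (3 * (h + k) * b * c) (- 3 * k * a * c) (- 3 * h * a * b) \<in> n"
proof -
  have "lie_bracket (lie_bracket (isym 0 0 a b c) (isym h k 0 0 0)) (isym 0 0 a b c)
      = isym (2 * ((h - k) * a^2 + (2 * h + k) * b^2)) (2 * ((h + 2 * k) * c^2 - (h - k) * a^2))
          (3 * (h + k) * b * c) (- 3 * k * a * c) (- 3 * h * a * b)"
    by (simp add: lie_bracket_isym lie_bracket_rskew_isym power2_eq_square algebra_simps)
  then show ?thesis
    using lie_triple_system_closed(4)[OF assms(1) assms(3,2,3)] by simp
qed

text \<open>A Lie triple system containing the diagonal matrices is a sum of joint eigenspaces of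
  their squared adjoint actions, and any two off-diagonal eigenspaces generate the third.\<close>
lemma lie_triple_system_above_diagonals:
  assumes lts: "lie_triple_system n" and diag: "\<And>x y. isym x y 0 0 0 \<in> n" and ne: "n \<noteq> su3_m"
  shows "congruent_to_model TypeT n \<or> congruent_to_model TypeP n"
proof -
  note closed = lie_triple_system_closed[OF lts]
  have unit: "isym 0 0 a b c \<in> n" if "isym 0 0 (r * a) (r * b) (r * c) \<in> n" "r \<noteq> 0" for a b c r
    using closed(3)[OF that(1), of "1 / r"] that(2) by simp
  have offdiag: "isym 0 0 a b c \<in> n" if "isym x y a b c \<in> n" for x y a b c
    using closed(2)[OF that diag[of x y]] by simp
  have part_c: "isym 0 0 0 0 c \<in> n" and part_b: "isym 0 0 0 b 0 \<in> n" and part_a: "isym 0 0 a 0 0 \<in> n"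
    if S: "isym x y a b c \<in> n" for x y a b c
  proof -
    \<comment> \<open>diag(1, 1, -2) has squared root values 0, 9, 9 and diag(2, -1, -1) has 9, 9,
      0: each removes one entry and scales the other two equally.\<close>
    have "isym 0 0 0 b c \<in> n" "isym 0 0 a b 0 \<in> n"
      using lie_triple_system_ad2[OF lts diag[of 1 1] S] unit[of 9 0 b c]
        lie_triple_system_ad2[OF lts diag[of 2 "-1"] S] unit[of 9 a b 0] by simp_all
    then show "isym 0 0 0 0 c \<in> n" "isym 0 0 0 b 0 \<in> n" "isym 0 0 a 0 0 \<in> n"
      using closed(2)[OF offdiag[OF S] \<open>isym 0 0 a b 0 \<in> n\<close>] closed(2)[OF offdiag[OF S] \<open>isym 0 0 0 b c \<in> n\<close>]
        closed(2)[OF \<open>isym 0 0 a b 0 \<in> n\<close> closed(2)[OF offdiag[OF S] \<open>isym 0 0 0 b c \<in> n\<close>]]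
      by simp_all
  qed
  have part: "isym 0 0 a' 0 0 \<in> n" if "isym x y a b c \<in> n" "a \<noteq> 0" for x y a b c a'
    using closed(3)[OF part_a[OF that(1)], of "a' / a"] that(2) by simp
  have part2: "isym 0 0 0 b' 0 \<in> n" if "isym x y a b c \<in> n" "b \<noteq> 0" for x y a b c b'
    using closed(3)[OF part_b[OF that(1)], of "b' / b"] that(2) by simp
  have part3: "isym 0 0 0 0 c' \<in> n" if "isym x y a b c \<in> n" "c \<noteq> 0" for x y a b c c'
    using closed(3)[OF part_c[OF that(1)], of "c' / c"] that(2) by simp
  \<comment> \<open>Each root line is one-dimensional, so these three truth values determine
    \<open>n\<close>; see \<open>iff\<close>.\<close>
  define fa where "fa \<longleftrightarrow> (\<exists>x y a b c. isym x y a b c \<in> n \<and> a \<noteq> 0)"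
  define fb where "fb \<longleftrightarrow> (\<exists>x y a b c. isym x y a b c \<in> n \<and> b \<noteq> 0)"
  define fc where "fc \<longleftrightarrow> (\<exists>x y a b c. isym x y a b c \<in> n \<and> c \<noteq> 0)"
  have iff: "isym x y a b c \<in> n \<longleftrightarrow> (a \<noteq> 0 \<longrightarrow> fa) \<and> (b \<noteq> 0 \<longrightarrow> fb) \<and> (c \<noteq> 0 \<longrightarrow> fc)" for x y a b c
  proof
    assume r: "(a \<noteq> 0 \<longrightarrow> fa) \<and> (b \<noteq> 0 \<longrightarrow> fb) \<and> (c \<noteq> 0 \<longrightarrow> fc)"
    have "isym 0 0 a 0 0 \<in> n"
      using r part diag[of 0 0] by (cases "a = 0") (auto simp: fa_def)
    moreover have "isym 0 0 0 b 0 \<in> n"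
      using r part2 diag[of 0 0] by (cases "b = 0") (auto simp: fb_def)
    moreover have "isym 0 0 0 0 c \<in> n"
      using r part3 diag[of 0 0] by (cases "c = 0") (auto simp: fc_def)
    ultimately show "isym x y a b c \<in> n"
      using closed(1)[OF closed(1)[OF diag[of x y] \<open>isym 0 0 a 0 0 \<in> n\<close>]
          closed(1)[OF \<open>isym 0 0 0 b 0 \<in> n\<close> \<open>isym 0 0 0 0 c \<in> n\<close>]] by simp
  next
    assume "isym x y a b c \<in> n"
    then show "(a \<noteq> 0 \<longrightarrow> fa) \<and> (b \<noteq> 0 \<longrightarrow> fb) \<and> (c \<noteq> 0 \<longrightarrow> fc)"
      unfolding fa_def fb_def fc_def by blast
  qed
  have bracket: "isym (2 * ((h - k) * a^2 + (2 * h + k) * b^2)) (2 * ((h + 2 * k) * c^2 - (h - k) * a^2))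
    (3 * (h + k) * b * c) (- 3 * k * a * c) (- 3 * h * a * b) \<in> n"
    if "(a \<noteq> 0 \<longrightarrow> fa) \<and> (b \<noteq> 0 \<longrightarrow> fb) \<and> (c \<noteq> 0 \<longrightarrow> fc)" for h k a b c
    using lie_triple_system_bracket_offdiag[OF lts diag] that iff by blast
  \<comment> \<open>Two entries are set to 1; \<open>h\<close> and \<open>k\<close> are chosen to
    make the coefficient of the third nonzero.\<close>
  have gen: "fa \<Longrightarrow> fb \<Longrightarrow> fc" "fb \<Longrightarrow> fc \<Longrightarrow> fa" "fa \<Longrightarrow> fc \<Longrightarrow> fb"
    using bracket[of 1 1 0 1 1] bracket[of 0 1 1 1 1] bracket[of 1 0 1 0 1] by (simp_all add: iff)
  have "\<not> (fa \<and> fb \<and> fc)"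
  proof
    assume "fa \<and> fb \<and> fc"
    then have "su3_m \<subseteq> n"
      by (auto simp: su3_m_eq iff)
    then show False
      using ne lts by (auto simp: lie_triple_system_def)
  qed
  then consider "\<not> fa" "\<not> fb" "\<not> fc" | "fa" "\<not> fb" "\<not> fc" | "\<not> fa" "fb" "\<not> fc" | "\<not> fa" "\<not> fb" "fc"
    using gen by blast
  then show ?thesis
  proof cases
    case 1
    then have "n = {isym x y 0 0 0 | x y. True}"
      by (intro lie_triple_system_eqI[OF lts]) (auto simp: iff)
    then show ?thesis
      by (simp add: congruent_to_modelI)
  next
    case 2
    have "n = {isym x y a 0 0 | x y a. True}"
      using 2 by (intro lie_triple_system_eqI[OF lts]) (auto simp: iff)
    then have "n = conj_by swap23 ` {isym x y 0 b 0 | x y b. True}"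
      by (intro involution_image_eq) (auto simp: conj_by_swap_flip_isym)
    then show ?thesis
      unfolding congruent_to_model_def by (intro disjI2 exI[of _ swap23]) auto
  next
    case 3
    then have "n = {isym x y 0 b 0 | x y b. True}"
      by (intro lie_triple_system_eqI[OF lts]) (auto simp: iff)
    then show ?thesis
      by (simp add: congruent_to_modelI)
  next
    case 4
    have "n = {isym x y 0 0 c | x y c. True}"
      using 4 by (intro lie_triple_system_eqI[OF lts]) (auto simp: iff)
    then have "n = conj_by swap12 ` {isym x y 0 b 0 | x y b. True}"
      by (intro involution_image_eq) (auto simp: conj_by_swap_flip_isym)
    then show ?thesis
      unfolding congruent_to_model_def by (intro disjI2 exI[of _ swap12]) auto
  qed
qed

text \<open>Here every element of \<open>n\<close> commuting with the diagonal matrix \<open>H\<close> is a multiple of \<open>H\<close>.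
  Splitting \<open>n\<close> into eigenspaces of the squared adjoint action of \<open>H\<close>, the brackets
  \<open>[[S, H], S]\<close> of off-diagonal eigenvectors \<open>S\<close> force the spectrum of \<open>H\<close>.\<close>
lemma lie_triple_system_rank_one:
  assumes lts: "lie_triple_system n" and H: "isym h k 0 0 0 \<in> n" and H0: "h \<noteq> 0 \<or> k \<noteq> 0"
    and order: "h \<ge> k" "k \<ge> - h - k"
    and rank: "\<And>x y a b c. isym x y a b c \<in> n \<Longrightarrow> (h - k) * a = 0 \<Longrightarrow> (2 * h + k) * b = 0 \<Longrightarrow>
      (h + 2 * k) * c = 0 \<Longrightarrow> a = 0 \<and> b = 0 \<and> c = 0 \<and> x * k = y * h"
  shows "\<exists>t. congruent_to_model t n"
proof -
  note closed = lie_triple_system_closed[OF lts]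
  note ad2 = lie_triple_system_ad2[OF lts]
  note bracket = lie_triple_system_bracket_offdiag[OF lts H]
  have unit: "isym 0 0 a b c \<in> n" if "isym 0 0 (r * a) (r * b) (r * c) \<in> n" "r \<noteq> 0" for a b c r
    using closed(3)[OF that(1), of "1 / r"] that(2) by simp
  have h: "h > 0"
    using order H0 by linarith
  \<comment> \<open>Without off-diagonal entries, \<open>rank\<close> makes \<open>n\<close> the
    line of H, which is type G. The first three cases below end here.\<close>
  have diagonal: "\<exists>t. congruent_to_model t n"
    if "\<And>x y a b c. isym x y a b c \<in> n \<Longrightarrow> a = 0 \<and> b = 0 \<and> c = 0"
  proof -
    have "isym x y a b c \<in> n \<longleftrightarrow> (\<exists>r. isym x y a b c = isym (r * h) (r * k) 0 0 0)" for x y a b c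
    proof
      assume S: "isym x y a b c \<in> n"
      then have "a = 0" "b = 0" "c = 0"
        using that by blast+
      moreover from this have "x * k = y * h"
        using rank[OF S] by simp
      ultimately show "\<exists>r. isym x y a b c = isym (r * h) (r * k) 0 0 0"
        using h by (intro exI[of _ "x / h"]) (simp add: field_simps)
    next
      assume "\<exists>r. isym x y a b c = isym (r * h) (r * k) 0 0 0"
      then show "isym x y a b c \<in> n"
        using closed(3)[OF H] by auto
    qed
    then have "n = {isym (r * h) (r * k) 0 0 0 | r. True}"
      by (intro lie_triple_system_eqI[OF lts]) auto
    then have "model TypeG n" by auto
    then show ?thesis
      using congruent_to_modelI by blast
  qed
  \<comment> \<open>Of the squared root values of H, one is zero in the first two cases; in the
    third they are distinct and positive; in the last they are \<open>h^2\<close>,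
    \<open>4 * h^2\<close>, \<open>h^2\<close>, and two root lines cannot be separated.\<close>
  consider "h = k" | "k = - h - k" | "h > k" "k > - h - k" "k \<noteq> 0" | "k = 0"
    using order by linarith
  then show ?thesis
  proof cases
    case 1
    have "a = 0 \<and> b = 0 \<and> c = 0" if S: "isym x y a b c \<in> n" for x y a b c
    proof -
      have bc: "isym 0 0 0 b c \<in> n"
        using ad2[OF H S] unit[of "(3 * h)^2" 0 b c] 1 h by simp
      have "a = 0"
        using rank[OF closed(2)[OF S bc]] 1 by simp
      \<comment> \<open>Off the diagonal, \<open>[[S, H], S]\<close> has only the (1,2) entry, a
        multiple of \<open>b * c\<close>, so it commutes with H. Being a multiple of H, it has
        \<open>b * c = 0\<close> and equal first two diagonal entries.\<close>
      have "b * c = 0" "b^2 = c^2"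
        using rank[OF bracket[OF bc]] 1 h by auto
      with \<open>a = 0\<close> show ?thesis
        by auto
    qed
    then show ?thesis by (rule diagonal)
  next
    case 2
    then have hk: "h = - 2 * k" "k < 0"
      using h by linarith+
    have "a = 0 \<and> b = 0 \<and> c = 0" if S: "isym x y a b c \<in> n" for x y a b c
    proof -
      have ab: "isym 0 0 a b 0 \<in> n"
        using ad2[OF H S] unit[of "(3 * k)^2" a b 0] hk by (simp add: power2_eq_square)
      have "c = 0"
        using rank[OF closed(2)[OF S ab]] hk by simp
      have "a * b = 0" "a^2 = b^2"
        using rank[OF bracket[OF ab]] hk by (auto simp: algebra_simps)
      with \<open>c = 0\<close> show ?thesis
        by auto
    qed
    then show ?thesis by (rule diagonal)
  next
    case 3
    define l1 l2 l3 where "l1 = (h - k)^2" and "l2 = (2 * h + k)^2" and "l3 = (h + 2 * k)^2"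
    have "l1 > 0" "l2 > 0" "l3 > 0"
      using 3 h by (auto simp: l1_def l2_def l3_def)
    moreover have "l1 \<noteq> l2" "l3 \<noteq> l2" "l1 \<noteq> l3"
      using 3 h unfolding l1_def l2_def l3_def power2_eq_iff by auto
    ultimately have l: "l1 * (l1 - l2) * (l1 - l3) \<noteq> 0" "l2 * (l2 - l1) * (l2 - l3) \<noteq> 0"
        "l3 * (l3 - l1) * (l3 - l2) \<noteq> 0"
      by auto
    have "a = 0 \<and> b = 0 \<and> c = 0" if S: "isym x y a b c \<in> n" for x y a b c
    proof -
      note S1 = ad2[OF H S, folded l1_def l2_def l3_def]
      note S2 = ad2[OF H S1, folded l1_def l2_def l3_def]
      note S3 = ad2[OF H S2, folded l1_def l2_def l3_def]
      text \<open>\<open>L\<close> applies the quadratic polynomial with roots \<open>p, q\<close> to the squared adjoint action.\<close>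
      have L: "isym 0 0 ((l1 * (l1 - p) * (l1 - q)) * a) ((l2 * (l2 - p) * (l2 - q)) * b)
          ((l3 * (l3 - p) * (l3 - q)) * c) \<in> n" for p q
        using closed(1)[OF closed(2)[OF S3 closed(3)[OF S2, of "p + q"]] closed(3)[OF S1, of "p * q"]]
        by (simp add: algebra_simps)
      have a: "isym 0 0 a 0 0 \<in> n" and b: "isym 0 0 0 b 0 \<in> n" and c: "isym 0 0 0 0 c \<in> n"
        using L[of l2 l3] L[of l1 l3] L[of l1 l2] l
          unit[of "l1 * (l1 - l2) * (l1 - l3)" a 0 0] unit[of "l2 * (l2 - l1) * (l2 - l3)" 0 b 0]
          unit[of "l3 * (l3 - l1) * (l3 - l2)" 0 0 c]
        by simp_all
      \<comment> \<open>For \<open>S\<close> on one root line the bracket is a multiple of diag(1,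
        -1, 0), diag(1, 0, -1) or diag(0, 1, -1). A nonzero one is parallel to H only if
        \<open>h + k\<close>, \<open>k\<close> or \<open>h\<close> vanishes, respectively, which
        this case excludes.\<close>
      have "(h - k) * a^2 * (h + k) = 0"
        using rank[OF bracket[OF a]] by (auto simp: algebra_simps)
      moreover have "(2 * h + k) * b^2 * k = 0"
        using rank[OF bracket[OF b]] by (auto simp: algebra_simps)
      moreover have "(h + 2 * k) * c^2 * h = 0"
        using rank[OF bracket[OF c]] by (auto simp: algebra_simps)
      ultimately show ?thesis
        using 3 h by auto
    qed
    then show ?thesis by (rule diagonal)
  next
    case 4
    have H1: "isym 1 0 0 0 0 \<in> n"
      using closed(3)[OF H, of "1 / h"] h 4 by simp
    have parts: "isym 0 0 0 b 0 \<in> n" "isym 0 0 a 0 c \<in> n" "y = 0" if S: "isym x y a b c \<in> n" for x y a b c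
    proof -
      note S1 = ad2[OF H1 S]
      note S2 = ad2[OF H1 S1]
      \<comment> \<open>The scaling factors are 1, 4, 1, so the difference of the second and the
        first iterate is 16 - 4 = 12 times the \<open>b\<close> part.\<close>
      show b: "isym 0 0 0 b 0 \<in> n"
        using closed(2)[OF S2 S1] unit[of 12 0 b 0] by simp
      show ac: "isym 0 0 a 0 c \<in> n"
        using closed(2)[OF S1 closed(3)[OF b, of 4]] by simp
      show "y = 0"
        using rank[OF closed(2)[OF closed(2)[OF S b] ac]] 4 h by simp
    qed
    \<comment> \<open>As \<open>k = 0\<close>, the bracket of \<open>isym 0 0 a 0 c\<close> is
      diagonal with middle entry \<open>2 * h * (c^2 - a^2)\<close>, which must vanish in a multiple
      of H.\<close>
    have ac: "a^2 = c^2" if S: "isym x y a b c \<in> n" for x y a b c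
      using rank[OF bracket[OF parts(2)[OF S]]] 4 h by simp
    show ?thesis
    proof (cases "\<exists>x y a b c. isym x y a b c \<in> n \<and> a \<noteq> 0")
      case False
      then have a: "a = 0" "c = 0" "y = 0" if "isym x y a b c \<in> n" for x y a b c
      proof -
        show "a = 0"
          using False that by blast
        then show "c = 0" "y = 0"
          using ac[OF that] parts(3)[OF that] by simp_all
      qed
      show ?thesis
      proof (cases "\<exists>x y a b c. isym x y a b c \<in> n \<and> b \<noteq> 0")
        case False
        then show ?thesis
          using a by (intro diagonal) blast
      next
        case True
        then obtain b0 where b0: "isym 0 0 0 b0 0 \<in> n" "b0 \<noteq> 0"
          using parts(1) by blast
        have "isym x y a b c \<in> n \<longleftrightarrow> y = 0 \<and> a = 0 \<and> c = 0" for x y a b c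
          using a closed(1)[OF closed(3)[OF H1, of x] closed(3)[OF b0(1), of "b / b0"]] b0(2) by auto
        then have "n = {isym x 0 0 b 0 | x b. True}"
          by (intro lie_triple_system_eqI[OF lts]) auto
        then have "model TypeS n" by simp
        then show ?thesis
          using congruent_to_modelI by blast
      qed
    next
      case True
      then obtain a0 c0 where ac0: "isym 0 0 a0 0 c0 \<in> n" "a0 \<noteq> 0"
        using parts(2) by blast
      define s where "s = c0 / a0"
      have "s^2 = 1"
        using ac[OF ac0(1)] ac0(2) by (auto simp: s_def power_divide)
      then have s: "s = 1 \<or> s = - 1"
        by (simp add: power2_eq_1_iff)
      have u: "isym 0 0 1 0 s \<in> n"
        using closed(3)[OF ac0(1), of "1 / a0"] ac0(2) by (simp add: s_def)
      \<comment> \<open>Subtracting \<open>a\<close> times \<open>u\<close> leaves first entry 0,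
        hence also second entry 0 by \<open>ac\<close>: one sign \<open>s\<close> serves all of
        \<open>n\<close>.\<close>
      have c: "c = s * a" if S: "isym x y a b c \<in> n" for x y a b c
        using ac[OF closed(2)[OF parts(2)[OF S] closed(3)[OF u, of a]]] by (simp add: mult.commute)
      have b: "b = 0" if S: "isym x y a b c \<in> n" for x y a b c
      proof -
        \<comment> \<open>This bracket is incompatible with \<open>c = s * a\<close> unless
          \<open>b = 0\<close>: since \<open>s^2 = 1\<close>, it would give
          \<open>- 2 * b = 2 * b\<close>.\<close>
        have "lie_bracket (lie_bracket (isym 0 0 0 b 0) (isym 1 0 0 0 0)) (isym 0 0 1 0 s) = isym 0 0 (2 * b * s) 0 (- 2 * b)"
          by (simp add: lie_bracket_isym lie_bracket_rskew_isym)
        then have "isym 0 0 (2 * b * s) 0 (- 2 * b) \<in> n"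
          using closed(4)[OF parts(1)[OF S] H1 u] by simp
        from c[OF this] show ?thesis
          using s by auto
      qed
      have "isym x y a b c \<in> n \<longleftrightarrow> y = 0 \<and> b = 0 \<and> c = s * a" for x y a b c
      proof
        assume S: "isym x y a b c \<in> n"
        show "y = 0 \<and> b = 0 \<and> c = s * a"
          using c[OF S] b[OF S] parts(3)[OF S] by simp
      next
        assume "y = 0 \<and> b = 0 \<and> c = s * a"
        then show "isym x y a b c \<in> n"
          using closed(1)[OF closed(3)[OF H1, of x] closed(3)[OF u, of a]] by (simp add: mult.commute)
      qed
      then have ns: "n = {isym x 0 a 0 (s * a) | x a. True}"
        by (intro lie_triple_system_eqI[OF lts]) auto
      from s show ?thesis
      proof
        assume "s = 1"
        then have "model TypeM n"
          using ns by simp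
        then show ?thesis
          using congruent_to_modelI by blast
      next
        assume "s = - 1"
        then have n_eq: "n = {isym x 0 a 0 (- a) | x a. True}"
          using ns by simp
        have "n = conj_by flip1 ` {isym x 0 a 0 a | x a. True}"
          unfolding n_eq by (intro involution_image_eq) (auto simp: conj_by_swap_flip_isym)
        then have "congruent_to_model TypeM n"
          unfolding congruent_to_model_def by (intro exI[of _ flip1]) auto
        then show ?thesis by blast
      qed
    qed
  qed
qed

text \<open>The two swaps generate all permutations of the diagonal entries, so these can be sorted,
  which keeps the cases of \<open>lie_triple_system_rank_one\<close> few.\<close>

lemma su3_m_diagonalizable_ordered:
  assumes "A \<in> su3_m"
  obtains Q h k where "orthogonal_matrix Q" "A = conj_by Q (isym h k 0 0 0)" "h \<ge> k" "k \<ge> - h - k"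
proof -
  define D where "D x y \<longleftrightarrow> (\<exists>Q. orthogonal_matrix Q \<and> A = conj_by Q (isym x y 0 0 0))" for x y
  have conj: "D x' y'" if "D x y" "orthogonal_matrix R" "conj_by R (isym x' y' 0 0 0) = isym x y 0 0 0" for R x y x' y'
    using that conj_by_mult orthogonal_matrix_mul unfolding D_def by metis
  have swap: "D y x" "D x (- x - y)" if "D x y" for x y
    using conj[OF that, of swap12 y x] conj[OF that, of swap23 x "- x - y"] by (simp_all add: conj_by_swap_flip_isym)
  have "lie_bracket A A = 0"
    by (simp add: lie_bracket_def)
  then obtain x y where D: "D x y"
    using commuting_su3_m_diagonalizable[OF assms assms] unfolding D_def by metis
  have "D y (- x - y)" "D (- x - y) x" "D (- x - y) y"
    using swap(2)[OF swap(1)[OF D]] swap(1)[OF swap(2)[OF D]] swap(1)[OF swap(2)[OF swap(1)[OF D]]]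
    by (metis minus_diff_commute)+
  then have "\<exists>h k. D h k \<and> h \<ge> k \<and> k \<ge> - h - k"
    using D swap[OF D] by (smt (verit))
  then show ?thesis
    using that unfolding D_def by blast
qed

lemma lie_triple_system_classification:
  assumes lts: "lie_triple_system n" and "n \<noteq> {0}" "n \<noteq> su3_m"
  shows "\<exists>t. congruent_to_model t n"
proof (cases "\<exists>A\<in>n. \<exists>B\<in>n. lie_bracket A B = 0 \<and> A \<noteq> 0 \<and> (\<forall>r. B \<noteq> r *\<^sub>R A)")
  case True
  have n: "n \<subseteq> su3_m"
    using lts by (simp add: lie_triple_system_def)
  obtain A B where AB: "A \<in> n" "B \<in> n" "lie_bracket A B = 0" "A \<noteq> 0" "\<And>r. B \<noteq> r *\<^sub>R A"
    using True by blast
  then obtain Q x y x' y' where Q: "orthogonal_matrix Q" and A: "A = conj_by Q (isym x y 0 0 0)"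
    and B: "B = conj_by Q (isym x' y' 0 0 0)"
    using commuting_su3_m_diagonalizable[of A B] n by blast
  define n0 where "n0 = conj_by (transpose Q) ` n"
  have lts0: "lie_triple_system n0" "n0 \<noteq> su3_m"
    using lts Q assms(3) conj_by_image_su3_m[of Q] conj_by_image_inverse[of Q n]
    by (auto simp: n0_def lie_triple_system_conj_by_iff)
  note closed = lie_triple_system_closed[OF lts0(1)]
  have mem: "isym x y 0 0 0 \<in> n0" "isym x' y' 0 0 0 \<in> n0"
    using AB(1,2) conj_by_inverse(1)[OF Q] unfolding A B n0_def by (metis imageI)+
  have xy: "x \<noteq> 0 \<or> y \<noteq> 0"
    using AB(4) by (auto simp: A simp flip: isym_0)
  \<comment> \<open>The determinant of the two diagonals. It is nonzero by independence, and
    Cramer's rule then produces every diagonal matrix.\<close>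
  define d where "d = x * y' - x' * y"
  have "d \<noteq> 0"
  proof
    assume d: "d = 0"
    have "\<exists>r. isym x' y' 0 0 0 = r *\<^sub>R isym x y 0 0 0"
    proof (cases "x = 0")
      case True
      then show ?thesis
        using xy d by (intro exI[of _ "y' / y"]) (simp add: isym_scaleR d_def)
    next
      case False
      then show ?thesis
        using d by (intro exI[of _ "x' / x"]) (simp add: isym_scaleR d_def field_simps)
    qed
    then obtain r where "isym x' y' 0 0 0 = r *\<^sub>R isym x y 0 0 0" ..
    then have "B = r *\<^sub>R A"
      by (simp only: A B conj_by_scaleR)
    then show False
      using AB(5) by blast
  qed
  have "isym u v 0 0 0 \<in> n0" for u v
  proof -
    have "(u * y' - v * x') / d * x + (v * x - u * y) / d * x' = u"
      "(u * y' - v * x') / d * y + (v * x - u * y) / d * y' = v"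
      using \<open>d \<noteq> 0\<close> by (simp_all add: field_simps) (simp_all add: d_def algebra_simps)
    then show ?thesis
      using closed(1)[OF closed(3)[OF mem(1), of "(u * y' - v * x') / d"]
          closed(3)[OF mem(2), of "(v * x - u * y) / d"]] by simp
  qed
  then have "\<exists>t. congruent_to_model t n0"
    using lie_triple_system_above_diagonals[OF lts0(1) _ lts0(2)] by blast
  then show ?thesis
    using congruent_to_model_conj_by_transpose[OF Q] unfolding n0_def by blast
next
  case False
  have n: "n \<subseteq> su3_m" "0 \<in> n"
    using lts subspace_0 by (auto simp: lie_triple_system_def)
  then obtain A where A: "A \<in> n" "A \<noteq> 0"
    using assms(2) by blast
  then obtain Q h k where Q: "orthogonal_matrix Q" and Ah: "A = conj_by Q (isym h k 0 0 0)"
    and order: "h \<ge> k" "k \<ge> - h - k"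
    using su3_m_diagonalizable_ordered n by blast
  define n0 where "n0 = conj_by (transpose Q) ` n"
  have lts0: "lie_triple_system n0"
    using lts Q by (simp add: n0_def lie_triple_system_conj_by)
  have hk: "h \<noteq> 0 \<or> k \<noteq> 0"
    using A(2) by (auto simp: Ah simp flip: isym_0)
  have mem: "isym h k 0 0 0 \<in> n0"
    using A(1) conj_by_inverse(1)[OF Q] unfolding Ah n0_def by (metis imageI)
  have "a = 0 \<and> b = 0 \<and> c = 0 \<and> x * k = y * h"
    if S: "isym x y a b c \<in> n0" and comm: "(h - k) * a = 0" "(2 * h + k) * b = 0" "(h + 2 * k) * c = 0" for x y a b c
  proof -
    have "lie_bracket (isym h k 0 0 0) (isym x y a b c) = 0"
      using comm by (auto simp add: lie_bracket_isym algebra_simps)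
    then have "lie_bracket A (conj_by Q (isym x y a b c)) = 0"
      unfolding Ah by (simp add: Q flip: conj_by_lie_bracket)
    moreover have "conj_by Q (isym x y a b c) \<in> n"
      using S conj_by_inverse(2)[OF Q] by (auto simp: n0_def)
    ultimately obtain r where "conj_by Q (isym x y a b c) = r *\<^sub>R A"
      using False A by blast
    then have "isym x y a b c = r *\<^sub>R isym h k 0 0 0"
      unfolding Ah conj_by_scaleR[symmetric] conj_by_eq_iff[OF Q] .
    then show ?thesis
      by (simp add: isym_scaleR)
  qed
  then have "\<exists>t. congruent_to_model t n0"
    using lie_triple_system_rank_one[OF lts0 mem hk order] by blast
  then show ?thesis
    using congruent_to_model_conj_by_transpose[OF Q] unfolding n0_def by blast
qed

section \<open>Killing form and maximal flats\<close>

text \<open>A trace can be computed from any spanning family \<open>g\<close> with linear coefficient functions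
  \<open>\<phi>\<close>, even if \<open>g\<close> is not contained in \<open>V\<close>.\<close>
lemma endo_trace_frame:
  assumes V: "cmat.subspace V" and fin: "finite I" and f_mem: "\<And>i. i \<in> I \<Longrightarrow> f (g i) \<in> V"
    and frame: "\<And>Z. Z \<in> V \<Longrightarrow> Z = (\<Sum>i\<in>I. cscale (\<phi> i Z) (g i))"
    and f_add: "\<And>A B. f (A + B) = f A + f B" and f_scale: "\<And>c A. f (cscale c A) = cscale c (f A)"
    and \<phi>_add: "\<And>i A B. \<phi> i (A + B) = \<phi> i A + \<phi> i B" and \<phi>_scale: "\<And>i c A. \<phi> i (cscale c A) = c * \<phi> i A"
  shows "endo_trace V f = (\<Sum>i\<in>I. \<phi> i (f (g i)))"
proof -
  have f_0: "f 0 = 0" and \<phi>_0: "\<phi> i 0 = 0" for i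
    using f_scale[of 0 0] \<phi>_scale[of i 0 0] by simp_all
  have f_sum: "f (\<Sum>i\<in>J. cscale (c i) (h i)) = (\<Sum>i\<in>J. cscale (c i) (f (h i)))" for c h and J :: "'a set"
    by (induction J rule: infinite_finite_induct) (simp_all add: f_0 f_add f_scale)
  have \<phi>_sum: "\<phi> i (\<Sum>b\<in>J. cscale (c b) b) = (\<Sum>b\<in>J. c b * \<phi> i b)" for c i J
    by (induction J rule: infinite_finite_induct) (simp_all add: \<phi>_0 \<phi>_add \<phi>_scale)
  define B where "B = (SOME B. B \<subseteq> V \<and> cmat.independent B \<and> cmat.span B = V)"
  have "\<exists>B. B \<subseteq> V \<and> cmat.independent B \<and> cmat.span B = V"
    using cmat.maximal_independent_subset[of V] cmat.span_minimal[OF _ V] by (metis subset_antisym)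
  then have B: "B \<subseteq> V" "cmat.independent B" "cmat.span B = V"
    unfolding B_def by (metis (mono_tags, lifting) someI_ex)+
  have "V \<subseteq> cmat.span (g ` I)"
  proof
    fix Z assume "Z \<in> V"
    have "(\<Sum>i\<in>I. cscale (\<phi> i Z) (g i)) \<in> cmat.span (g ` I)"
      by (intro cmat.span_sum cmat.span_scale cmat.span_base) auto
    then show "Z \<in> cmat.span (g ` I)"
      using frame[OF \<open>Z \<in> V\<close>] by simp
  qed
  then have finB: "finite B"
    using cmat.independent_span_bound[of "g ` I" B] B fin by blast
  have "endo_trace V f = (\<Sum>b\<in>B. cmat.representation B (f b) b)"
    by (simp add: endo_trace_def B_def Let_def)
  also have "\<dots> = (\<Sum>b\<in>B. \<Sum>i\<in>I. \<phi> i b * cmat.representation B (f (g i)) b)"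
  proof (rule sum.cong[OF refl])
    fix b assume "b \<in> B"
    then have "f b = (\<Sum>i\<in>I. cscale (\<phi> i b) (f (g i)))"
      using frame[of b] f_sum[of "\<lambda>i. \<phi> i b" g I] B(1) by auto
    moreover have "cmat.representation B (\<Sum>i\<in>I. cscale (\<phi> i b) (f (g i)))
        = (\<lambda>b'. \<Sum>i\<in>I. cmat.representation B (cscale (\<phi> i b) (f (g i))) b')"
      using B f_mem by (intro cmat.representation_sum) (auto intro!: cmat.span_scale)
    ultimately show "cmat.representation B (f b) b = (\<Sum>i\<in>I. \<phi> i b * cmat.representation B (f (g i)) b)"
      using B f_mem by (simp add: cmat.representation_scale)
  qed
  also have "\<dots> = (\<Sum>i\<in>I. \<Sum>b\<in>B. cmat.representation B (f (g i)) b * \<phi> i b)"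
    by (subst sum.swap) (simp add: mult.commute)
  also have "\<dots> = (\<Sum>i\<in>I. \<phi> i (f (g i)))"
  proof (rule sum.cong[OF refl])
    fix i assume "i \<in> I"
    then have "(\<Sum>b\<in>B. cscale (cmat.representation B (f (g i)) b) b) = f (g i)"
      using B f_mem finB by (intro cmat.sum_representation_eq) auto
    then show "(\<Sum>b\<in>B. cmat.representation B (f (g i)) b * \<phi> i b) = \<phi> i (f (g i))"
      using \<phi>_sum[of i "cmat.representation B (f (g i))" B] by simp
  qed
  finally show ?thesis .
qed

definition mat_unit :: "3 \<Rightarrow> 3 \<Rightarrow> cmat3" where
  "mat_unit j k = (\<chi> a b. if a = j \<and> b = k then 1 else 0)"

lemma mat_unit_nth [simp]: "mat_unit j k $ a $ b = (if a = j \<and> b = k then 1 else 0)"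
  by (simp add: mat_unit_def)

lemma mat_unit_sandwich_nth: "(X ** mat_unit j k ** Y) $ a $ b = X $ a $ j * Y $ k $ b"
proof -
  have "(X ** mat_unit j k) $ a $ m = (if m = k then X $ a $ j else 0)" for m
    by (simp add: matrix_matrix_mult_def if_distrib[where f = "\<lambda>x. _ * x"] sum.delta cong: if_cong)
  then show ?thesis
    by (simp add: matrix_matrix_mult_def[of "X ** mat_unit j k"] if_distrib[where f = "\<lambda>x. x * _"] sum.delta cong: if_cong)
qed

text \<open>Double brackets are traceless, so the trace over \<open>su3C\<close> can be taken over
  all matrices, with the nine matrix units as frame. This gives the formula for gl(n), 2n times the
  trace form minus twice the product of traces, at n = 3.\<close>

lemma killing_eq: "killing A B = 6 * trace (A ** B) - 2 * trace A * trace B"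
proof -
  let ?f = "\<lambda>Z. lie_bracket A (lie_bracket B Z)"
  have diff: "X ** (Y - Z) = X ** Y - X ** Z" "(Y - Z) ** X = Y ** X - Z ** X" for X Y Z :: cmat3
    by (simp_all add: vec_eq_iff matrix_matrix_mult_def sum_3 algebra_simps)
  \<comment> \<open>A sum of maps \<open>X ** Z ** Y\<close>, each with trace
    \<open>trace X * trace Y\<close> on the space of matrices.\<close>
  have f: "?f Z = A ** B ** Z ** mat 1 - A ** Z ** B - B ** Z ** A + mat 1 ** Z ** (B ** A)" for Z
    by (simp add: lie_bracket_def matrix_mul_assoc diff algebra_simps)
  have "killing A B = (\<Sum>p\<in>UNIV. (?f (mat_unit (fst p) (snd p))) $ fst p $ snd p)"
    unfolding killing_def
  proof (rule endo_trace_frame)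
    show "cmat.subspace su3C"
      by (auto simp: cmat.subspace_def su3C_eq trace_simps trace_def[of 0])
    show "?f (mat_unit (fst p) (snd p)) \<in> su3C" for p
      by (simp add: su3C_eq lie_bracket_def trace_sub trace_mul_sym[of A])
    show "Z = (\<Sum>p\<in>UNIV. cscale (Z $ fst p $ snd p) (mat_unit (fst p) (snd p)))" if "Z \<in> su3C" for Z
    proof -
      have "(\<Sum>p\<in>UNIV. cscale (Z $ fst p $ snd p) (mat_unit (fst p) (snd p))) $ a $ b = Z $ a $ b" for a b
      proof -
        have "(\<Sum>p\<in>UNIV. cscale (Z $ fst p $ snd p) (mat_unit (fst p) (snd p))) $ a $ b
            = (\<Sum>p\<in>UNIV. if p = (a, b) then Z $ a $ b else 0)"
          unfolding sum_component by (intro sum.cong) (auto simp: cscale_nth)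
        then show ?thesis by simp
      qed
      then show ?thesis
        by (simp add: vec_eq_iff)
    qed
  qed (simp_all add: f matrix_matrix_mult_def vec_eq_iff cscale_nth sum_3 algebra_simps)
  also have "\<dots> = (\<Sum>p\<in>UNIV. (A ** B) $ fst p $ fst p - A $ fst p $ fst p * B $ snd p $ snd p
      - B $ fst p $ fst p * A $ snd p $ snd p + (B ** A) $ snd p $ snd p)"
    unfolding f vector_add_component vector_minus_component mat_unit_sandwich_nth by (simp add: mat_def)
  also have "\<dots> = (\<Sum>j\<in>UNIV. \<Sum>k\<in>UNIV. (A ** B) $ j $ j - A $ j $ j * B $ k $ k
      - B $ j $ j * A $ k $ k + (B ** A) $ k $ k)"
    unfolding UNIV_Times_UNIV[symmetric] sum.cartesian_product by (simp add: case_prod_unfold)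
  also have "\<dots> = 3 * trace (A ** B) - 2 * trace A * trace B + 3 * trace (B ** A)"
    by (simp add: trace_def sum_3 algebra_simps)
  also have "\<dots> = 6 * trace (A ** B) - 2 * trace A * trace B"
    by (simp add: trace_mul_sym[of B A])
  finally show ?thesis .
qed

lemma killing_conj_by: "orthogonal_matrix Q \<Longrightarrow> killing (conj_by Q A) (conj_by Q B) = killing A B"
  by (simp add: killing_eq trace_conj_by flip: conj_by_times)

section \<open>Diagonal matrices and maximal flats\<close>

definition cdiag :: "complex \<Rightarrow> complex \<Rightarrow> cmat3" where
  "cdiag u v = vector [vector [u, 0, 0], vector [0, v, 0], vector [0, 0, - u - v]]"

lemma cdiag_nth [simp]:
  "cdiag u v $ 1 $ 1 = u" "cdiag u v $ 2 $ 2 = v" "cdiag u v $ 3 $ 3 = - u - v"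
  "i \<noteq> j \<Longrightarrow> cdiag u v $ i $ j = 0"
proof -
  show "i \<noteq> j \<Longrightarrow> cdiag u v $ i $ j = 0"
    using exhaust_3[of i] exhaust_3[of j] by (auto simp: cdiag_def)
qed (simp_all add: cdiag_def)

lemma isym_diag_eq_cdiag: "isym x y 0 0 0 = cdiag (\<i> * complex_of_real x) (\<i> * complex_of_real y)"
  by (simp add: vec_eq_iff forall_3 algebra_simps)

lemma lie_bracket_cdiag_nth:
  "lie_bracket (cdiag u v) Z $ i $ j = (cdiag u v $ i $ i - cdiag u v $ j $ j) * Z $ i $ j"
  using exhaust_3[of i] exhaust_3[of j]
  by (auto simp: lie_bracket_def matrix_matrix_mult_def sum_3 algebra_simps)

definition diag_flat :: "real^3^3 \<Rightarrow> cmat3 set" where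
  "diag_flat Q = conj_by Q ` {isym x y 0 0 0 | x y. True}"

lemma diag_flat_iff: "A \<in> diag_flat Q \<longleftrightarrow> (\<exists>x y. A = conj_by Q (isym x y 0 0 0))"
  by (auto simp: diag_flat_def)

lemma flat_diagonals: "flat_subspace {isym x y 0 0 0 | x y. True}"
proof -
  have "lie_triple_system {isym x y 0 0 0 | x y. True}"
    by (rule lie_triple_system_model[of TypeT]) simp
  then show ?thesis
    by (auto simp: lie_triple_system_def flat_subspace_def lie_bracket_isym)
qed

lemma diagonals_self_centralizing:
  assumes "A \<in> su3_m" "\<And>x y. lie_bracket (isym x y 0 0 0) A = 0"
  shows "A \<in> {isym x y 0 0 0 | x y. True}"
  using assms(1) assms(2)[of 1 0] assms(2)[of 0 1] by (auto simp: su3_m_eq lie_bracket_isym)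

text \<open>A larger flat would commute with all diagonal matrices of the basis, and these are
  self-centralising.\<close>

lemma maximal_flat_diag_flat:
  assumes Q: "orthogonal_matrix Q"
  shows "maximal_flat (diag_flat Q)"
  unfolding maximal_flat_def
proof (intro conjI allI impI)
  show "flat_subspace (diag_flat Q)"
    unfolding diag_flat_def by (rule flat_subspace_conj_by[OF Q flat_diagonals])
  fix b assume b: "flat_subspace b \<and> diag_flat Q \<subseteq> b"
  have "A \<in> diag_flat Q" if "A \<in> b" for A
  proof -
    have "lie_bracket (conj_by Q (isym x y 0 0 0)) A = 0" for x y
      using b that diag_flat_iff[of "conj_by Q (isym x y 0 0 0)" Q] unfolding flat_subspace_def by blast
    then have "lie_bracket (isym x y 0 0 0) (conj_by (transpose Q) A) = 0" for x y
      using conj_by_lie_bracket[OF Q, of "isym x y 0 0 0" "conj_by (transpose Q) A"]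
      by (simp add: conj_by_inverse Q conj_by_eq_0_iff)
    moreover have "conj_by (transpose Q) A \<in> su3_m"
      using b that Q by (auto simp: flat_subspace_def conj_by_in_su3_m)
    ultimately have "conj_by (transpose Q) A \<in> {isym x y 0 0 0 | x y. True}"
      by (intro diagonals_self_centralizing)
    then obtain x y where "conj_by (transpose Q) A = isym x y 0 0 0"
      by blast
    then have "A = conj_by Q (isym x y 0 0 0)"
      using conj_by_inverse(2)[OF Q, of A] by simp
    then show ?thesis
      by (auto simp: diag_flat_iff)
  qed
  then show "b = diag_flat Q"
    using b by blast
qed

text \<open>Two independent elements are diagonalised jointly, and what commutes with both is
  diagonal too. Otherwise \<open>a\<close> is at most a line and one nonzero element
  suffices.\<close>

lemma flat_subset_diag_flat:
  assumes "flat_subspace a"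
  obtains Q where "orthogonal_matrix Q" "a \<subseteq> diag_flat Q"
proof (cases "\<exists>A\<in>a. \<exists>B\<in>a. \<not> (\<exists>r s. (r, s) \<noteq> (0, 0) \<and> r *\<^sub>R A + s *\<^sub>R B = 0)")
  case True
  then obtain A B where AB: "A \<in> a" "B \<in> a" and indep: "\<And>r s. r *\<^sub>R A + s *\<^sub>R B = 0 \<Longrightarrow> r = 0 \<and> s = 0"
    by auto
  have "A \<in> su3_m" "B \<in> su3_m" "lie_bracket A B = 0"
    using assms AB by (auto simp: flat_subspace_def)
  then obtain Q x y x' y' where Q: "orthogonal_matrix Q" and A: "A = conj_by Q (isym x y 0 0 0)"
    and B: "B = conj_by Q (isym x' y' 0 0 0)"
    using commuting_su3_m_diagonalizable by blast
  have comb: "r *\<^sub>R A + s *\<^sub>R B = conj_by Q (isym (r * x + s * x') (r * y + s * y') 0 0 0)" for r s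
    by (simp add: A B isym_scaleR isym_add flip: conj_by_scaleR conj_by_add)
  have d: "x * y' - x' * y \<noteq> 0"
  proof
    assume d: "x * y' - x' * y = 0"
    have "y' *\<^sub>R A + (- y) *\<^sub>R B = 0" "x' *\<^sub>R A + (- x) *\<^sub>R B = 0"
      unfolding comb using d by (auto simp add: algebra_simps isym_0[symmetric])
    from indep[OF this(1)] indep[OF this(2)] have "1 *\<^sub>R A + 0 *\<^sub>R B = 0"
      unfolding comb by (simp add: isym_0[symmetric])
    then show False
      using indep by fastforce
  qed
  have "C \<in> diag_flat Q" if "C \<in> a" for C
  proof -
    have C: "C \<in> su3_m" "lie_bracket A C = 0" "lie_bracket B C = 0"
      using assms AB that by (auto simp: flat_subspace_def)
    obtain u v p q r where uv: "conj_by (transpose Q) C = isym u v p q r"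
      using conj_by_in_su3_m[OF orthogonal_transpose[OF Q] C(1)] by (auto simp: su3_m_eq)
    have Cuv: "conj_by Q (isym u v p q r) = C"
      using conj_by_inverse(2)[OF Q, of C] uv by simp
    have *: "lie_bracket (isym x y 0 0 0) (isym u v p q r) = 0" if "lie_bracket (conj_by Q (isym x y 0 0 0)) C = 0" for x y
      using that conj_by_lie_bracket[OF Q, of "isym x y 0 0 0" "isym u v p q r"]
      by (simp add: Cuv conj_by_eq_0_iff[OF Q])
    have "p * (x - y) = 0" "q * (2 * x + y) = 0" "r * (x + 2 * y) = 0"
      "p * (x' - y') = 0" "q * (2 * x' + y') = 0" "r * (x' + 2 * y') = 0"
      using *[OF C(2)[unfolded A]] *[OF C(3)[unfolded B]] by (auto simp: lie_bracket_isym algebra_simps)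
    \<comment> \<open>A root vanishing on both \<open>A\<close> and \<open>B\<close> would make
      their diagonals proportional.\<close>
    moreover have "x \<noteq> y \<or> x' \<noteq> y'" "2 * x + y \<noteq> 0 \<or> 2 * x' + y' \<noteq> 0" "x + 2 * y \<noteq> 0 \<or> x' + 2 * y' \<noteq> 0"
      using d by (auto simp: algebra_simps add_eq_0_iff2)
    ultimately have "p = 0" "q = 0" "r = 0"
      by auto
    then have "C = conj_by Q (isym u v 0 0 0)"
      using Cuv by simp
    then show ?thesis
      by (auto simp: diag_flat_iff)
  qed
  then show ?thesis
    using that Q by blast
next
  case False
  show ?thesis
  proof (cases "a \<subseteq> {0}")
    case True
    have "0 \<in> diag_flat (mat 1)"
      unfolding diag_flat_iff by (intro exI[of _ 0]) (simp add: isym_0[symmetric])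
    then show ?thesis
      using that[of "mat 1"] True by (auto simp: orthogonal_matrix_id)
  next
    case nontriv: False
    then obtain A where A: "A \<in> a" "A \<noteq> 0" by blast
    then have "A \<in> su3_m"
      using assms by (auto simp: flat_subspace_def)
    then obtain Q h k where Q: "orthogonal_matrix Q" "A = conj_by Q (isym h k 0 0 0)"
      using su3_m_diagonalizable_ordered by metis
    have "B \<in> diag_flat Q" if B: "B \<in> a" for B
    proof -
      obtain r s where rs: "(r, s) \<noteq> (0, 0)" "r *\<^sub>R A + s *\<^sub>R B = 0"
        using False A(1) B by blast
      then have "s \<noteq> 0"
        using A(2) by auto
      then have "B = (- r / s) *\<^sub>R A"
        using arg_cong[OF rs(2), of "scaleR (1 / s)"]
        by (simp add: scaleR_right_distrib eq_neg_iff_add_eq_0 add.commute)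
      then show ?thesis
        unfolding diag_flat_iff Q(2) conj_by_scaleR[symmetric] isym_scaleR by auto
    qed
    then show ?thesis
      using that Q(1) by blast
  qed
qed

lemma maximal_flat_iff: "maximal_flat a \<longleftrightarrow> (\<exists>Q. orthogonal_matrix Q \<and> a = diag_flat Q)"
proof
  assume a: "maximal_flat a"
  then obtain Q where "orthogonal_matrix Q" "a \<subseteq> diag_flat Q"
    using flat_subset_diag_flat unfolding maximal_flat_def by blast
  then show "\<exists>Q. orthogonal_matrix Q \<and> a = diag_flat Q"
    using a maximal_flat_diag_flat unfolding maximal_flat_def by metis
qed (auto simp: maximal_flat_diag_flat)

lemma complexification_diag_flat: "complexification (diag_flat Q) = conj_by Q ` {cdiag u v | u v. True}"
proof -
  have "isym x y 0 0 0 + cscale \<i> (isym x' y' 0 0 0) = cdiag (Complex (- x') x) (Complex (- y') y)" for x y x' y'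
    by (simp add: vec_eq_iff forall_3 cscale_nth complex_eq_iff)
  then have *: "conj_by Q (isym x y 0 0 0) + cscale \<i> (conj_by Q (isym x' y' 0 0 0)) =
      conj_by Q (cdiag (Complex (- x') x) (Complex (- y') y))" for x y x' y'
    by (metis conj_by_add conj_by_cscale)
  show ?thesis
  proof (intro set_eqI iffI)
    fix Z assume "Z \<in> complexification (diag_flat Q)"
    then show "Z \<in> conj_by Q ` {cdiag u v | u v. True}"
      unfolding complexification_def diag_flat_iff using * by blast
  next
    fix Z assume "Z \<in> conj_by Q ` {cdiag u v | u v. True}"
    then obtain u v where Z: "Z = conj_by Q (cdiag u v)"
      by blast
    have "Z = conj_by Q (isym (Im u) (Im v) 0 0 0) + cscale \<i> (conj_by Q (isym (- Re u) (- Re v) 0 0 0))"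
      by (simp add: * Z)
    then show "Z \<in> complexification (diag_flat Q)"
      unfolding complexification_def diag_flat_iff by blast
  qed
qed

lemma complexification_diag_flat_iff:
  "Z \<in> complexification (diag_flat Q) \<longleftrightarrow> (\<exists>u v. Z = conj_by Q (cdiag u v))"
  by (auto simp: complexification_diag_flat)

section \<open>Roots\<close>

text \<open>The value 0 off the complexified flat follows the convention of
  \<open>dual_space\<close>, so that roots can be compared as functions.\<close>

definition diag_root :: "real^3^3 \<Rightarrow> 3 \<Rightarrow> 3 \<Rightarrow> cfunctional" where
  "diag_root Q j k = (\<lambda>Z. if Z \<in> complexification (diag_flat Q)
     then conj_by (transpose Q) Z $ j $ j - conj_by (transpose Q) Z $ k $ k else 0)"

lemma diag_root_conj_by_cdiag:
  assumes "orthogonal_matrix Q"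
  shows "diag_root Q j k (conj_by Q (cdiag u v)) = cdiag u v $ j $ j - cdiag u v $ k $ k"
  using assms by (auto simp: diag_root_def complexification_diag_flat conj_by_inverse)

lemma diag_root_outside: "Z \<notin> complexification (diag_flat Q) \<Longrightarrow> diag_root Q j k Z = 0"
  by (simp add: diag_root_def)

text \<open>An element on which all roots take different values.\<close>
definition regular_diag :: cmat3 where
  "regular_diag = cdiag 4 (- 1)"

text \<open>An integer copy of the diagonal of \<open>regular_diag\<close>: comparing roots becomes
  integer arithmetic with the values 5, 7, 2 and their negatives.\<close>

definition regular_entry :: "3 \<Rightarrow> int" where
  "regular_entry j = (if j = 1 then 4 else if j = 2 then - 1 else - 3)"

lemma regular_diag_nth: "regular_diag $ j $ j = of_int (regular_entry j)"
  using exhaust_3[of j] by (auto simp: regular_diag_def regular_entry_def)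

lemma diag_root_regular:
  "orthogonal_matrix Q \<Longrightarrow> diag_root Q j k (conj_by Q regular_diag) = of_int (regular_entry j - regular_entry k)"
  using diag_root_conj_by_cdiag[of Q j k 4 "- 1"] by (simp add: regular_diag_nth flip: regular_diag_def)

lemma regular_entry_eq_iff: "regular_entry a = regular_entry b \<longleftrightarrow> a = b"
  using exhaust_3[of a] exhaust_3[of b] by (auto simp: regular_entry_def)

lemma regular_entry_diff_eq_iff:
  "j \<noteq> k \<Longrightarrow> regular_entry a - regular_entry b = regular_entry j - regular_entry k \<longleftrightarrow> a = j \<and> b = k"
  using exhaust_3[of a] exhaust_3[of b] exhaust_3[of j] exhaust_3[of k]
  by (elim disjE; simp add: regular_entry_def)

text \<open>Up to sign and order, \<open>5 + 2 = 7\<close> is the only way for two root values to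
  add up to a third, and it is the relation of the A2 roots. So one element detects whether a sum of
  roots is a root.\<close>

lemma regular_entry_diff_sum_iff:
  assumes "j \<noteq> k" "l \<noteq> m" "p \<noteq> q"
    "regular_entry j - regular_entry k + (regular_entry l - regular_entry m) = regular_entry p - regular_entry q"
  shows "k = l \<and> j \<noteq> m \<or> j = m \<and> k \<noteq> l"
proof -
  have "regular_entry p - regular_entry q \<in> {5, - 5, 7, - 7, 2, - 2}"
    using assms(3) exhaust_3[of p] exhaust_3[of q] by (elim disjE; simp add: regular_entry_def)
  then have "regular_entry j - regular_entry k + (regular_entry l - regular_entry m) \<in> {5, - 5, 7, - 7, 2, - 2}"
    by (simp only: assms(4))
  then show ?thesis
    using assms(1,2) exhaust_3[of j] exhaust_3[of k] exhaust_3[of l] exhaust_3[of m]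
    by (elim disjE; simp add: regular_entry_def)
qed

lemma diag_root_eq_iff:
  assumes "orthogonal_matrix Q" "j \<noteq> k"
  shows "diag_root Q a b = diag_root Q j k \<longleftrightarrow> a = j \<and> b = k"
proof
  assume "diag_root Q a b = diag_root Q j k"
  then have "(of_int (regular_entry a - regular_entry b) :: complex) = of_int (regular_entry j - regular_entry k)"
    using diag_root_regular[OF assms(1)] by metis
  then show "a = j \<and> b = k"
    unfolding of_int_eq_iff using regular_entry_diff_eq_iff[OF assms(2)] by simp
qed simp

lemma diag_root_nonzero:
  assumes "orthogonal_matrix Q" "j \<noteq> k"
  shows "diag_root Q j k \<noteq> 0"
proof
  assume "diag_root Q j k = 0"
  then have "(of_int (regular_entry j - regular_entry k) :: complex) = 0"
    using diag_root_regular[OF assms(1), of j k] by simp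
  then show False
    using assms(2) by (simp add: regular_entry_eq_iff)
qed

lemma diag_root_add: "diag_root Q j k + diag_root Q k l = diag_root Q j l"
  by (auto simp: fun_eq_iff diag_root_def)

lemma diag_root_same: "diag_root Q j j = 0"
  by (auto simp: fun_eq_iff diag_root_def)

lemma diag_root_uminus: "- diag_root Q j k = diag_root Q k j"
  by (auto simp: fun_eq_iff diag_root_def)

lemma diag_root_in_dual_space:
  assumes Q: "orthogonal_matrix Q"
  shows "diag_root Q j k \<in> dual_space (complexification (diag_flat Q))"
proof -
  let ?C = "complexification (diag_flat Q)"
  have "A + B \<in> ?C" if mem: "A \<in> ?C" "B \<in> ?C" for A B
  proof -
    obtain u v u' v' where AB: "A = conj_by Q (cdiag u v)" "B = conj_by Q (cdiag u' v')"
      using mem unfolding complexification_diag_flat_iff by blast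
    have "cdiag u v + cdiag u' v' = cdiag (u + u') (v + v')"
      by (simp add: vec_eq_iff forall_3)
    then have "A + B = conj_by Q (cdiag (u + u') (v + v'))"
      by (simp add: AB flip: conj_by_add)
    then show ?thesis
      unfolding complexification_diag_flat_iff by blast
  qed
  moreover have "cscale c A \<in> ?C" if mem: "A \<in> ?C" for c A
  proof -
    obtain u v where A: "A = conj_by Q (cdiag u v)"
      using mem unfolding complexification_diag_flat_iff by blast
    have "cscale c (cdiag u v) = cdiag (c * u) (c * v)"
      by (simp add: vec_eq_iff forall_3 cscale_nth algebra_simps)
    then have "cscale c A = conj_by Q (cdiag (c * u) (c * v))"
      by (simp add: A flip: conj_by_cscale)
    then show ?thesis
      unfolding complexification_diag_flat_iff by blast
  qed
  ultimately show ?thesis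
    by (simp add: dual_space_def diag_root_def conj_by_add conj_by_cscale cscale_nth algebra_simps)
qed

definition root_vec :: "real^3^3 \<Rightarrow> 3 \<Rightarrow> 3 \<Rightarrow> cmat3" where
  "root_vec Q j k = conj_by Q (mat_unit j k)"

lemma mat_unit_nonzero: "mat_unit j k \<noteq> 0"
proof
  assume "mat_unit j k = 0"
  then have "mat_unit j k $ j $ k = 0"
    by (simp only: zero_index)
  then show False by simp
qed

lemma root_vec_nonzero: "orthogonal_matrix Q \<Longrightarrow> root_vec Q j k \<noteq> 0"
  by (simp add: root_vec_def conj_by_eq_0_iff mat_unit_nonzero)

lemma cscale_root_vec_eq_iff:
  assumes "orthogonal_matrix Q"
  shows "cscale x (root_vec Q j k) = cscale y (root_vec Q j k) \<longleftrightarrow> x = y"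
  using cmat.scale_right_imp_eq[OF root_vec_nonzero[OF assms]] by auto

lemma root_vec_in_su3C:
  assumes "orthogonal_matrix Q" "j \<noteq> k"
  shows "root_vec Q j k \<in> su3C"
  unfolding root_vec_def conj_by_in_su3C_iff[OF assms(1)] using assms(2) by (auto simp: su3C_eq trace_def intro!: sum.neutral)

lemma lie_bracket_root_vec:
  assumes "orthogonal_matrix Q"
  shows "lie_bracket (root_vec Q j k) (root_vec Q l m) =
    (if k = l then root_vec Q j m else 0) - (if m = j then root_vec Q l k else 0)"
proof -
  have mult: "mat_unit j k ** mat_unit l m = (if k = l then mat_unit j m else 0)" for j k l m
    by (auto simp: vec_eq_iff matrix_matrix_mult_def if_distrib[where f = "\<lambda>x. x * _"] sum.delta cong: if_cong)
  show ?thesis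
    unfolding root_vec_def conj_by_lie_bracket[OF assms, symmetric]
    unfolding lie_bracket_def mult
    by (simp add: conj_by_diff)
qed

lemma lie_bracket_cscale:
  "lie_bracket (cscale x A) (cscale y B) = cscale (x * y) (lie_bracket A B)"
  by (simp add: lie_bracket_def vec_eq_iff matrix_matrix_mult_def cscale_nth sum_3 algebra_simps)

text \<open>In the diagonalising basis the eigenvalue equations decouple: at each index pair either
  the entry vanishes or \<alpha> is the difference of the two coordinates.\<close>

lemma root_space_diag_iff:
  assumes Q: "orthogonal_matrix Q"
  shows "Z \<in> root_space (diag_flat Q) \<alpha> \<longleftrightarrow> Z \<in> su3C \<and>
    (\<forall>u v j k. (cdiag u v $ j $ j - cdiag u v $ k $ k - \<alpha> (conj_by Q (cdiag u v))) * conj_by (transpose Q) Z $ j $ k = 0)"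
proof -
  define W where "W = conj_by (transpose Q) Z"
  have Z: "Z = conj_by Q W"
    using conj_by_inverse(2)[OF Q] by (simp add: W_def)
  have *: "lie_bracket (conj_by Q (cdiag u v)) Z = cscale (\<alpha> (conj_by Q (cdiag u v))) Z \<longleftrightarrow>
      (\<forall>j k. (cdiag u v $ j $ j - cdiag u v $ k $ k - \<alpha> (conj_by Q (cdiag u v))) * W $ j $ k = 0)" for u v
    unfolding Z conj_by_lie_bracket[OF Q, symmetric] conj_by_cscale[symmetric] conj_by_eq_iff[OF Q]
    unfolding vec_eq_iff[of "lie_bracket _ _"] vec_eq_iff[of "lie_bracket _ _ $ _"] lie_bracket_cdiag_nth cscale_nth
    by (simp add: left_diff_distrib)
  have "Z \<in> root_space (diag_flat Q) \<alpha> \<longleftrightarrow> Z \<in> su3C \<and>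
      (\<forall>u v. lie_bracket (conj_by Q (cdiag u v)) Z = cscale (\<alpha> (conj_by Q (cdiag u v))) Z)"
    unfolding root_space_def complexification_diag_flat by blast
  then show ?thesis
    unfolding * W_def .
qed

lemma root_space_diag_root:
  assumes Q: "orthogonal_matrix Q" and "j \<noteq> k"
  shows "root_space (diag_flat Q) (diag_root Q j k) = {cscale x (root_vec Q j k) | x. True}"
proof (intro set_eqI iffI)
  fix Z assume Z: "Z \<in> root_space (diag_flat Q) (diag_root Q j k)"
  define W where "W = conj_by (transpose Q) Z"
  have "W $ a $ b = 0" if "(a, b) \<noteq> (j, k)" for a b
  proof -
    have "(regular_diag $ a $ a - regular_diag $ b $ b - diag_root Q j k (conj_by Q regular_diag)) * W $ a $ b = 0"
      using Z unfolding root_space_diag_iff[OF Q] W_def regular_diag_def by blast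
    moreover have "regular_diag $ a $ a - regular_diag $ b $ b - diag_root Q j k (conj_by Q regular_diag)
        = of_int (regular_entry a - regular_entry b - (regular_entry j - regular_entry k))"
      by (simp add: diag_root_regular Q regular_diag_nth)
    moreover have "regular_entry a - regular_entry b - (regular_entry j - regular_entry k) \<noteq> 0"
      using that regular_entry_diff_eq_iff[OF assms(2), of a b] by auto
    ultimately show ?thesis
      by (metis mult_eq_0_iff of_int_eq_0_iff)
  qed
  then have "W = cscale (W $ j $ k) (mat_unit j k)"
    by (auto simp: vec_eq_iff cscale_nth)
  then have "Z = cscale (W $ j $ k) (root_vec Q j k)"
    unfolding root_vec_def conj_by_cscale[symmetric] using conj_by_inverse(2)[OF Q, of Z] W_def by simp
  then show "Z \<in> {cscale x (root_vec Q j k) | x. True}"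
    by blast
next
  fix Z assume "Z \<in> {cscale x (root_vec Q j k) | x. True}"
  then obtain x where x: "Z = cscale x (root_vec Q j k)"
    by blast
  have "Z \<in> su3C"
    using root_vec_in_su3C[OF assms] by (simp add: x su3C_eq trace_simps)
  moreover have "conj_by (transpose Q) Z = cscale x (mat_unit j k)"
    by (simp add: x root_vec_def conj_by_cscale conj_by_inverse Q)
  ultimately show "Z \<in> root_space (diag_flat Q) (diag_root Q j k)"
    by (auto simp: root_space_diag_iff[OF Q] diag_root_conj_by_cdiag[OF Q] cscale_nth)
qed

text \<open>One nonzero entry of a root vector already determines the root, and a nonzero root
  excludes diagonal entries.\<close>

lemma roots_diag_flat:
  assumes Q: "orthogonal_matrix Q"
  shows "roots (diag_flat Q) = {diag_root Q j k | j k. j \<noteq> k}"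
proof (intro set_eqI iffI)
  fix \<alpha> assume "\<alpha> \<in> roots (diag_flat Q)"
  then have \<alpha>: "\<alpha> \<in> dual_space (complexification (diag_flat Q))" "\<alpha> \<noteq> 0"
    and ne: "root_space (diag_flat Q) \<alpha> \<noteq> {0}"
    by (auto simp: roots_def)
  have "0 \<in> root_space (diag_flat Q) \<alpha>"
    using cmat.subspace_0 by (simp add: root_space_diag_iff[OF Q] su3C_eq) (simp add: trace_def)
  then obtain Z where Z: "Z \<in> root_space (diag_flat Q) \<alpha>" "Z \<noteq> 0"
    using ne by blast
  then have "conj_by (transpose Q) Z \<noteq> 0"
    by (simp add: conj_by_eq_0_iff Q)
  then obtain j k where jk: "conj_by (transpose Q) Z $ j $ k \<noteq> 0"
    by (auto simp: vec_eq_iff)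
  have eval: "\<alpha> (conj_by Q (cdiag u v)) = cdiag u v $ j $ j - cdiag u v $ k $ k" for u v
  proof -
    have "(cdiag u v $ j $ j - cdiag u v $ k $ k - \<alpha> (conj_by Q (cdiag u v))) * conj_by (transpose Q) Z $ j $ k = 0"
      using Z(1) unfolding root_space_diag_iff[OF Q] by blast
    then show ?thesis
      using jk by simp
  qed
  have "\<alpha> Y = diag_root Q j k Y" for Y
  proof (cases "Y \<in> complexification (diag_flat Q)")
    case True
    then obtain u v where "Y = conj_by Q (cdiag u v)"
      unfolding complexification_diag_flat_iff by blast
    then show ?thesis
      by (simp add: eval diag_root_conj_by_cdiag[OF Q])
  next
    case False
    then show ?thesis
      using \<alpha>(1) by (simp add: dual_space_def diag_root_outside)
  qed
  then have "\<alpha> = diag_root Q j k" by blast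
  moreover have "j \<noteq> k"
    using \<alpha>(2) calculation diag_root_same by metis
  ultimately show "\<alpha> \<in> {diag_root Q j k | j k. j \<noteq> k}"
    by blast
next
  fix \<alpha> assume "\<alpha> \<in> {diag_root Q j k | j k. j \<noteq> k}"
  then obtain j k where jk: "\<alpha> = diag_root Q j k" "j \<noteq> k"
    by blast
  have "cscale 1 (root_vec Q j k) \<in> root_space (diag_flat Q) \<alpha>"
    unfolding jk(1) root_space_diag_root[OF Q jk(2)] by blast
  then have "root_space (diag_flat Q) \<alpha> \<noteq> {0}"
    using root_vec_nonzero[OF Q, of j k] by auto
  then show "\<alpha> \<in> roots (diag_flat Q)"
    using diag_root_nonzero[OF Q jk(2)] diag_root_in_dual_space[OF Q] by (simp add: roots_def jk(1))
qed

lemma diag_root_sum_in_roots_iff: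
  assumes Q: "orthogonal_matrix Q" and "j \<noteq> k" "l \<noteq> m"
  shows "diag_root Q j k + diag_root Q l m \<in> roots (diag_flat Q) \<longleftrightarrow> (k = l \<and> j \<noteq> m) \<or> (j = m \<and> k \<noteq> l)"
proof
  assume "diag_root Q j k + diag_root Q l m \<in> roots (diag_flat Q)"
  then obtain p q where pq: "p \<noteq> q" "diag_root Q j k + diag_root Q l m = diag_root Q p q"
    unfolding roots_diag_flat[OF Q] by blast
  from fun_cong[OF pq(2), of "conj_by Q regular_diag"]
  have "(of_int (regular_entry j - regular_entry k + (regular_entry l - regular_entry m)) :: complex)
      = of_int (regular_entry p - regular_entry q)"
    by (simp add: diag_root_regular[OF Q])
  then show "k = l \<and> j \<noteq> m \<or> j = m \<and> k \<noteq> l"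
    unfolding of_int_eq_iff using regular_entry_diff_sum_iff assms(2,3) pq(1) by blast
next
  assume "k = l \<and> j \<noteq> m \<or> j = m \<and> k \<noteq> l"
  then have "diag_root Q j k + diag_root Q l m = diag_root Q j m \<and> j \<noteq> m \<or>
      diag_root Q j k + diag_root Q l m = diag_root Q l k \<and> l \<noteq> k"
    using diag_root_add[of Q] by (metis add.commute)
  then show "diag_root Q j k + diag_root Q l m \<in> roots (diag_flat Q)"
    unfolding roots_diag_flat[OF Q] by auto
qed

text \<open>By linear independence, coefficients 1 and -1 cannot be replaced by coefficients of one
  sign.\<close>

lemma simple_system_diff:
  assumes "simple_system a {\<alpha>, \<beta>}" "\<alpha> \<noteq> \<beta>"
  shows "\<alpha> - \<beta> \<notin> roots a" "\<alpha> + \<beta> \<noteq> 0"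
proof -
  have indep: "p = 0 \<and> q = 0" if "\<And>H. p * \<alpha> H + q * \<beta> H = 0" for p q
  proof -
    have *: "\<forall>H. (\<Sum>\<gamma>\<in>{\<alpha>, \<beta>}. (if \<gamma> = \<alpha> then p else q) * \<gamma> H) = 0"
      using that assms(2) by auto
    have "\<And>u :: cfunctional \<Rightarrow> complex. (\<forall>H. (\<Sum>\<gamma>\<in>{\<alpha>, \<beta>}. u \<gamma> * \<gamma> H) = 0) \<Longrightarrow> \<forall>\<gamma>\<in>{\<alpha>, \<beta>}. u \<gamma> = 0"
      using assms(1) unfolding simple_system_def by blast
    from this[OF *] have "\<forall>\<gamma>\<in>{\<alpha>, \<beta>}. (if \<gamma> = \<alpha> then p else q) = 0" .
    then show ?thesis
      using assms(2) by auto
  qed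
  show "\<alpha> + \<beta> \<noteq> 0"
  proof
    assume "\<alpha> + \<beta> = 0"
    then have "1 * \<alpha> H + 1 * \<beta> H = 0" for H
      by (simp add: fun_eq_iff)
    then show False
      using indep[of 1 1] by auto
  qed
  show "\<alpha> - \<beta> \<notin> roots a"
  proof
    assume "\<alpha> - \<beta> \<in> roots a"
    then obtain n :: "cfunctional \<Rightarrow> nat" where
      "(\<forall>H. (\<alpha> - \<beta>) H = (\<Sum>\<gamma>\<in>{\<alpha>, \<beta>}. of_nat (n \<gamma>) * \<gamma> H)) \<or>
       (\<forall>H. (\<alpha> - \<beta>) H = - (\<Sum>\<gamma>\<in>{\<alpha>, \<beta>}. of_nat (n \<gamma>) * \<gamma> H))"
      using assms(1) unfolding simple_system_def by blast
    then show False
    proof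
      assume *: "\<forall>H. (\<alpha> - \<beta>) H = (\<Sum>\<gamma>\<in>{\<alpha>, \<beta>}. of_nat (n \<gamma>) * \<gamma> H)"
      have "(of_nat (n \<alpha>) - 1) * \<alpha> H + (of_nat (n \<beta>) + 1) * \<beta> H = 0" for H
        using spec[OF *, of H] assms(2) by (simp add: algebra_simps)
      from indep[OF this] have "of_nat (Suc (n \<beta>)) = (0 :: complex)"
        by (simp add: add.commute)
      then show False
        unfolding of_nat_eq_0_iff by simp
    next
      assume *: "\<forall>H. (\<alpha> - \<beta>) H = - (\<Sum>\<gamma>\<in>{\<alpha>, \<beta>}. of_nat (n \<gamma>) * \<gamma> H)"
      have "(of_nat (n \<alpha>) + 1) * \<alpha> H + (of_nat (n \<beta>) - 1) * \<beta> H = 0" for H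
        using spec[OF *, of H] assms(2) by (simp add: algebra_simps)
      from indep[OF this] have "of_nat (Suc (n \<alpha>)) = (0 :: complex)"
        by (simp add: add.commute)
      then show False
        unfolding of_nat_eq_0_iff by simp
    qed
  qed
qed

text \<open>Distinct roots sharing a first or a second index differ by a root, and opposite roots
  are dependent. With three indices only a chain is left, in either order.\<close>

lemma simple_system_diag_flat:
  assumes Q: "orthogonal_matrix Q" and simple: "simple_system (diag_flat Q) {\<alpha>, \<beta>}" and "\<alpha> \<noteq> \<beta>"
  obtains j k l where "j \<noteq> k" "k \<noteq> l" "j \<noteq> l"
    "(\<alpha>, \<beta>) = (diag_root Q j k, diag_root Q k l) \<or> (\<alpha>, \<beta>) = (diag_root Q k l, diag_root Q j k)"
proof -
  have "\<alpha> \<in> roots (diag_flat Q)" "\<beta> \<in> roots (diag_flat Q)"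
    using simple by (auto simp: simple_system_def)
  then obtain j k l m where jk: "j \<noteq> k" "\<alpha> = diag_root Q j k" and lm: "l \<noteq> m" "\<beta> = diag_root Q l m"
    unfolding roots_diag_flat[OF Q] by blast
  have "\<not> (k = l \<and> j = m)"
    using simple_system_diff(2)[OF simple assms(3)] diag_root_add[of Q j k j] diag_root_same[of Q j]
    unfolding jk(2) lm(2) by metis
  have "j \<noteq> l" if "k \<noteq> m"
  proof
    assume "j = l"
    then have "\<alpha> - \<beta> = diag_root Q m k"
      using jk lm by (auto simp: fun_eq_iff diag_root_def)
    then show False
      using simple_system_diff(1)[OF simple assms(3)] that roots_diag_flat[OF Q] by auto
  qed
  moreover have "k \<noteq> m" if "j \<noteq> l"
  proof
    assume "k = m"
    then have "\<alpha> - \<beta> = diag_root Q j l"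
      using jk lm by (auto simp: fun_eq_iff diag_root_def)
    then show False
      using simple_system_diff(1)[OF simple assms(3)] that roots_diag_flat[OF Q] by auto
  qed
  moreover have "\<not> (j = l \<and> k = m)"
    using assms(3) jk lm by auto
  ultimately have "j \<noteq> l" "k \<noteq> m"
    by blast+
  then have "k = l \<and> j \<noteq> m \<or> j = m \<and> k \<noteq> l"
    using \<open>\<not> (k = l \<and> j = m)\<close> jk(1) lm(1) exhaust_3[of j] exhaust_3[of k] exhaust_3[of l] exhaust_3[of m]
    \<open>j \<noteq> l\<close> \<open>k \<noteq> m\<close> by (elim disjE; simp)
  then show ?thesis
  proof
    assume "k = l \<and> j \<noteq> m"
    then show ?thesis
      using that[of j k m] jk lm by simp
  next
    assume "j = m \<and> k \<noteq> l"
    then show ?thesis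
      using that[of l j k] jk lm by auto
  qed
qed

section \<open>Chevalley bases\<close>

text \<open>Used to renumber the basis along the chain of simple roots. One inclusion suffices,
  since both sides are maximal flats.\<close>

lemma diag_flat_perm:
  assumes Q: "orthogonal_matrix Q" and "inj p"
  shows "diag_flat (Q ** perm_matrix p) = diag_flat Q"
proof -
  let ?P = "perm_matrix p"
  have P: "orthogonal_matrix ?P"
    by (rule orthogonal_perm_matrix[OF assms(2)])
  have "conj_by Q (isym x y 0 0 0) \<in> diag_flat (Q ** ?P)" for x y
  proof -
    obtain x' y' a b c where *: "conj_by (transpose ?P) (isym x y 0 0 0) = isym x' y' a b c"
      using conj_by_in_su3_m[OF orthogonal_transpose[OF P], of "isym x y 0 0 0"] by (auto simp: su3_m_eq)
    have "conj_by (transpose ?P) (isym x y 0 0 0) $ i $ j = 0" if "i \<noteq> j" for i j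
      using that assms(2) by (simp add: conj_by_transpose_perm_matrix isym_diag_eq_cdiag inj_eq)
    from this[of 1 2] this[of 1 3] this[of 2 3] have "conj_by (transpose ?P) (isym x y 0 0 0) = isym x' y' 0 0 0"
      using * by simp
    then have "isym x y 0 0 0 = conj_by ?P (isym x' y' 0 0 0)"
      using conj_by_inverse(2)[OF P] by metis
    then have "conj_by Q (isym x y 0 0 0) = conj_by (Q ** ?P) (isym x' y' 0 0 0)"
      by (simp add: conj_by_mult)
    then show ?thesis
      unfolding diag_flat_iff by blast
  qed
  then have "diag_flat Q \<subseteq> diag_flat (Q ** ?P)"
    by (auto simp: diag_flat_iff[of _ Q])
  then show ?thesis
    using maximal_flat_diag_flat[OF Q] maximal_flat_diag_flat[OF orthogonal_matrix_mul[OF Q P]]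
    unfolding maximal_flat_def by blast
qed

lemma diag_root_perm:
  assumes "orthogonal_matrix Q" "inj p"
  shows "diag_root (Q ** perm_matrix p) j k = diag_root Q (p j) (p k)"
proof -
  have "conj_by (transpose (Q ** perm_matrix p)) Z $ i $ i = conj_by (transpose Q) Z $ p i $ p i" for Z i
    unfolding matrix_transpose_mul conj_by_mult[symmetric] conj_by_transpose_perm_matrix ..
  then show ?thesis
    by (simp only: diag_root_def diag_flat_perm[OF assms])
qed

section \<open>Killing duals of the roots\<close>

lemma killing_diff_left: "killing (A - B) C = killing A C - killing B C"
  by (simp add: killing_eq trace_def matrix_matrix_mult_def sum_3 algebra_simps)

lemma killing_cscale_left: "killing (cscale c A) C = c * killing A C"
  by (simp add: killing_eq trace_def matrix_matrix_mult_def sum_3 cscale_nth algebra_simps)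

lemma killing_isym_diag:
  "killing (isym x y 0 0 0) (isym x' y' 0 0 0) = - 6 * complex_of_real (x * x' + y * y' + (x + y) * (x' + y'))"
  by (simp add: killing_eq trace_def matrix_matrix_mult_def sum_3 algebra_simps)

text \<open>Supplies the uniqueness behind the definite descriptions \<open>Hvec\<close> and
  \<open>sharp\<close>.\<close>

lemma killing_definite_diag_flat:
  assumes "orthogonal_matrix Q" "A \<in> diag_flat Q" "killing A A = 0"
  shows "A = 0"
proof -
  obtain x y where A: "A = conj_by Q (isym x y 0 0 0)"
    using assms(2) unfolding diag_flat_iff by blast
  have "- 6 * complex_of_real (x * x + y * y + (x + y) * (x + y)) = 0"
    using assms(3) unfolding A killing_conj_by[OF assms(1)] killing_isym_diag .
  then have "x * x + y * y + (x + y) * (x + y) = 0"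
    unfolding mult_eq_0_iff of_real_eq_0_iff by simp
  then have "x = 0" "y = 0"
    using sum_squares_ge_zero[of x y] zero_le_square[of "x + y"] sum_squares_eq_zero_iff[of x y] by linarith+
  then show ?thesis
    by (simp add: A isym_0[symmetric])
qed

lemma diag_flat_diff:
  assumes "A \<in> diag_flat Q" "B \<in> diag_flat Q"
  shows "A - B \<in> diag_flat Q"
proof -
  obtain x y x' y' where AB: "A = conj_by Q (isym x y 0 0 0)" "B = conj_by Q (isym x' y' 0 0 0)"
    using assms unfolding diag_flat_iff by blast
  have "A - B = conj_by Q (isym (x - x') (y - y') 0 0 0)"
    by (simp add: AB isym_diff flip: conj_by_diff)
  then show ?thesis
    unfolding diag_flat_iff by blast
qed

lemma diag_root_conj_by_isym:
  "orthogonal_matrix Q \<Longrightarrow> diag_root Q j k (conj_by Q (isym x y 0 0 0)) =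
     isym x y 0 0 0 $ j $ j - isym x y 0 0 0 $ k $ k"
  by (simp add: isym_diag_eq_cdiag diag_root_conj_by_cdiag)

lemma sharp_diag_root:
  assumes Q: "orthogonal_matrix Q" and "j \<noteq> k"
  shows "sharp (diag_flat Q) (diag_root Q j k) = cscale (1 / 6) (root_vec Q j j - root_vec Q k k)"
  unfolding sharp_def
proof (rule the_equality)
  let ?Z = "cscale (1 / 6) (root_vec Q j j - root_vec Q k k)"
  \<comment> \<open>The signs are reversed because the factor \<open>\<i>\<close> in front meets the
    \<open>\<i>\<close> inside \<open>isym\<close>; the 6 comes from
    \<open>killing_eq\<close>.\<close>
  let ?x = "(of_bool (k = 1) - of_bool (j = 1)) / 6" and ?y = "(of_bool (k = 2) - of_bool (j = 2)) / 6"
  have "cscale (1 / 6) (mat_unit j j - mat_unit k k) = cscale \<i> (isym ?x ?y 0 0 0)"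
    unfolding vec_eq_iff forall_3 cscale_nth vector_minus_component mat_unit_nth isym_nth
    using assms(2) exhaust_3[of j] exhaust_3[of k] by (elim disjE; simp)
  then have "?Z = cscale \<i> (conj_by Q (isym ?x ?y 0 0 0))"
    unfolding root_vec_def conj_by_diff[symmetric] conj_by_cscale[symmetric] by simp
  then have mem: "?Z \<in> cscale \<i> ` diag_flat Q"
    unfolding image_iff Bex_def diag_flat_iff by blast
  moreover have "killing ?Z H = diag_root Q j k H" if H: "H \<in> diag_flat Q" for H
  proof -
    obtain x y where H: "H = conj_by Q (isym x y 0 0 0)"
      using H unfolding diag_flat_iff by blast
    have tr: "trace (mat_unit j j ** D) = D $ j $ j" for j D
    proof -
      have "(mat_unit j j ** D) $ a $ a = (if a = j then D $ j $ j else 0)" for a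
        using mat_unit_sandwich_nth[of "mat 1" j j D a a] unfolding matrix_mul_lid by (simp add: mat_def)
      then show ?thesis
        by (simp add: trace_def)
    qed
    have "killing (mat_unit j j) (isym x y 0 0 0) = 6 * isym x y 0 0 0 $ j $ j" for j
      by (simp add: killing_eq tr) (simp add: trace_def sum_3 algebra_simps)
    then show ?thesis
      unfolding H root_vec_def killing_cscale_left killing_diff_left killing_conj_by[OF Q] diag_root_conj_by_isym[OF Q]
      by (simp add: algebra_simps)
  qed
  ultimately show "?Z \<in> cscale \<i> ` diag_flat Q \<and> (\<forall>H\<in>diag_flat Q. killing ?Z H = diag_root Q j k H)"
    by blast
  fix Z assume Z: "Z \<in> cscale \<i> ` diag_flat Q \<and> (\<forall>H\<in>diag_flat Q. killing Z H = diag_root Q j k H)"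
  obtain A B where AB: "A \<in> diag_flat Q" "B \<in> diag_flat Q" "Z = cscale \<i> A" "?Z = cscale \<i> B"
    using Z mem by blast
  have "killing Z (A - B) = killing ?Z (A - B)"
    using Z \<open>?Z \<in> cscale \<i> ` diag_flat Q \<and> (\<forall>H\<in>diag_flat Q. killing ?Z H = diag_root Q j k H)\<close>
      diag_flat_diff[OF AB(1,2)] by metis
  then have "killing (A - B) (A - B) = 0"
    unfolding AB(3,4) killing_cscale_left killing_diff_left[of A B "A - B"] by simp
  then have "A = B"
    using killing_definite_diag_flat[OF Q diag_flat_diff[OF AB(1,2)]] by simp
  then show "Z = ?Z"
    using AB(3,4) by simp
qed

text \<open>After renumbering, the sum of the simple roots is
  \<open>diag_root Q 1 3\<close>.\<close>

lemma Hvec_diag_root: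
  assumes Q: "orthogonal_matrix Q"
  shows "Hvec (diag_flat Q) (diag_root Q 1 3) = conj_by Q (isym (1 / 6) 0 0 0 0)"
  unfolding Hvec_def
proof (rule the_equality)
  let ?H = "conj_by Q (isym (1 / 6) 0 0 0 0)"
  have mem: "?H \<in> diag_flat Q"
    unfolding diag_flat_iff by blast
  have eq: "- killing ?H A = 1 / \<i> * diag_root Q 1 3 A" if A: "A \<in> diag_flat Q" for A
  proof -
    obtain x y where A: "A = conj_by Q (isym x y 0 0 0)"
      using A unfolding diag_flat_iff by blast
    show ?thesis
      unfolding A killing_conj_by[OF Q] killing_isym_diag diag_root_conj_by_isym[OF Q]
      by (simp add: field_simps)
  qed
  show "?H \<in> diag_flat Q \<and> (\<forall>A\<in>diag_flat Q. - killing ?H A = 1 / \<i> * diag_root Q 1 3 A)"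
    using mem eq by blast
  fix H assume H: "H \<in> diag_flat Q \<and> (\<forall>A\<in>diag_flat Q. - killing H A = 1 / \<i> * diag_root Q 1 3 A)"
  have d: "H - ?H \<in> diag_flat Q"
    using diag_flat_diff H mem by blast
  have "- killing H (H - ?H) = - killing ?H (H - ?H)"
    using H eq[OF d] d by metis
  then have "killing (H - ?H) (H - ?H) = 0"
    by (subst killing_diff_left) simp
  then show "H = ?H"
    using killing_definite_diag_flat[OF Q d] by simp
qed

section \<open>Normalised root vectors and their signs\<close>

lemma conj_su3_root_vec:
  assumes "orthogonal_matrix Q" "j \<noteq> k"
  shows "- conj_su3 (cscale x (root_vec Q j k)) = cscale (cnj x) (root_vec Q k j)"
proof -
  have "cscale x (root_vec Q j k) \<in> su3C"
    using root_vec_in_su3C[OF assms] by (simp add: su3C_eq trace_simps)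
  moreover have "conj_transpose (cscale x (mat_unit j k)) = cscale (cnj x) (mat_unit k j)"
    by (auto simp: vec_eq_iff conj_transpose_def map_matrix_def transpose_def cscale_nth)
  ultimately show ?thesis
    unfolding root_vec_def conj_by_cscale[symmetric] by (simp add: conj_su3_eq conj_transpose_conj_by)
qed

lemma sigmaC_root_vec:
  assumes "orthogonal_matrix Q" "j \<noteq> k"
  shows "sigmaC (cscale x (root_vec Q j k)) = cscale (- x) (root_vec Q k j)"
proof -
  have "cscale x (root_vec Q j k) \<in> su3C"
    using root_vec_in_su3C[OF assms] by (simp add: su3C_eq trace_simps)
  moreover have "- transpose (cscale x (mat_unit j k)) = cscale (- x) (mat_unit k j)"
    by (auto simp: vec_eq_iff transpose_def cscale_nth)
  ultimately show ?thesis
    unfolding root_vec_def conj_by_cscale[symmetric] by (simp add: sigmaC_eq transpose_conj_by flip: conj_by_uminus)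
qed

lemma diag_root_in_roots: "orthogonal_matrix Q \<Longrightarrow> j \<noteq> k \<Longrightarrow> diag_root Q j k \<in> roots (diag_flat Q)"
  by (auto simp: roots_diag_flat)

lemma zero_notin_roots: "0 \<notin> roots a"
  by (simp add: roots_def)

text \<open>Comparing the bracket of opposite root vectors with \<open>sharp\<close> fixes the
  modulus of the coefficient and leaves its phase free.\<close>

lemma chevalley_basis_diag_root:
  assumes Q: "orthogonal_matrix Q" and chev: "chevalley_basis (diag_flat Q) X c"
    and conj: "\<forall>\<alpha>\<in>roots (diag_flat Q). X (- \<alpha>) = - conj_su3 (X \<alpha>)" and jk: "j \<noteq> k"
  obtains x where "X (diag_root Q j k) = cscale x (root_vec Q j k)"
    "X (diag_root Q k j) = cscale (cnj x) (root_vec Q k j)" "x * cnj x = 1 / 6"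
proof -
  let ?\<alpha> = "diag_root Q j k"
  have \<alpha>: "?\<alpha> \<in> roots (diag_flat Q)" "- ?\<alpha> \<in> roots (diag_flat Q)"
    using jk by (auto simp: diag_root_uminus diag_root_in_roots Q)
  have "X ?\<alpha> \<in> root_space (diag_flat Q) ?\<alpha>"
    using chev \<alpha>(1) unfolding chevalley_basis_def by blast
  then obtain x where x: "X ?\<alpha> = cscale x (root_vec Q j k)"
    unfolding root_space_diag_root[OF Q jk] by blast
  have x': "X (diag_root Q k j) = cscale (cnj x) (root_vec Q k j)"
  proof -
    have "X (- ?\<alpha>) = - conj_su3 (X ?\<alpha>)"
      using conj \<alpha>(1) by blast
    then show ?thesis
      unfolding diag_root_uminus x conj_su3_root_vec[OF Q jk] .
  qed
  have "lie_bracket (X ?\<alpha>) (X (- ?\<alpha>)) = (if ?\<alpha> + - ?\<alpha> \<in> roots (diag_flat Q) then c ?\<alpha> (- ?\<alpha>) *\<^sub>R X (?\<alpha> + - ?\<alpha>)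
      else if - ?\<alpha> = - ?\<alpha> then sharp (diag_flat Q) ?\<alpha> else 0)"
    using chev \<alpha> unfolding chevalley_basis_def by blast
  moreover have "?\<alpha> + - ?\<alpha> = 0"
    by simp
  ultimately have "lie_bracket (X ?\<alpha>) (X (- ?\<alpha>)) = sharp (diag_flat Q) ?\<alpha>"
    by (simp only: zero_notin_roots if_False refl if_True)
  then have "cscale (x * cnj x) (root_vec Q j j - root_vec Q k k) = cscale (1 / 6) (root_vec Q j j - root_vec Q k k)"
    unfolding sharp_diag_root[OF Q jk] diag_root_uminus x x' lie_bracket_cscale lie_bracket_root_vec[OF Q] by simp
  then have "cscale (x * cnj x) (mat_unit j j - mat_unit k k) = cscale (1 / 6) (mat_unit j j - mat_unit k k)"
    unfolding root_vec_def conj_by_diff[symmetric] conj_by_cscale[symmetric] conj_by_eq_iff[OF Q] .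
  then have "cscale (x * cnj x) (mat_unit j j - mat_unit k k) $ j $ j = cscale (1 / 6) (mat_unit j j - mat_unit k k) $ j $ j"
    by (rule arg_cong)
  then have "x * cnj x = 1 / 6"
    using jk unfolding cscale_nth by simp
  then show ?thesis
    using that x x' by blast
qed

text \<open>\<open>sigmaC\<close> is minus the transpose on \<open>su3C\<close>. Thus an imaginary
  coefficient has sign 1 and a real one sign -1.\<close>

lemma root_sign_diag_root:
  assumes Q: "orthogonal_matrix Q" and jk: "j \<noteq> k" and x: "X (diag_root Q j k) = cscale x (root_vec Q j k)"
    "X (diag_root Q k j) = cscale (cnj x) (root_vec Q k j)" "x \<noteq> 0" and s: "s = 1 \<or> s = - 1" "- x = of_real s * cnj x"
  shows "root_sign X (diag_root Q j k) = s"
proof -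
  have "sigmaC (X (diag_root Q j k)) = r *\<^sub>R X (- diag_root Q j k) \<longleftrightarrow> r = s" for r
  proof -
    have "sigmaC (X (diag_root Q j k)) = cscale (of_real s * cnj x) (root_vec Q k j)"
      unfolding x(1) sigmaC_root_vec[OF Q jk] s(2) ..
    moreover have "r *\<^sub>R X (- diag_root Q j k) = cscale (of_real r * cnj x) (root_vec Q k j)"
      by (simp add: diag_root_uminus x(2) scaleR_eq_cscale)
    ultimately have "sigmaC (X (diag_root Q j k)) = r *\<^sub>R X (- diag_root Q j k) \<longleftrightarrow>
        of_real s * cnj x = of_real r * cnj x"
      by (simp only: cscale_root_vec_eq_iff[OF Q])
    then show ?thesis
      using x(3) by auto
  qed
  then show ?thesis
    unfolding root_sign_def using s(1) by auto
qed

text \<open>The last assumption covers both branches of \<open>Mvec\<close>: \<open>z = 1\<close>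
  with \<open>x\<close> imaginary and \<open>z = \<i>\<close> with \<open>x\<close> real.\<close>

lemma Vvec_diag_root:
  assumes "X (diag_root Q j k) = cscale x (root_vec Q j k)"
    "X (diag_root Q k j) = cscale (cnj x) (root_vec Q k j)" "z * x = \<i> * complex_of_real w"
  shows "Vvec X (diag_root Q j k) z = conj_by Q (cscale (\<i> * of_real (w / sqrt 2)) (mat_unit j k + mat_unit k j))"
proof -
  have *: "cnj (\<i> * complex_of_real w) = - \<i> * complex_of_real w"
    by simp
  have "cscale z (X (diag_root Q j k)) - cscale (cnj z) (X (- diag_root Q j k)) =
      cscale (z * x) (root_vec Q j k) - cscale (cnj (z * x)) (root_vec Q k j)"
    by (simp add: diag_root_uminus assms(1,2))
  then have "cscale z (X (diag_root Q j k)) - cscale (cnj z) (X (- diag_root Q j k)) =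
      cscale (\<i> * complex_of_real w) (root_vec Q j k) - cscale (- \<i> * complex_of_real w) (root_vec Q k j)"
    by (simp only: * assms(3))
  also have "\<dots> = conj_by Q (cscale (\<i> * of_real w) (mat_unit j k + mat_unit k j))"
    unfolding root_vec_def conj_by_cscale conj_by_add cmat.scale_right_distrib by simp
  finally show ?thesis
    unfolding Vvec_def by (simp add: scaleR_eq_cscale mult.commute mult.left_commute flip: conj_by_cscale)
qed

lemma isym_off_diag_eq:
  "cscale (\<i> * complex_of_real t) (mat_unit 1 2 + mat_unit 2 1) = isym 0 0 t 0 0"
  "cscale (\<i> * complex_of_real t) (mat_unit 2 3 + mat_unit 3 2) = isym 0 0 0 0 t"
  "cscale (\<i> * complex_of_real t) (mat_unit 1 3 + mat_unit 3 1) = isym 0 0 0 t 0"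
  unfolding vec_eq_iff forall_3 cscale_nth vector_add_component mat_unit_nth isym_nth by simp_all

text \<open>The moduli of the simple coefficients agree, so \<open>t1\<close> and \<open>t2\<close>
  differ at most in sign. The formulas for \<open>X\<close> are exported so that this sign can be
  read off from a given basis.\<close>

lemma adapted_chevalley_basis_diag_flat:
  assumes Q: "orthogonal_matrix Q"
    and simple: "(\<alpha>1, \<alpha>2) = (diag_root Q 1 2, diag_root Q 2 3) \<or> (\<alpha>1, \<alpha>2) = (diag_root Q 2 3, diag_root Q 1 2)"
    and adapted: "adapted_chevalley_basis (diag_flat Q) \<alpha>1 \<alpha>2 X c"
  obtains t1 t2 t3 where "t1\<^sup>2 = t2\<^sup>2" "t1 \<noteq> 0" "t3 \<noteq> 0"
    "X (diag_root Q 1 2) = cscale (\<i> * of_real (sqrt 2 * t1)) (root_vec Q 1 2)"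
    "X (diag_root Q 2 3) = cscale (\<i> * of_real (sqrt 2 * t2)) (root_vec Q 2 3)"
    "Mvec X \<alpha>1 + Mvec X \<alpha>2 = conj_by Q (isym 0 0 t1 0 t2)"
    "Mvec X (\<alpha>1 + \<alpha>2) = conj_by Q (isym 0 0 0 t3 0)"
proof -
  let ?r = "diag_root Q"
  have chev: "chevalley_basis (diag_flat Q) X c"
    and conj: "\<forall>\<alpha>\<in>roots (diag_flat Q). X (- \<alpha>) = - conj_su3 (X \<alpha>)"
    and c_pos: "c \<alpha>1 \<alpha>2 > 0" and sig: "sigmaC (X \<alpha>1) = X (- \<alpha>1)" "sigmaC (X \<alpha>2) = X (- \<alpha>2)"
    using adapted by (auto simp: adapted_chevalley_basis_def)
  have sum: "\<alpha>1 + \<alpha>2 = ?r 1 3"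
    using simple diag_root_add[of Q 1 2 3] by (auto simp: add.commute)
  have real: "\<exists>w. w\<^sup>2 = 1 / 6 \<and> X (?r j k) = cscale (\<i> * of_real w) (root_vec Q j k) \<and>
      Mvec X (?r j k) = conj_by Q (cscale (\<i> * of_real (w / sqrt 2)) (mat_unit j k + mat_unit k j))"
    if jk: "j \<noteq> k" and fixed: "sigmaC (X (?r j k)) = X (- ?r j k)" for j k
  proof -
    obtain x where x: "X (?r j k) = cscale x (root_vec Q j k)" "X (?r k j) = cscale (cnj x) (root_vec Q k j)"
      "x * cnj x = 1 / 6"
      using chevalley_basis_diag_root[OF Q chev conj jk] .
    have "- x = cnj x"
      using fixed unfolding diag_root_uminus x(1,2) sigmaC_root_vec[OF Q jk] cscale_root_vec_eq_iff[OF Q] .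
    then have xi: "x = \<i> * of_real (Im x)"
      by (auto simp: complex_eq_iff)
    have "Re x = 0"
      using \<open>- x = cnj x\<close> by (simp add: complex_eq_iff)
    then have "complex_of_real ((Im x)\<^sup>2) = of_real (1 / 6)"
      using x(3) by (simp add: complex_mult_cnj)
    then have "(Im x)\<^sup>2 = 1 / 6"
      by (simp only: of_real_eq_iff)
    moreover have "root_sign X (?r j k) = 1"
      by (rule root_sign_diag_root[OF Q jk x(1,2)]) (use x(3) \<open>- x = cnj x\<close> in auto)
    then have "Mvec X (?r j k) = conj_by Q (cscale (\<i> * of_real (Im x / sqrt 2)) (mat_unit j k + mat_unit k j))"
      unfolding Mvec_def using Vvec_diag_root[of X Q j k x 1, OF x(1,2)] xi by simp
    ultimately show ?thesis
      using x(1) xi by metis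
  qed
  have "sigmaC (X (?r 1 2)) = X (- ?r 1 2)" "sigmaC (X (?r 2 3)) = X (- ?r 2 3)"
    using sig simple by auto
  then obtain w1 w2 where w1: "w1\<^sup>2 = 1 / 6" "X (?r 1 2) = cscale (\<i> * of_real w1) (root_vec Q 1 2)"
      "Mvec X (?r 1 2) = conj_by Q (isym 0 0 (w1 / sqrt 2) 0 0)"
    and w2: "w2\<^sup>2 = 1 / 6" "X (?r 2 3) = cscale (\<i> * of_real w2) (root_vec Q 2 3)"
      "Mvec X (?r 2 3) = conj_by Q (isym 0 0 0 0 (w2 / sqrt 2))"
    using real[of 1 2] real[of 2 3] unfolding isym_off_diag_eq by auto
  obtain x where x: "X (?r 1 3) = cscale x (root_vec Q 1 3)" "X (?r 3 1) = cscale (cnj x) (root_vec Q 3 1)"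
      "x * cnj x = 1 / 6"
    using chevalley_basis_diag_root[OF Q chev conj, of 1 3] by auto
  have roots: "\<alpha>1 \<in> roots (diag_flat Q)" "\<alpha>2 \<in> roots (diag_flat Q)" "\<alpha>1 + \<alpha>2 \<in> roots (diag_flat Q)"
    using simple by (auto simp: sum diag_root_in_roots Q)
  have "lie_bracket (X \<alpha>1) (X \<alpha>2) = (if \<alpha>1 + \<alpha>2 \<in> roots (diag_flat Q) then c \<alpha>1 \<alpha>2 *\<^sub>R X (\<alpha>1 + \<alpha>2)
      else if \<alpha>2 = - \<alpha>1 then sharp (diag_flat Q) \<alpha>1 else 0)"
    using chev roots unfolding chevalley_basis_def by blast
  then have br: "lie_bracket (X \<alpha>1) (X \<alpha>2) = cscale (of_real (c \<alpha>1 \<alpha>2) * x) (root_vec Q 1 3)"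
    using roots(3) by (simp add: sum x scaleR_eq_cscale)
  have mul: "\<i> * complex_of_real p * (\<i> * complex_of_real q) = of_real (- (p * q))" for p q
    by (simp add: complex_eq_iff)
  \<comment> \<open>The product of two imaginary coefficients is real; the order of the simple roots
    changes only its sign.\<close>
  have "\<exists>s. lie_bracket (X \<alpha>1) (X \<alpha>2) = cscale (of_real s) (root_vec Q 1 3)"
    using simple
  proof
    assume "(\<alpha>1, \<alpha>2) = (?r 1 2, ?r 2 3)"
    then have "lie_bracket (X \<alpha>1) (X \<alpha>2) = cscale (of_real (- (w1 * w2))) (root_vec Q 1 3)"
      by (simp only: prod.inject w1 w2 lie_bracket_cscale lie_bracket_root_vec[OF Q] mul) simp
    then show ?thesis ..
  next
    assume "(\<alpha>1, \<alpha>2) = (?r 2 3, ?r 1 2)"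
    then have "lie_bracket (X \<alpha>1) (X \<alpha>2) = cscale (of_real (w2 * w1)) (root_vec Q 1 3)"
      by (simp only: prod.inject w1 w2 lie_bracket_cscale lie_bracket_root_vec[OF Q] mul) simp
    then show ?thesis ..
  qed
  then obtain s where "of_real (c \<alpha>1 \<alpha>2) * x = of_real s"
    unfolding br cscale_root_vec_eq_iff[OF Q] by blast
  then have "x = of_real (s / c \<alpha>1 \<alpha>2)"
    using c_pos by (simp add: field_simps)
  then have cx: "cnj x = x" and xr: "x = of_real (Re x)"
    by simp_all
  have "x \<noteq> 0"
    using x(3) by auto
  then have "root_sign X (?r 1 3) = - 1"
    by (intro root_sign_diag_root[OF Q _ x(1,2)]) (simp_all add: cx)
  then have M3: "Mvec X (\<alpha>1 + \<alpha>2) = conj_by Q (isym 0 0 0 (Re x / sqrt 2) 0)"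
    unfolding Mvec_def sum isym_off_diag_eq(3)[symmetric]
    using Vvec_diag_root[of X Q 1 3 x \<i> "Re x", OF x(1,2)] xr by simp
  have "Mvec X (?r 1 2) + Mvec X (?r 2 3) = conj_by Q (isym 0 0 (w1 / sqrt 2) 0 (w2 / sqrt 2))"
    unfolding w1 w2 conj_by_add[symmetric] isym_add by simp
  then have M12: "Mvec X \<alpha>1 + Mvec X \<alpha>2 = conj_by Q (isym 0 0 (w1 / sqrt 2) 0 (w2 / sqrt 2))"
    using simple by (auto simp: add.commute)
  show ?thesis
  proof (rule that[OF _ _ _ _ _ M12 M3])
    show "(w1 / sqrt 2)\<^sup>2 = (w2 / sqrt 2)\<^sup>2" "w1 / sqrt 2 \<noteq> 0"
      using w1(1) w2(1) by (auto simp: power_divide)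
    show "Re x / sqrt 2 \<noteq> 0"
      using \<open>x \<noteq> 0\<close> xr by (auto simp: complex_eq_iff)
  qed (use w1 w2 in simp_all)
qed

section \<open>Types and models\<close>

lemma span_conj_by_singleton: "span {conj_by Q A} = conj_by Q ` {r *\<^sub>R A | r. True}"
proof -
  have "{r *\<^sub>R A | r. True} = range (\<lambda>r. r *\<^sub>R A)"
    by auto
  then show ?thesis
    by (simp add: span_singleton image_image conj_by_scaleR)
qed

lemma is_direct_sum_conj_by_iff:
  assumes "orthogonal_matrix Q" "U \<inter> V = {0}"
  shows "is_direct_sum n (conj_by Q ` U) (conj_by Q ` V) \<longleftrightarrow> n = conj_by Q ` {u + v | u v. u \<in> U \<and> v \<in> V}"
proof -
  have "conj_by Q ` U \<inter> conj_by Q ` V = {0}"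
    using assms(2) image_Int[OF inj_conj_by[OF assms(1)], of U V] by simp
  moreover have "{u + v | u v. u \<in> conj_by Q ` U \<and> v \<in> conj_by Q ` V} = conj_by Q ` {u + v | u v. u \<in> U \<and> v \<in> V}"
  proof (intro set_eqI iffI)
    fix A assume "A \<in> {u + v | u v. u \<in> conj_by Q ` U \<and> v \<in> conj_by Q ` V}"
    then obtain u v where "u \<in> U" "v \<in> V" "A = conj_by Q (u + v)"
      by (auto simp: conj_by_add)
    then show "A \<in> conj_by Q ` {u + v | u v. u \<in> U \<and> v \<in> V}"
      by blast
  next
    fix A assume "A \<in> conj_by Q ` {u + v | u v. u \<in> U \<and> v \<in> V}"
    then obtain u v where "u \<in> U" "v \<in> V" "A = conj_by Q u + conj_by Q v"
      by (auto simp: conj_by_add)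
    then show "A \<in> {u + v | u v. u \<in> conj_by Q ` U \<and> v \<in> conj_by Q ` V}"
      by blast
  qed
  ultimately show ?thesis
    by (simp add: is_direct_sum_def)
qed

text \<open>Type M stands apart because it alone sees the relative sign \<open>s\<close>; the other
  types depend on the flat and on the lines of H and of the third vector M.\<close>

lemma has_type_wrt_diag_flat:
  assumes Q: "orthogonal_matrix Q"
    and H: "Hvec (diag_flat Q) (\<alpha>1 + \<alpha>2) = conj_by Q (isym (1 / 6) 0 0 0 0)"
    and M: "Mvec X \<alpha>1 + Mvec X \<alpha>2 = conj_by Q (isym 0 0 t1 0 t2)" "t1 \<noteq> 0" "t2 = s * t1"
    and M3: "Mvec X (\<alpha>1 + \<alpha>2) = conj_by Q (isym 0 0 0 t3 0)" "t3 \<noteq> 0"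
  shows "t \<noteq> TypeM \<Longrightarrow> has_type_wrt (diag_flat Q) \<alpha>1 \<alpha>2 X t n \<longleftrightarrow> (\<exists>n0. model t n0 \<and> n = conj_by Q ` n0)"
    and "has_type_wrt (diag_flat Q) \<alpha>1 \<alpha>2 X TypeM n \<longleftrightarrow> n = conj_by Q ` {isym x 0 a 0 (s * a) | x a. True}"
proof -
  have line: "{r *\<^sub>R isym (1 / 6) 0 0 0 0 | r. True} = {isym x 0 0 0 0 | x. True}"
    "{r *\<^sub>R isym 0 0 0 t3 0 | r. True} = {isym 0 0 0 b 0 | b. True}"
    "{r *\<^sub>R isym 0 0 t1 0 t2 | r. True} = {isym 0 0 a 0 (s * a) | a. True}"
  proof -
    have "isym x 0 0 0 0 = (x * 6) *\<^sub>R isym (1 / 6) 0 0 0 0" for x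
      by (simp add: isym_scaleR)
    moreover have "isym 0 0 0 b 0 = (b / t3) *\<^sub>R isym 0 0 0 t3 0" for b
      using M3(2) by (simp add: isym_scaleR)
    moreover have "isym 0 0 a 0 (s * a) = (a / t1) *\<^sub>R isym 0 0 t1 0 t2" for a
      using M(2) by (simp add: isym_scaleR M(3))
    ultimately have "{isym x 0 0 0 0 | x. True} \<subseteq> {r *\<^sub>R isym (1 / 6) 0 0 0 0 | r. True}"
      "{isym 0 0 0 b 0 | b. True} \<subseteq> {r *\<^sub>R isym 0 0 0 t3 0 | r. True}"
      "{isym 0 0 a 0 (s * a) | a. True} \<subseteq> {r *\<^sub>R isym 0 0 t1 0 t2 | r. True}"
      by blast+
    then show "{r *\<^sub>R isym (1 / 6) 0 0 0 0 | r. True} = {isym x 0 0 0 0 | x. True}"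
      "{r *\<^sub>R isym 0 0 0 t3 0 | r. True} = {isym 0 0 0 b 0 | b. True}"
      "{r *\<^sub>R isym 0 0 t1 0 t2 | r. True} = {isym 0 0 a 0 (s * a) | a. True}"
      by (intro equalityI; auto simp: isym_scaleR M(3) mult.left_commute)+
  qed
  have typeG: "has_type_wrt (diag_flat Q) \<alpha>1 \<alpha>2 X TypeG n \<longleftrightarrow> (\<exists>n0. model TypeG n0 \<and> n = conj_by Q ` n0)"
  proof -
    have "span {conj_by Q (isym x y 0 0 0)} = conj_by Q ` {isym (r * x) (r * y) 0 0 0 | r. True}" for x y
      by (simp add: span_conj_by_singleton isym_scaleR)
    then have "has_type_wrt (diag_flat Q) \<alpha>1 \<alpha>2 X TypeG n \<longleftrightarrow>
        (\<exists>x y. n = conj_by Q ` {isym (r * x) (r * y) 0 0 0 | r. True})"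
      unfolding has_type_wrt.simps Bex_def diag_flat_iff by metis
    then show ?thesis
      unfolding model.simps by blast
  qed
  have typeT: "has_type_wrt (diag_flat Q) \<alpha>1 \<alpha>2 X TypeT n \<longleftrightarrow> (\<exists>n0. model TypeT n0 \<and> n = conj_by Q ` n0)"
    by (simp add: diag_flat_def)
  have "{isym x 0 0 0 0 | x. True} \<inter> {isym 0 0 0 b 0 | b. True} = {0}"
    by (auto simp: isym_0)
  moreover have "{u + v | u v. u \<in> {isym x 0 0 0 0 | x. True} \<and> v \<in> {isym 0 0 0 b 0 | b. True}}
      = {isym x 0 0 b 0 | x b. True}" (is "?S = ?T")
  proof
    show "?S \<subseteq> ?T"
      by (auto simp: isym_add)
    have "isym x 0 0 b 0 = isym x 0 0 0 0 + isym 0 0 0 b 0" for x b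
      by (simp add: isym_add)
    then show "?T \<subseteq> ?S"
      by blast
  qed
  ultimately have typeS: "has_type_wrt (diag_flat Q) \<alpha>1 \<alpha>2 X TypeS n \<longleftrightarrow> (\<exists>n0. model TypeS n0 \<and> n = conj_by Q ` n0)"
    unfolding has_type_wrt.simps H M3(1) span_conj_by_singleton line by (simp add: is_direct_sum_conj_by_iff[OF Q])
  have "{isym x y 0 0 0 | x y. True} \<inter> {isym 0 0 0 b 0 | b. True} = {0}"
    by (auto simp: isym_0)
  moreover have "{u + v | u v. u \<in> {isym x y 0 0 0 | x y. True} \<and> v \<in> {isym 0 0 0 b 0 | b. True}}
      = {isym x y 0 b 0 | x y b. True}" (is "?S = ?T")
  proof
    show "?S \<subseteq> ?T"
      by (auto simp: isym_add)
    have "isym x y 0 b 0 = isym x y 0 0 0 + isym 0 0 0 b 0" for x y b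
      by (simp add: isym_add)
    then show "?T \<subseteq> ?S"
      by blast
  qed
  ultimately have typeP: "has_type_wrt (diag_flat Q) \<alpha>1 \<alpha>2 X TypeP n \<longleftrightarrow> (\<exists>n0. model TypeP n0 \<and> n = conj_by Q ` n0)"
    unfolding has_type_wrt.simps M3(1) span_conj_by_singleton line diag_flat_def by (simp add: is_direct_sum_conj_by_iff[OF Q])
  show "t \<noteq> TypeM \<Longrightarrow> has_type_wrt (diag_flat Q) \<alpha>1 \<alpha>2 X t n \<longleftrightarrow> (\<exists>n0. model t n0 \<and> n = conj_by Q ` n0)"
    by (cases t) (simp_all only: typeG typeT typeS typeP not_True_eq_False simp_thms)
  have "{isym x 0 0 0 0 | x. True} \<inter> {isym 0 0 a 0 (s * a) | a. True} = {0}"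
    by (auto simp: isym_0)
  moreover have "{u + v | u v. u \<in> {isym x 0 0 0 0 | x. True} \<and> v \<in> {isym 0 0 a 0 (s * a) | a. True}}
      = {isym x 0 a 0 (s * a) | x a. True}" (is "?S = ?T")
  proof
    show "?S \<subseteq> ?T"
      by (auto simp: isym_add)
    have "isym x 0 a 0 (s * a) = isym x 0 0 0 0 + isym 0 0 a 0 (s * a)" for x a
      by (simp add: isym_add)
    then show "?T \<subseteq> ?S"
      by blast
  qed
  ultimately show "has_type_wrt (diag_flat Q) \<alpha>1 \<alpha>2 X TypeM n \<longleftrightarrow> n = conj_by Q ` {isym x 0 a 0 (s * a) | x a. True}"
    unfolding has_type_wrt.simps H M(1) span_conj_by_singleton line by (simp add: is_direct_sum_conj_by_iff[OF Q])
qed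

text \<open>Renumbering the basis turns the simple roots into the standard chain; the remaining sign
  in type M is absorbed by \<open>flip1\<close>.\<close>

lemma congruent_to_model_if_has_type:
  assumes "has_type t n"
  shows "congruent_to_model t n"
proof -
  obtain a \<alpha>1 \<alpha>2 X c where "maximal_flat a" and ne: "\<alpha>1 \<noteq> \<alpha>2" and simple: "simple_system a {\<alpha>1, \<alpha>2}"
    and adapted: "adapted_chevalley_basis a \<alpha>1 \<alpha>2 X c" and type: "has_type_wrt a \<alpha>1 \<alpha>2 X t n"
    using assms unfolding has_type_def by blast
  then obtain Q0 where Q0: "orthogonal_matrix Q0" and a: "a = diag_flat Q0"
    unfolding maximal_flat_iff by blast
  obtain j k l where jkl: "j \<noteq> k" "k \<noteq> l" "j \<noteq> l"
    "(\<alpha>1, \<alpha>2) = (diag_root Q0 j k, diag_root Q0 k l) \<or> (\<alpha>1, \<alpha>2) = (diag_root Q0 k l, diag_root Q0 j k)"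
    using simple_system_diag_flat[OF Q0 simple[unfolded a] ne] .
  define p where "p i = (if i = 1 then j else if i = 2 then k else l)" for i :: 3
  have p: "p 1 = j" "p 2 = k" "p 3 = l"
    by (simp_all add: p_def)
  have inj: "inj p"
    using jkl(1-3) by (auto simp: inj_def forall_3 p)
  define Q where "Q = Q0 ** perm_matrix p"
  have Q: "orthogonal_matrix Q"
    unfolding Q_def by (rule orthogonal_matrix_mul[OF Q0 orthogonal_perm_matrix[OF inj]])
  have a: "a = diag_flat Q"
    unfolding Q_def diag_flat_perm[OF Q0 inj] a ..
  have roots: "(\<alpha>1, \<alpha>2) = (diag_root Q 1 2, diag_root Q 2 3) \<or> (\<alpha>1, \<alpha>2) = (diag_root Q 2 3, diag_root Q 1 2)"
    unfolding Q_def diag_root_perm[OF Q0 inj] p by (rule jkl(4))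
  then have sum: "\<alpha>1 + \<alpha>2 = diag_root Q 1 3"
    using diag_root_add[of Q 1 2 3] by (auto simp: add.commute)
  obtain t1 t2 t3 where t: "t1\<^sup>2 = t2\<^sup>2" "t1 \<noteq> 0" "t3 \<noteq> 0"
    and M: "Mvec X \<alpha>1 + Mvec X \<alpha>2 = conj_by Q (isym 0 0 t1 0 t2)" "Mvec X (\<alpha>1 + \<alpha>2) = conj_by Q (isym 0 0 0 t3 0)"
    using adapted_chevalley_basis_diag_flat[OF Q roots adapted[unfolded a]] .
  obtain s where s: "t2 = s * t1" "s = 1 \<or> s = - 1"
  proof -
    have "t2 = 1 * t1 \<or> t2 = - 1 * t1"
      using t(1) by (auto simp: power2_eq_iff)
    then show ?thesis
      using that by blast
  qed
  note types = has_type_wrt_diag_flat[OF Q Hvec_diag_root[OF Q, folded sum] M(1) t(2) s(1) M(2) t(3)]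
  show ?thesis
  proof (cases "t = TypeM")
    case False
    then show ?thesis
      using types(1) type Q unfolding a congruent_to_model_def by blast
  next
    case True
    then have n: "n = conj_by Q ` {isym x 0 a 0 (s * a) | x a. True}"
      using types(2) type unfolding a by simp
    from s(2) show ?thesis
    proof
      assume "s = 1"
      then have "n = conj_by Q ` {isym x 0 a 0 a | x a. True}"
        using n by simp
      then show ?thesis
        using Q unfolding congruent_to_model_def True model.simps by blast
    next
      assume "s = - 1"
      moreover have "{isym x 0 a 0 (- 1 * a) | x a. True} = conj_by flip1 ` {isym x 0 a 0 a | x a. True}"
        by (intro involution_image_eq) (auto simp: conj_by_swap_flip_isym)
      ultimately have "n = conj_by (Q ** flip1) ` {isym x 0 a 0 a | x a. True}"
        using n by (simp only: conj_by_image_mult)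
      then show ?thesis
        using orthogonal_matrix_mul[OF Q orthogonal_swap_flip(3)]
        unfolding congruent_to_model_def True model.simps by blast
    qed
  qed
qed

section \<open>Existence of simple systems and adapted Chevalley bases\<close>

lemma simple_system_diag_roots:
  assumes Q: "orthogonal_matrix Q"
  shows "simple_system (diag_flat Q) {diag_root Q 1 2, diag_root Q 2 3}" (is "simple_system ?a {?\<alpha>, ?\<beta>}")
proof -
  have ne: "?\<alpha> \<noteq> ?\<beta>"
    using diag_root_eq_iff[OF Q, of 2 3 1 2] by simp
  have sum: "(\<Sum>\<gamma>\<in>{?\<alpha>, ?\<beta>}. f \<gamma> * \<gamma> H) = f ?\<alpha> * ?\<alpha> H + f ?\<beta> * ?\<beta> H" for f :: "cfunctional \<Rightarrow> complex" and H
    using ne by simp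
  show ?thesis
    unfolding simple_system_def
  proof (intro conjI allI impI ballI)
    show "{?\<alpha>, ?\<beta>} \<subseteq> roots ?a"
      by (auto simp: diag_root_in_roots Q)
    fix u \<gamma> assume u: "\<forall>H. (\<Sum>\<alpha>\<in>{?\<alpha>, ?\<beta>}. u \<alpha> * \<alpha> H) = 0" and \<gamma>: "\<gamma> \<in> {?\<alpha>, ?\<beta>}"
    have "u ?\<alpha> * ?\<alpha> (conj_by Q (cdiag v w)) + u ?\<beta> * ?\<beta> (conj_by Q (cdiag v w)) = 0" for v w
      using u unfolding sum by blast
    \<comment> \<open>The simple roots take the values 1, 1 on \<open>cdiag 1 0\<close> and -1, 2 on
      \<open>cdiag 0 1\<close>.\<close>
    from this[of 1 0] this[of 0 1] have "u ?\<alpha> + u ?\<beta> = 0" "- u ?\<alpha> + 2 * u ?\<beta> = 0"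
      by (simp_all add: diag_root_conj_by_cdiag[OF Q] mult.commute)
    moreover have "3 * u ?\<beta> = (u ?\<alpha> + u ?\<beta>) + (- u ?\<alpha> + 2 * u ?\<beta>)"
      by (simp add: algebra_simps)
    ultimately have "u ?\<beta> = 0" "u ?\<alpha> = 0"
      by simp_all
    then show "u \<gamma> = 0"
      using \<gamma> by auto
  next
    fix \<gamma> assume "\<gamma> \<in> roots ?a"
    then obtain j k where jk: "j \<noteq> k" "\<gamma> = diag_root Q j k"
      unfolding roots_diag_flat[OF Q] by blast
    have pos: "\<exists>n. (\<forall>H. \<gamma> H = (\<Sum>\<alpha>\<in>{?\<alpha>, ?\<beta>}. of_nat (n \<alpha>) * \<alpha> H)) \<or> (\<forall>H. \<gamma> H = - (\<Sum>\<alpha>\<in>{?\<alpha>, ?\<beta>}. of_nat (n \<alpha>) * \<alpha> H))"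
      if "(\<forall>H. \<gamma> H = of_nat p * ?\<alpha> H + of_nat q * ?\<beta> H) \<or> (\<forall>H. \<gamma> H = - (of_nat p * ?\<alpha> H + of_nat q * ?\<beta> H))" for p q
      using that ne unfolding sum by (intro exI[of _ "\<lambda>\<delta>. if \<delta> = ?\<alpha> then p else q"]) simp
    have neg: "diag_root Q i l H = - diag_root Q l i H" for i l H
      by (simp flip: diag_root_uminus[of Q l i])
    have add: "diag_root Q 1 3 H = ?\<alpha> H + ?\<beta> H" for H
      by (simp flip: diag_root_add[of Q 1 2 3])
    consider "(j, k) = (1, 2)" | "(j, k) = (2, 3)" | "(j, k) = (1, 3)" | "(j, k) = (2, 1)" | "(j, k) = (3, 2)" | "(j, k) = (3, 1)"
      using jk(1) exhaust_3[of j] exhaust_3[of k] by auto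
    then show "\<exists>n. (\<forall>H. \<gamma> H = (\<Sum>\<alpha>\<in>{?\<alpha>, ?\<beta>}. of_nat (n \<alpha>) * \<alpha> H)) \<or> (\<forall>H. \<gamma> H = - (\<Sum>\<alpha>\<in>{?\<alpha>, ?\<beta>}. of_nat (n \<alpha>) * \<alpha> H))"
    proof cases
      case 1 then show ?thesis by (intro pos[of 1 0]) (simp add: jk(2))
    next
      case 2 then show ?thesis by (intro pos[of 0 1]) (simp add: jk(2))
    next
      case 3 then show ?thesis by (intro pos[of 1 1]) (simp add: jk(2) add)
    next
      case 4 then show ?thesis by (intro pos[of 1 0]) (simp add: jk(2) neg[of 2 1])
    next
      case 5 then show ?thesis by (intro pos[of 0 1]) (simp add: jk(2) neg[of 3 2])
    next
      case 6 then show ?thesis by (intro pos[of 1 1]) (simp add: jk(2) neg[of 3 1] add)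
    qed
  qed simp
qed

text \<open>The root vectors are \<open>u\<^sub>j \<cdot> cnj u\<^sub>k / sqrt 6\<close> times matrix units, with phases \<open>u = (-1, \<i>, 1)\<close>
  chosen so that the simple root vectors get imaginary coefficients.\<close>
lemma adapted_chevalley_basis_exists:
  assumes Q: "orthogonal_matrix Q"
  obtains X c where "adapted_chevalley_basis (diag_flat Q) (diag_root Q 1 2) (diag_root Q 2 3) X c"
    "X (diag_root Q 1 2) = cscale (\<i> / of_real (sqrt 6)) (root_vec Q 1 2)"
    "X (diag_root Q 2 3) = cscale (\<i> / of_real (sqrt 6)) (root_vec Q 2 3)"
proof -
  let ?r = "diag_root Q" and ?a = "diag_flat Q"
  define u :: "3 \<Rightarrow> complex" where "u j = (if j = 1 then - 1 else if j = 2 then \<i> else 1)" for j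
  have u_unit: "cnj (u j) * u j = 1" for j
    by (simp add: u_def)
  \<comment> \<open>Phases of this product form cancel in the middle index (\<open>x_mult\<close>),
    which makes all structure constants real.\<close>
  define x where "x j k = u j * cnj (u k) / of_real (sqrt 6)" for j k
  have x_mult: "x j k * x k m = x j m / of_real (sqrt 6)" for j k m
  proof -
    have "x j k * x k m = u j * (cnj (u k) * u k) * cnj (u m) / (of_real (sqrt 6) * of_real (sqrt 6))"
      by (simp add: x_def)
    then show ?thesis
      unfolding u_unit by (simp add: x_def)
  qed
  have x_inv: "x j k * x k j = 1 / 6" for j k
  proof -
    have "x j j = 1 / of_real (sqrt 6)"
      using u_unit[of j] by (simp add: x_def mult.commute)
    then have "x j k * x k j = 1 / (of_real (sqrt 6) * of_real (sqrt 6))"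
      unfolding x_mult by simp
    also have "of_real (sqrt 6) * of_real (sqrt 6) = (6 :: complex)"
      by (simp flip: of_real_mult)
    finally show ?thesis .
  qed
  have x_cnj: "cnj (x j k) = x k j" for j k
    by (simp add: x_def mult.commute)
  \<comment> \<open>\<open>X\<close> and \<open>c\<close> take functionals as arguments, so the
    index pair must be recovered from the root.\<close>
  define idx where "idx = inv_into {(j, k). j \<noteq> k} (\<lambda>(j, k). ?r j k)"
  have "inj_on (\<lambda>(j, k). ?r j k) {(j, k). j \<noteq> k}"
    by (auto simp: inj_on_def diag_root_eq_iff[OF Q])
  then have idx: "idx (?r j k) = (j, k)" if "j \<noteq> k" for j k
    unfolding idx_def using that inv_into_f_f[of "\<lambda>(j, k). ?r j k" "{(j, k). j \<noteq> k}" "(j, k)"] by simp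
  define X where "X \<alpha> = (case idx \<alpha> of (j, k) \<Rightarrow> cscale (x j k) (root_vec Q j k))" for \<alpha>
  \<comment> \<open>The sign is that of the bracket of matrix units: plus when the first pair
    continues into the second, minus in the reverse order. Pairs whose sum is no root get a dummy
    value.\<close>
  define c where "c \<alpha> \<beta> = (if snd (idx \<alpha>) = fst (idx \<beta>) then 1 / sqrt 6 else - (1 / sqrt 6))" for \<alpha> \<beta>
  have X: "X (?r j k) = cscale (x j k) (root_vec Q j k)" if "j \<noteq> k" for j k
    by (simp add: X_def idx that)
  have c: "c (?r j k) (?r l m) = (if k = l then 1 / sqrt 6 else - (1 / sqrt 6))" if "j \<noteq> k" "l \<noteq> m" for j k l m
    by (simp add: c_def idx that)
  have bracket: "lie_bracket (X (?r j k)) (X (?r l m)) =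
      (if ?r j k + ?r l m \<in> roots ?a then c (?r j k) (?r l m) *\<^sub>R X (?r j k + ?r l m)
       else if ?r l m = - ?r j k then sharp ?a (?r j k) else 0)"
    if jk: "j \<noteq> k" and lm: "l \<noteq> m" for j k l m
  proof -
    have lhs: "lie_bracket (X (?r j k)) (X (?r l m)) =
        cscale (x j k * x l m) ((if k = l then root_vec Q j m else 0) - (if m = j then root_vec Q l k else 0))"
      by (simp only: X[OF jk] X[OF lm] lie_bracket_cscale lie_bracket_root_vec[OF Q])
    have neg: "?r l m = - ?r j k \<longleftrightarrow> l = k \<and> m = j"
      unfolding diag_root_uminus using diag_root_eq_iff[OF Q, of k j l m] jk by auto
    note mem = diag_root_sum_in_roots_iff[OF Q jk lm]
    consider "k = l" "m \<noteq> j" | "k \<noteq> l" "m = j" | "k = l" "m = j" | "k \<noteq> l" "m \<noteq> j"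
      by blast
    then show ?thesis
    proof cases
      case 1
      have "?r j k + ?r l m = ?r j m"
        using diag_root_add 1(1) by simp
      moreover have "x j k * x l m = complex_of_real (1 / sqrt 6) * x j m"
        using x_mult[of j k m] 1(1) by simp
      moreover have "c (?r j k) (?r l m) = 1 / sqrt 6"
        using c[OF jk lm] 1(1) by simp
      ultimately show ?thesis
        unfolding lhs using 1 mem X[of j m] by (simp add: scaleR_eq_cscale)
    next
      case 2
      have "?r j k + ?r l m = ?r l k"
        using diag_root_add[of Q l j k] 2(2) by (simp add: add.commute)
      moreover have "x j k * x l m = complex_of_real (1 / sqrt 6) * x l k"
        using x_mult[of l j k] 2(2) by (simp add: mult.commute)
      moreover have "c (?r j k) (?r l m) = - (1 / sqrt 6)"
        using c[OF jk lm] 2(1) by simp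
      ultimately show ?thesis
        unfolding lhs using 2 mem X[of l k] by (simp add: scaleR_eq_cscale)
    next
      case 3
      then show ?thesis
        unfolding lhs using mem neg sharp_diag_root[OF Q jk] by (simp add: x_inv)
    next
      case 4
      then show ?thesis
        unfolding lhs using mem neg by auto
    qed
  qed
  have "chevalley_basis ?a X c"
    unfolding chevalley_basis_def
  proof (intro conjI ballI impI)
    fix \<alpha> assume "\<alpha> \<in> roots ?a"
    then obtain j k where jk: "j \<noteq> k" "\<alpha> = ?r j k"
      unfolding roots_diag_flat[OF Q] by blast
    show "X \<alpha> \<in> root_space ?a \<alpha>"
      unfolding jk(2) X[OF jk(1)] root_space_diag_root[OF Q jk(1)] by blast
    have "x j k \<noteq> 0"
      using x_inv[of j k] by auto
    then show "X \<alpha> \<noteq> 0"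
      unfolding jk(2) X[OF jk(1)] using root_vec_nonzero[OF Q] by simp
    fix \<beta> assume "\<beta> \<in> roots ?a"
    then obtain l m where lm: "l \<noteq> m" "\<beta> = ?r l m"
      unfolding roots_diag_flat[OF Q] by blast
    show "lie_bracket (X \<alpha>) (X \<beta>) = (if \<alpha> + \<beta> \<in> roots ?a then c \<alpha> \<beta> *\<^sub>R X (\<alpha> + \<beta>)
        else if \<beta> = - \<alpha> then sharp ?a \<alpha> else 0)"
      unfolding jk(2) lm(2) by (rule bracket[OF jk(1) lm(1)])
    assume "\<alpha> + \<beta> \<in> roots ?a"
    then have "(k = l \<and> j \<noteq> m) \<or> (j = m \<and> k \<noteq> l)"
      unfolding jk(2) lm(2) diag_root_sum_in_roots_iff[OF Q jk(1) lm(1)] .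
    then show "c (- \<alpha>) (- \<beta>) = - c \<alpha> \<beta>"
      unfolding jk(2) lm(2) diag_root_uminus c[OF jk(1) lm(1)] c[OF jk(1)[symmetric] lm(1)[symmetric]] by auto
  qed
  moreover have "X (- \<alpha>) = - conj_su3 (X \<alpha>)" if mem: "\<alpha> \<in> roots ?a" for \<alpha>
  proof -
    obtain j k where jk: "j \<noteq> k" "\<alpha> = ?r j k"
      using mem unfolding roots_diag_flat[OF Q] by blast
    show ?thesis
      unfolding jk(2) diag_root_uminus X[OF jk(1)] X[OF jk(1)[symmetric]] conj_su3_root_vec[OF Q jk(1)] x_cnj ..
  qed
  moreover have x12: "x 1 2 = \<i> / of_real (sqrt 6)" and x23: "x 2 3 = \<i> / of_real (sqrt 6)"
    by (simp_all add: x_def u_def)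
  have "x 2 1 = - x 1 2" "x 3 2 = - x 2 3"
    by (simp_all add: x_def u_def)
  then have "sigmaC (X (?r 1 2)) = X (- ?r 1 2)" "sigmaC (X (?r 2 3)) = X (- ?r 2 3)"
    unfolding diag_root_uminus by (simp_all add: X sigmaC_root_vec[OF Q])
  moreover have "c (?r 1 2) (?r 2 3) > 0"
    by (simp add: c)
  ultimately have "adapted_chevalley_basis ?a (?r 1 2) (?r 2 3) X c"
    by (simp add: adapted_chevalley_basis_def)
  then show ?thesis
    using that X[of 1 2] X[of 2 3] unfolding x12 x23 by simp
qed

text \<open>For the converse, the explicit basis gives both simple root vectors the same
  coefficient, hence \<open>t1 = t2\<close> and exactly the model of type M.\<close>

lemma has_type_iff: "has_type t n \<longleftrightarrow> congruent_to_model t n"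
proof
  assume "congruent_to_model t n"
  then obtain Q n0 where Q: "orthogonal_matrix Q" and n0: "model t n0" "n = conj_by Q ` n0"
    unfolding congruent_to_model_def by blast
  let ?\<alpha> = "diag_root Q 1 2" and ?\<beta> = "diag_root Q 2 3"
  obtain X c where adapted: "adapted_chevalley_basis (diag_flat Q) ?\<alpha> ?\<beta> X c"
    and X: "X ?\<alpha> = cscale (\<i> / of_real (sqrt 6)) (root_vec Q 1 2)" "X ?\<beta> = cscale (\<i> / of_real (sqrt 6)) (root_vec Q 2 3)"
    using adapted_chevalley_basis_exists[OF Q] .
  obtain t1 t2 t3 where t: "t1\<^sup>2 = t2\<^sup>2" "t1 \<noteq> 0" "t3 \<noteq> 0"
    and Xt: "X ?\<alpha> = cscale (\<i> * of_real (sqrt 2 * t1)) (root_vec Q 1 2)" "X ?\<beta> = cscale (\<i> * of_real (sqrt 2 * t2)) (root_vec Q 2 3)"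
    and M: "Mvec X ?\<alpha> + Mvec X ?\<beta> = conj_by Q (isym 0 0 t1 0 t2)" "Mvec X (?\<alpha> + ?\<beta>) = conj_by Q (isym 0 0 0 t3 0)"
    using adapted_chevalley_basis_diag_flat[OF Q _ adapted] by blast
  have "\<i> * complex_of_real (sqrt 2 * t1) = \<i> * of_real (sqrt 2 * t2)"
    using X Xt by (simp only: cscale_root_vec_eq_iff[OF Q])
  then have "t2 = 1 * t1"
    by simp
  note types = has_type_wrt_diag_flat[OF Q Hvec_diag_root[OF Q, folded diag_root_add[of Q 1 2 3]] M(1) t(2) this M(2) t(3)]
  have "has_type_wrt (diag_flat Q) ?\<alpha> ?\<beta> X t n"
  proof (cases "t = TypeM")
    case True
    then show ?thesis
      using types(2) n0 by simp
  next
    case False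
    then show ?thesis
      using types(1) n0 by blast
  qed
  moreover have "?\<alpha> \<noteq> ?\<beta>"
    using diag_root_eq_iff[OF Q, of 2 3 1 2] by simp
  ultimately show "has_type t n"
    unfolding has_type_def using maximal_flat_diag_flat[OF Q] simple_system_diag_roots[OF Q] adapted by blast
qed (rule congruent_to_model_if_has_type)

section \<open>Invariants and maximality\<close>

definition common_kernel :: "cmat3 set \<Rightarrow> bool" where
  "common_kernel n \<longleftrightarrow> (\<exists>v. v \<noteq> 0 \<and> (\<forall>A\<in>n. A *v v = 0))"

definition common_eigenvector :: "cmat3 set \<Rightarrow> bool" where
  "common_eigenvector n \<longleftrightarrow> (\<exists>v. v \<noteq> 0 \<and> (\<forall>A\<in>n. \<exists>l. A *v v = l *s v))"

lemma conj_by_matrix_vector: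
  assumes Q: "orthogonal_matrix Q"
  shows "conj_by Q A *v (cmat_of_real Q *v v) = cmat_of_real Q *v (A *v v)"
    and "cmat_of_real Q *v v = 0 \<longleftrightarrow> v = 0"
proof -
  have inv: "cmat_of_real (transpose Q) ** cmat_of_real Q = mat 1"
    using Q by (simp add: orthogonal_matrix_def flip: cmat_of_real_mult cmat_of_real_1)
  then have "cmat_of_real (transpose Q) *v (cmat_of_real Q *v w) = w" for w
    by (simp add: matrix_vector_mul_assoc)
  then show "conj_by Q A *v (cmat_of_real Q *v v) = cmat_of_real Q *v (A *v v)"
    "cmat_of_real Q *v v = 0 \<longleftrightarrow> v = 0"
    unfolding conj_by_def by (simp_all flip: matrix_vector_mul_assoc) (metis matrix_vector_mult_0_right)
qed

lemma common_kernel_conj_by: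
  assumes Q: "orthogonal_matrix Q" and "common_kernel n"
  shows "common_kernel (conj_by Q ` n)"
proof -
  obtain v where "v \<noteq> 0" "\<And>A. A \<in> n \<Longrightarrow> A *v v = 0"
    using assms(2) unfolding common_kernel_def by blast
  then show ?thesis
    unfolding common_kernel_def
    by (intro exI[of _ "cmat_of_real Q *v v"]) (simp add: conj_by_matrix_vector[OF Q])
qed

lemma common_eigenvector_conj_by:
  assumes Q: "orthogonal_matrix Q" and "common_eigenvector n"
  shows "common_eigenvector (conj_by Q ` n)"
proof -
  obtain v where v: "v \<noteq> 0" "\<And>A. A \<in> n \<Longrightarrow> \<exists>l. A *v v = l *s v"
    using assms(2) unfolding common_eigenvector_def by blast
  have "\<exists>l. conj_by Q A *v (cmat_of_real Q *v v) = l *s (cmat_of_real Q *v v)" if A: "A \<in> n" for A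
  proof -
    obtain l where "A *v v = l *s v"
      using v(2)[OF A] by blast
    then have "conj_by Q A *v (cmat_of_real Q *v v) = l *s (cmat_of_real Q *v v)"
      by (simp add: conj_by_matrix_vector(1)[OF Q] vector_scalar_commute)
    then show ?thesis ..
  qed
  then show ?thesis
    unfolding common_eigenvector_def using v(1)
    by (intro exI[of _ "cmat_of_real Q *v v"]) (simp add: conj_by_matrix_vector(2)[OF Q])
qed

lemma common_kernel_conj_by_iff:
  "orthogonal_matrix Q \<Longrightarrow> common_kernel (conj_by Q ` n) \<longleftrightarrow> common_kernel n"
  using common_kernel_conj_by[of Q n] common_kernel_conj_by[of "transpose Q" "conj_by Q ` n"]
  by (auto simp: conj_by_image_inverse)

lemma common_eigenvector_conj_by_iff:
  "orthogonal_matrix Q \<Longrightarrow> common_eigenvector (conj_by Q ` n) \<longleftrightarrow> common_eigenvector n"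
  using common_eigenvector_conj_by[of Q n] common_eigenvector_conj_by[of "transpose Q" "conj_by Q ` n"]
  by (auto simp: conj_by_image_inverse)

lemma common_eigenvector_mono: "common_eigenvector n' \<Longrightarrow> n \<subseteq> n' \<Longrightarrow> common_eigenvector n"
  unfolding common_eigenvector_def by blast

lemma isym_mult_vec:
  "(isym x y a b c *v v) $ 1 = \<i> * (of_real x * v$1 + of_real a * v$2 + of_real b * v$3)"
  "(isym x y a b c *v v) $ 2 = \<i> * (of_real a * v$1 + of_real y * v$2 + of_real c * v$3)"
  "(isym x y a b c *v v) $ 3 = \<i> * (of_real b * v$1 + of_real c * v$2 + of_real (- x - y) * v$3)"
  by (simp_all add: matrix_vector_mult_def sum_3 algebra_simps)

lemma isym_mult_axis2:
  "isym x y 0 b 0 *v axis 2 1 = (\<i> * of_real y) *s axis 2 1"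
  unfolding vec_eq_iff[of "_ *v _"] forall_3 isym_mult_vec by (simp add: axis_def)

text \<open>diag(1, 0, -1) has distinct eigenvalues, so a common eigenvector would lie on a
  coordinate axis, and \<open>isym 0 0 1 0 1\<close> preserves none of these.\<close>

lemma not_common_eigenvector_M: "\<not> common_eigenvector {isym x 0 a 0 a | x a. True}"
proof
  assume "common_eigenvector {isym x 0 a 0 a | x a. True}"
  then obtain v where v: "v \<noteq> 0" and eig: "\<And>x a. \<exists>l. isym x 0 a 0 a *v v = l *s v"
    unfolding common_eigenvector_def by blast
  obtain l m where l: "isym 1 0 0 0 0 *v v = l *s v" and m: "isym 0 0 1 0 1 *v v = m *s v"
    using eig by metis
  have l: "\<i> * v$1 = l * v$1" "l * v$2 = 0" "- \<i> * v$3 = l * v$3"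
    using arg_cong[OF l, of "\<lambda>w. w $ 1"] arg_cong[OF l, of "\<lambda>w. w $ 2"] arg_cong[OF l, of "\<lambda>w. w $ 3"]
    by (simp_all add: isym_mult_vec)
  have m: "\<i> * v$2 = m * v$1" "\<i> * (v$1 + v$3) = m * v$2" "\<i> * v$2 = m * v$3"
    using arg_cong[OF m, of "\<lambda>w. w $ 1"] arg_cong[OF m, of "\<lambda>w. w $ 2"] arg_cong[OF m, of "\<lambda>w. w $ 3"]
    by (simp_all add: isym_mult_vec)
  have "v$2 = 0"
  proof (rule ccontr)
    assume "v$2 \<noteq> 0"
    then have "l = 0" using l(2) by simp
    then have "v$1 = 0" using l(1) by simp
    then show False using m(1) \<open>v$2 \<noteq> 0\<close> by simp
  qed
  then have 13: "v$3 = - v$1"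
    using m(2) by (simp add: add_eq_0_iff)
  have "v$1 = 0"
  proof (rule ccontr)
    assume "v$1 \<noteq> 0"
    then have "l = \<i>" "l = - \<i>"
      using l(1,3) 13 by auto
    then show False by (simp add: complex_eq_iff)
  qed
  then show False
    using v 13 \<open>v$2 = 0\<close> by (simp add: vec_eq_iff forall_3)
qed

text \<open>The second basis vector is an eigenvector of every model but M. In type S it is killed,
  while the diagonal matrices in type P have no common kernel.\<close>

lemma congruent_to_model_invariants:
  assumes "congruent_to_model t n"
  shows "flat_subspace n \<longleftrightarrow> t = TypeG \<or> t = TypeT"
    and "common_eigenvector n \<longleftrightarrow> t \<noteq> TypeM"
    and "t = TypeS \<Longrightarrow> common_kernel n"
    and "t = TypeP \<Longrightarrow> \<not> common_kernel n"
proof -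
  obtain Q n0 where Q: "orthogonal_matrix Q" and n0: "model t n0" and n: "n = conj_by Q ` n0"
    using assms unfolding congruent_to_model_def by blast
  have sub: "subspace n0" "n0 \<subseteq> su3_m"
    using lie_triple_system_model[OF n0] by (simp_all add: lie_triple_system_def)
  have not_flat: "\<not> flat_subspace n0" if "A \<in> n0" "B \<in> n0" "lie_bracket A B \<noteq> 0" for A B
    using that unfolding flat_subspace_def by blast
  have "flat_subspace n0 \<longleftrightarrow> t = TypeG \<or> t = TypeT"
  proof (cases t)
    case TypeG
    then show ?thesis
      using n0 sub by (auto simp: flat_subspace_def lie_bracket_isym)
  next
    case TypeT
    then show ?thesis
      using n0 flat_diagonals by simp
  next
    case TypeS
    then have "isym 1 0 0 0 0 \<in> n0" "isym 0 0 0 1 0 \<in> n0"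
      using n0 by auto
    from not_flat[OF this] show ?thesis
      using TypeS by (simp add: lie_bracket_isym)
  next
    case TypeM
    then have "isym 1 0 0 0 0 \<in> n0" "isym 0 0 1 0 1 \<in> n0"
      using n0 by auto
    from not_flat[OF this] show ?thesis
      using TypeM by (simp add: lie_bracket_isym)
  next
    case TypeP
    then have "isym 1 0 0 0 0 \<in> n0" "isym 0 0 0 1 0 \<in> n0"
      using n0 by auto
    from not_flat[OF this] show ?thesis
      using TypeP by (simp add: lie_bracket_isym)
  qed
  then show "flat_subspace n \<longleftrightarrow> t = TypeG \<or> t = TypeT"
    by (simp add: n flat_subspace_conj_by_iff Q)
  have "axis 2 (1::complex) \<noteq> (0 :: complex^3)"
    by (simp add: axis_eq_0_iff)
  have "common_eigenvector n0" if "t \<noteq> TypeM"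
  proof -
    have "\<exists>x y b. A = isym x y 0 b 0" if A: "A \<in> n0" for A
      using n0 A \<open>t \<noteq> TypeM\<close> by (cases t) auto
    then show ?thesis
      unfolding common_eigenvector_def using isym_mult_axis2 \<open>axis 2 (1::complex) \<noteq> 0\<close> by metis
  qed
  then show "common_eigenvector n \<longleftrightarrow> t \<noteq> TypeM"
    using n0 not_common_eigenvector_M by (auto simp: n common_eigenvector_conj_by_iff Q)
  show "common_kernel n" if "t = TypeS"
  proof -
    have "A *v axis 2 1 = 0" if A: "A \<in> n0" for A
    proof -
      obtain x b where "A = isym x 0 0 b 0"
        using n0 A \<open>t = TypeS\<close> by auto
      then show ?thesis
        using isym_mult_axis2[of x 0 b] by simp
    qed
    then have "common_kernel n0"
      unfolding common_kernel_def using \<open>axis 2 (1::complex) \<noteq> 0\<close> by blast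
    then show ?thesis
      by (simp add: n common_kernel_conj_by_iff Q)
  qed
  show "\<not> common_kernel n" if "t = TypeP"
  proof
    assume "common_kernel n"
    then have "common_kernel n0"
      by (simp add: n common_kernel_conj_by_iff Q)
    then obtain v where v: "v \<noteq> 0" "\<And>A. A \<in> n0 \<Longrightarrow> A *v v = 0"
      unfolding common_kernel_def by blast
    have "isym 1 0 0 0 0 \<in> n0" "isym 0 1 0 0 0 \<in> n0"
      using n0 that by auto
    then have 1: "isym 1 0 0 0 0 *v v = 0" and 2: "isym 0 1 0 0 0 *v v = 0"
      using v(2) by blast+
    have "v$1 = 0" "v$2 = 0" "v$3 = 0"
      using arg_cong[OF 1, of "\<lambda>w. w $ 1"] arg_cong[OF 1, of "\<lambda>w. w $ 3"] arg_cong[OF 2, of "\<lambda>w. w $ 2"]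
      by (simp_all add: isym_mult_vec)
    then show False
      using v(1) by (simp add: vec_eq_iff forall_3)
  qed
qed

text \<open>These invariants do not distinguish G from T, but they separate the other four
  types.\<close>

lemma congruent_to_model_type_unique:
  assumes "congruent_to_model t n" "congruent_to_model t' n" "t \<noteq> TypeG" "t' \<noteq> TypeG"
  shows "t = t'"
  using congruent_to_model_invariants[OF assms(1)] congruent_to_model_invariants[OF assms(2)] assms(3,4)
  by (cases t; cases t'; simp)

text \<open>Only type G has a parameter.\<close>

lemma model_unique: "model t n \<Longrightarrow> model t n' \<Longrightarrow> t \<noteq> TypeG \<Longrightarrow> n = n'"
  by (cases t) simp_all

lemma congruent_to_model_congruent:
  assumes "congruent_to_model t n" "congruent_to_model t n'" "t \<noteq> TypeG"
  obtains Q where "orthogonal_matrix Q" "n' = conj_by Q ` n"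
proof -
  obtain Q n0 where Q: "orthogonal_matrix Q" "model t n0" "n = conj_by Q ` n0"
    using assms(1) unfolding congruent_to_model_def by blast
  obtain Q' where Q': "orthogonal_matrix Q'" "n' = conj_by Q' ` n0"
    using assms(2,3) model_unique[OF Q(2)] unfolding congruent_to_model_def by blast
  have "n' = conj_by (Q' ** transpose Q) ` n"
    unfolding Q(3) Q'(2) conj_by_image_mult[symmetric] conj_by_image_inverse(1)[OF Q(1)] ..
  then show ?thesis
    using that orthogonal_matrix_mul[OF Q'(1) orthogonal_transpose[OF Q(1)]] by blast
qed

text \<open>Congruent subspaces have equal dimension.\<close>

lemma congruent_to_model_subset_eq:
  assumes "congruent_to_model t n" "congruent_to_model t n'" "t \<noteq> TypeG" "n \<subseteq> n'"
  shows "n = n'"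
proof -
  obtain Q where Q: "orthogonal_matrix Q" "n' = conj_by Q ` n"
    using congruent_to_model_congruent[OF assms(1-3)] .
  have "subspace n" "subspace n'"
    using lie_triple_system_congruent_to_model assms(1,2) by (auto simp: lie_triple_system_def)
  moreover have "dim n' = dim n"
    unfolding Q(2) by (rule dim_image_eq[OF linear_conj_by]) (meson inj_conj_by[OF Q(1)] inj_on_subset subset_UNIV)
  ultimately show ?thesis
    using assms(4) by (intro subspace_dim_equal) simp_all
qed

section \<open>Maximality\<close>

lemma model_neq_su3_m: "model t n \<Longrightarrow> n \<noteq> su3_m"
proof
  assume t: "model t n" "n = su3_m"
  have "isym 0 0 1 0 0 \<in> n"
    by (simp add: t(2))
  then show False
    using t(1) by (cases t) auto
qed

lemma congruent_to_model_neq_su3_m: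
  assumes "congruent_to_model t n"
  shows "n \<noteq> su3_m"
proof -
  obtain Q n0 where Q: "orthogonal_matrix Q" "model t n0" "n = conj_by Q ` n0"
    using assms unfolding congruent_to_model_def by blast
  then show ?thesis
    using model_neq_su3_m[OF Q(2)] conj_by_image_inverse(1)[OF Q(1), of n0]
      conj_by_image_su3_m[OF orthogonal_transpose[OF Q(1)]] by metis
qed

lemma not_maximal_if_model_subset:
  assumes "orthogonal_matrix Q" "model t' n1" "n0 \<subset> n1"
  shows "\<not> maximal_lie_triple_system (conj_by Q ` n0)"
proof
  assume max: "maximal_lie_triple_system (conj_by Q ` n0)"
  have "congruent_to_model t' (conj_by Q ` n1)"
    unfolding congruent_to_model_def using assms(1,2) by blast
  then have "lie_triple_system (conj_by Q ` n1)" "conj_by Q ` n1 \<noteq> su3_m"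
    using lie_triple_system_congruent_to_model congruent_to_model_neq_su3_m by simp_all
  moreover have "conj_by Q ` n0 \<subseteq> conj_by Q ` n1"
    using assms(3) by (intro image_mono) simp
  ultimately have "conj_by Q ` n1 = conj_by Q ` n0"
    using max by (simp add: maximal_lie_triple_system_def)
  then have "n1 = n0"
    using conj_by_image_inverse(1)[OF assms(1)] by metis
  then show False
    using assms(3) by blast
qed

text \<open>The models of G lie properly in that of T, and those of T and S in that of P.
  Conversely, above type M there is still no common eigenvector, and above type P all diagonal
  matrices are present while flatness is excluded; so the type persists and dimensions
  agree.\<close>

lemma maximal_lie_triple_system_iff:
  assumes n: "congruent_to_model t n"
  shows "maximal_lie_triple_system n \<longleftrightarrow> t = TypeP \<or> t = TypeM"
proof
  assume max: "maximal_lie_triple_system n"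
  obtain Q n0 where Q: "orthogonal_matrix Q" and n0: "model t n0" and eq: "n = conj_by Q ` n0"
    using n unfolding congruent_to_model_def by blast
  have no: False if "model t' n1" "n0 \<subseteq> n1" "A \<in> n1" "A \<notin> n0" for t' n1 A
    using not_maximal_if_model_subset[OF Q that(1), of n0] that(2-4) max eq by blast
  show "t = TypeP \<or> t = TypeM"
  proof (cases t)
    case TypeG
    then obtain x y where n0: "n0 = {isym (r * x) (r * y) 0 0 0 | r. True}"
      using n0 by auto
    have "isym 1 0 0 0 0 \<notin> n0 \<or> isym 0 1 0 0 0 \<notin> n0"
      by (auto simp: n0)
    moreover have "model TypeT {isym x y 0 0 0 | x y. True}" "n0 \<subseteq> {isym x y 0 0 0 | x y. True}"
      by (auto simp: n0)
    ultimately show ?thesis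
      using no[of TypeT "{isym x y 0 0 0 | x y. True}"] by blast
  next
    case TypeT
    then show ?thesis
      using no[of TypeP "{isym x y 0 b 0 | x y b. True}" "isym 0 0 0 1 0"] n0 by auto
  next
    case TypeS
    then show ?thesis
      using no[of TypeP "{isym x y 0 b 0 | x y b. True}" "isym 0 1 0 0 0"] n0 by auto
  qed simp_all
next
  assume t: "t = TypeP \<or> t = TypeM"
  show "maximal_lie_triple_system n"
    unfolding maximal_lie_triple_system_def
  proof (intro conjI allI impI)
    show lts: "lie_triple_system n" "n \<noteq> su3_m"
      using n lie_triple_system_congruent_to_model congruent_to_model_neq_su3_m by blast+
    fix n' assume n': "lie_triple_system n' \<and> n' \<noteq> su3_m \<and> n \<subseteq> n'"
    have not_flat: "\<not> flat_subspace n"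
      using congruent_to_model_invariants(1)[OF n] t by auto
    have "n' \<noteq> {0}"
    proof
      assume "n' = {0}"
      then have "n \<subseteq> {0}"
        using n' by blast
      then have "flat_subspace n"
        using lts(1) by (auto simp: flat_subspace_def lie_triple_system_def lie_bracket_def)
      then show False
        using not_flat by blast
    qed
    have not_flat': "\<not> flat_subspace n'"
    proof
      assume "flat_subspace n'"
      then have "flat_subspace n"
        using n' lts(1) by (auto simp: flat_subspace_def lie_triple_system_def subset_iff)
      then show False
        using not_flat by blast
    qed
    have "\<exists>t'. congruent_to_model t' n'"
      using lie_triple_system_classification n' \<open>n' \<noteq> {0}\<close> by blast
    then obtain t' where t': "congruent_to_model t' n'" ..
    have "t' = t"
      using t
    proof
      assume "t = TypeM"
      then have "\<not> common_eigenvector n'"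
        using congruent_to_model_invariants(2)[OF n] common_eigenvector_mono n' by blast
      then show ?thesis
        using congruent_to_model_invariants(2)[OF t'] \<open>t = TypeM\<close> by blast
    next
      assume P: "t = TypeP"
      obtain Q where Q: "orthogonal_matrix Q" "n = conj_by Q ` {isym x y 0 b 0 | x y b. True}"
        using n unfolding P congruent_to_model_def model.simps by blast
      have "{isym x y 0 b 0 | x y b. True} = conj_by (transpose Q) ` n"
        unfolding Q(2) conj_by_image_inverse(1)[OF Q(1)] ..
      then have sub: "{isym x y 0 b 0 | x y b. True} \<subseteq> conj_by (transpose Q) ` n'"
        using n' by blast
      have "lie_triple_system (conj_by (transpose Q) ` n')"
        using n' Q(1) by (simp add: lie_triple_system_conj_by)
      moreover have "conj_by (transpose Q) ` n' \<noteq> su3_m"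
        using congruent_to_model_neq_su3_m[OF congruent_to_model_conj_by[OF orthogonal_transpose[OF Q(1)] t']] .
      moreover have "isym x y 0 0 0 \<in> conj_by (transpose Q) ` n'" for x y
        using sub by blast
      ultimately have "congruent_to_model TypeT (conj_by (transpose Q) ` n') \<or> congruent_to_model TypeP (conj_by (transpose Q) ` n')"
        using lie_triple_system_above_diagonals by blast
      then have "congruent_to_model TypeT n' \<or> congruent_to_model TypeP n'"
        using congruent_to_model_conj_by_transpose[OF Q(1)] by blast
      then have "congruent_to_model TypeP n'"
        using not_flat' congruent_to_model_invariants(1) by blast
      moreover have "t' \<noteq> TypeG"
        using not_flat' congruent_to_model_invariants(1)[OF t'] by blast
      ultimately show ?thesis
        using congruent_to_model_type_unique[OF t'] P by blast
    qed
    then show "n' = n"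
      using congruent_to_model_subset_eq[OF n, of n'] t t' n' by auto
  qed
qed

theorem proposition6p1:
  shows "(\<forall>n. subspace n \<and> {0} \<noteq> n \<and> n \<subset> su3_m \<longrightarrow>
            (lie_triple_system n \<longleftrightarrow> (\<exists>t. has_type t n)))
       \<and> (\<forall>n1 n2 t1 t2.
            lie_triple_system n1 \<and> lie_triple_system n2 \<and>
            t1 \<noteq> TypeG \<and> t2 \<noteq> TypeG \<and> has_type t1 n1 \<and> has_type t2 n2 \<longrightarrow>
            (isotropy_congruent n1 n2 \<longleftrightarrow> t1 = t2))
       \<and> (\<forall>n. lie_triple_system n \<and> {0} \<noteq> n \<and> n \<subset> su3_m \<longrightarrow>
            (maximal_lie_triple_system n \<longleftrightarrow> has_type TypeP n \<or> has_type TypeM n))"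
  unfolding has_type_iff
proof (intro conjI allI impI)
  fix n assume "subspace n \<and> {0} \<noteq> n \<and> n \<subset> su3_m"
  then show "lie_triple_system n \<longleftrightarrow> (\<exists>t. congruent_to_model t n)"
    using lie_triple_system_classification[of n] lie_triple_system_congruent_to_model by blast
next
  fix n1 n2 t1 t2
  assume "lie_triple_system n1 \<and> lie_triple_system n2 \<and> t1 \<noteq> TypeG \<and> t2 \<noteq> TypeG \<and>
    congruent_to_model t1 n1 \<and> congruent_to_model t2 n2"
  then have t: "t1 \<noteq> TypeG" "t2 \<noteq> TypeG" "congruent_to_model t1 n1" "congruent_to_model t2 n2"
    by auto
  show "isotropy_congruent n1 n2 \<longleftrightarrow> t1 = t2"
    unfolding isotropy_congruent_iff
  proof
    assume "\<exists>Q. orthogonal_matrix Q \<and> n2 = conj_by Q ` n1"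
    then have "congruent_to_model t1 n2"
      using congruent_to_model_conj_by t(3) by blast
    then show "t1 = t2"
      using congruent_to_model_type_unique t by blast
  next
    assume "t1 = t2"
    then show "\<exists>Q. orthogonal_matrix Q \<and> n2 = conj_by Q ` n1"
      using congruent_to_model_congruent[of t1 n1 n2] t by blast
  qed
next
  fix n assume n: "lie_triple_system n \<and> {0} \<noteq> n \<and> n \<subset> su3_m"
  then obtain t where "congruent_to_model t n"
    using lie_triple_system_classification by blast
  then show "maximal_lie_triple_system n \<longleftrightarrow> congruent_to_model TypeP n \<or> congruent_to_model TypeM n"
    using maximal_lie_triple_system_iff by blast
qed

end
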